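(* Let $m>0$, $\sigma>0$, $\tau>0$ and $(\alpha,\beta,\gamma)\in Q$, let $\mathcal{H}$ and $\mathcal{A}$ be the Hilbert space and the operator defined in the context, and suppose that $(T(t))_{t\ge 0}$ is the $C_0$-semigroup of contractions on $\mathcal{H}$ generated by $\mathcal{A}$. Then for $t\ge 1$, $$\Big\|T(t)\,\mathcal{A}\,(I-\mathcal{A})^{-\left(1+\frac{2(2\alpha-\beta-\gamma)}{2\alpha-\gamma}\right)}\Big\|=O(t^{-1}),$$ and $$\big\|T(t)\,\mathcal{A}\,(I-\mathcal{A})^{-2}\big\|=O(t^{-1/a}),\qquad a=\max\Big\{1,\ \frac{2(2\alpha-\beta-\gamma)}{2\alpha-\gamma}\Big\}.$$ Moreover, the decay rate $O(t^{-1/a})$ in the second estimate is sharp if $\alpha\ge \beta+\frac{\gamma}{2}$.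
   Context: $H$ is an infinite-dimensional complex Hilbert space with inner product $(\cdot,\cdot)$ and norm $\|\cdot\|$; $A$ is a self-adjoint, positive definite operator on $H$ with compact resolvent (so its eigenvalues form a sequence $0<\mu_1\le\mu_2\le\cdots\to\infty$). For $s\in\mathbb{R}$, $A^s$ denotes the fractional power; $\mathcal{D}(A^s)$ carries the norm $\|A^s\cdot\|$, and for $s<0$ it denotes the completion of $H$ in this norm. Expressions such as $A^\alpha v$ are understood in these extrapolation spaces. Parameter region: $$Q=\Big\{(\alpha,\beta,\gamma)\in[0,1]\times[0,1]\times(0,1]\ :\ \alpha>\tfrac{\beta+1}{2}\Big\}.$$ The space is $\mathcal{H}=\mathcal{D}(A^{1/2})\times\mathcal{D}(A^{\gamma/2})\times H\times H$ with inner product $$\langle U_1,U_2\rangle_{\mathcal{H}}=\sigma(A^{1/2}u_1,A^{1/2}u_2)+m(A^{\gamma/2}v_1,A^{\gamma/2}v_2)+(v_1,v_2)+(\theta_1,\theta_2)+\tau(q_1,q_2),\quad U_i=(u_i,v_i,\theta_i,q_i)^\top .$$ The operator $\mathcal{A}:\mathcal{D}(\mathcal{A})\subseteq\mathcal{H}\to\mathcal{H}$ is $$\mathcal{A}\,(u,v,\theta,q)^\top=\Big(v,\ -(I+mA^\gamma)^{-1}(\sigma Au-A^\alpha\theta),\ -A^\alpha v+A^{\beta/2}q,\ \tfrac1\tau(-q-A^{\beta/2}\theta)\Big)^\top,$$ with domain the set of all $(u,v,\theta,q)^\top\in\mathcal{H}$ such that $v\in\mathcal{D}(A^{1/2})$,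 $\sigma Au-A^\alpha\theta\in\mathcal{D}(A^{-\gamma/2})$, $-A^\alpha v+A^{\beta/2}q\in H$, and $q+A^{\beta/2}\theta\in H$. It is the first-order form of the system $u_{tt}+mA^\gamma u_{tt}+\sigma Au-A^\alpha\theta=0$, $\theta_t-A^{\beta/2}q+A^\alpha u_t=0$, $\tau q_t+q+A^{\beta/2}\theta=0$. $\|\cdot\|$ of an operator is the operator norm on $\mathcal{H}$; $(I-\mathcal{A})^{-s}$, $s>0$, is the fractional power of the invertible sectorial operator $I-\mathcal{A}$. "$f(t)=O(g(t))$ for $t\ge1$" means there is a constant $C$ with $|f(t)|\le C g(t)$ for all $t\ge1$. "The decay rate $O(t^{-1/a})$ is sharp" means that the exponent cannot be improved: there is no $\delta>0$ such that the norm is $O(t^{-1/a-\delta})$ as $t\to\infty$. *)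

theory Defs
  imports "HOL-Analysis.Analysis"
begin

section \<open>Complex Hilbert spaces\<close>

class complex_vector = real_vector +
  fixes scaleC :: "complex \<Rightarrow> 'a \<Rightarrow> 'a"  (infixr \<open>*\<^sub>C\<close> 75)
  assumes scaleC_add_right: "c *\<^sub>C (x + y) = c *\<^sub>C x + c *\<^sub>C y"
    and scaleC_add_left: "(c + d) *\<^sub>C x = c *\<^sub>C x + d *\<^sub>C x"
    and scaleC_scaleC: "c *\<^sub>C (d *\<^sub>C x) = (c * d) *\<^sub>C x"
    and scaleR_scaleC: "r *\<^sub>R x = complex_of_real r *\<^sub>C x"

lemma scaleC_one: "1 *\<^sub>C x = (x :: 'a :: complex_vector)"
  using scaleR_scaleC[of 1 x] by simp

global_interpretation complex_vector: vector_space "scaleC :: complex \<Rightarrow> 'a \<Rightarrow> 'a :: complex_vector"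
  by standard (simp_all add: scaleC_add_right scaleC_add_left scaleC_scaleC scaleC_one)

instantiation prod :: (complex_vector, complex_vector) complex_vector
begin

definition scaleC_prod_def: "c *\<^sub>C p = (c *\<^sub>C fst p, c *\<^sub>C snd p)"

instance
  by standard (simp_all add: scaleC_prod_def scaleR_prod_def plus_prod_def
      scaleC_add_right scaleC_add_left scaleC_scaleC scaleR_scaleC)

end

text \<open>
  The inner product is linear in its first argument. The norm and the topology are those of the
  underlying real inner product \<open>Re (cinner x y)\<close>.
\<close>

class complex_inner = complex_vector + real_inner +
  fixes cinner :: "'a \<Rightarrow> 'a \<Rightarrow> complex"
  assumes cinner_commute: "cinner x y = cnj (cinner y x)"
    and cinner_add_left: "cinner (x + y) z = cinner x z + cinner y z"
    and cinner_scaleC_left: "cinner (c *\<^sub>C x) y = c * cinner x y"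
    and inner_eq_Re_cinner: "inner x y = Re (cinner x y)"

class chilbert_space = complex_inner + complete_space


section \<open>Unbounded operators\<close>

text \<open>The values of \<open>opfun\<close> outside \<open>opdom\<close> carry no meaning.\<close>

record 'a operator =
  opdom :: "'a set"
  opfun :: "'a \<Rightarrow> 'a"

definition clinear_on :: "'a::complex_vector set \<Rightarrow> ('a \<Rightarrow> 'a) \<Rightarrow> bool" where
  "clinear_on D f \<longleftrightarrow> complex_vector.subspace D \<and>
     (\<forall>x\<in>D. \<forall>y\<in>D. f (x + y) = f x + f y) \<and> (\<forall>c. \<forall>x\<in>D. f (c *\<^sub>C x) = c *\<^sub>C f x)"

text \<open>The last conjunct says that the graph of the adjoint is the graph of \<open>A\<close>.\<close>

definition selfadjoint :: "'h::chilbert_space operator \<Rightarrow> bool" where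
  "selfadjoint A \<longleftrightarrow> clinear_on (opdom A) (opfun A) \<and> closure (opdom A) = UNIV \<and>
     (\<forall>y z. (\<forall>x\<in>opdom A. cinner (opfun A x) y = cinner x z) \<longleftrightarrow> y \<in> opdom A \<and> opfun A y = z)"

definition positive_definite :: "'h::chilbert_space operator \<Rightarrow> bool" where
  "positive_definite A \<longleftrightarrow> (\<forall>x\<in>opdom A. x \<noteq> 0 \<longrightarrow> Re (cinner (opfun A x) x) > 0)"

definition compact_resolvent :: "'h::chilbert_space operator \<Rightarrow> bool" where
  "compact_resolvent A \<longleftrightarrow> (\<exists>z. bij_betw (\<lambda>x. z *\<^sub>C x - opfun A x) (opdom A) UNIV \<and>
     compact (closure (inv_into (opdom A) (\<lambda>x. z *\<^sub>C x - opfun A x) ` cball 0 1)))"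


section \<open>Fractional powers of \<open>A\<close> and the extrapolation spaces\<close>

definition eigenspace :: "'h::chilbert_space operator \<Rightarrow> real \<Rightarrow> 'h set" where
  "eigenspace A \<mu> = {x \<in> opdom A. opfun A x = \<mu> *\<^sub>R x}"

text \<open>Orthogonal projection onto an eigenspace (it is \<open>0\<close> if \<open>\<mu>\<close> is not an eigenvalue).\<close>

definition eigproj :: "'h::chilbert_space operator \<Rightarrow> real \<Rightarrow> 'h \<Rightarrow> 'h" where
  "eigproj A \<mu> x = (THE y. y \<in> eigenspace A \<mu> \<and> (\<forall>z\<in>eigenspace A \<mu>. cinner (x - y) z = 0))"

text \<open>
  All spaces \<open>D(A^s)\<close>, \<open>s\<close> real, are realised inside one vector space, that of the formal
  eigenvector expansions \<open>\<Sum>\<mu>. X \<mu>\<close> with \<open>X \<mu>\<close> in the eigenspace of \<open>\<mu>\<close>. A vector \<open>x\<close> of the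
  Hilbert space is identified with its expansion \<open>embed A x\<close>. The expansions in \<open>ext_space A s\<close>
  are those with \<open>\<Sum>\<mu>. \<parallel>\<mu>^s X \<mu>\<parallel>^2 < \<infinity>\<close>; for \<open>s < 0\<close> this is the completion of the Hilbert space
  in the norm \<open>\<parallel>A^s x\<parallel>\<close>: it is complete, \<open>embed\<close> is isometric for that norm, and the
  finitely supported expansions are dense in it and lie in the range of \<open>embed\<close>.
\<close>

definition embed :: "'h::chilbert_space operator \<Rightarrow> 'h \<Rightarrow> real \<Rightarrow> 'h" where
  "embed A x = (\<lambda>\<mu>. eigproj A \<mu> x)"

definition ext_space :: "'h::chilbert_space operator \<Rightarrow> real \<Rightarrow> (real \<Rightarrow> 'h) set" where
  "ext_space A s = {X. (\<forall>\<mu>. X \<mu> \<in> eigenspace A \<mu>) \<and>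
                       (\<lambda>\<mu>. (norm (\<mu> powr s *\<^sub>R X \<mu>))\<^sup>2) summable_on UNIV}"

text \<open>
  \<open>ext_pow A s x\<close> is \<open>A^s x\<close> as a formal expansion, for an arbitrary vector \<open>x\<close>.
  For \<open>s \<ge> 0\<close>, \<open>pow_dom A s\<close> is the domain of \<open>A^s\<close> as an operator in the Hilbert space, and
  \<open>frac_pow A s\<close> its action there.
\<close>

definition ext_pow :: "'h::chilbert_space operator \<Rightarrow> real \<Rightarrow> 'h \<Rightarrow> real \<Rightarrow> 'h" where
  "ext_pow A s x = (\<lambda>\<mu>. \<mu> powr s *\<^sub>R embed A x \<mu>)"

definition pow_dom :: "'h::chilbert_space operator \<Rightarrow> real \<Rightarrow> 'h set" where
  "pow_dom A s = {x. embed A x \<in> ext_space A s}"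

definition frac_pow :: "'h::chilbert_space operator \<Rightarrow> real \<Rightarrow> 'h \<Rightarrow> 'h" where
  "frac_pow A s x = (\<Sum>\<^sub>\<infinity>\<mu>. \<mu> powr s *\<^sub>R eigproj A \<mu> x)"

text \<open>The inverse of \<open>I + m A^\<gamma>\<close>, which maps \<open>D(A^(\<gamma>/2))\<close> onto \<open>D(A^(-\<gamma>/2))\<close>.\<close>

definition inv_I_plus_pow :: "'h::chilbert_space operator \<Rightarrow> real \<Rightarrow> real \<Rightarrow> (real \<Rightarrow> 'h) \<Rightarrow> 'h" where
  "inv_I_plus_pow A m \<gamma> = inv_into (pow_dom A (\<gamma>/2)) (\<lambda>w \<mu>. embed A w \<mu> + m *\<^sub>R ext_pow A \<gamma> w \<mu>)"


section \<open>The energy space and the system operator\<close>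

definition param_region :: "(real \<times> real \<times> real) set" where
  "param_region = {(\<alpha>, \<beta>, \<gamma>). \<alpha> \<in> {0..1} \<and> \<beta> \<in> {0..1} \<and> \<gamma> \<in> {0<..1} \<and> \<alpha> > (\<beta> + 1) / 2}"

type_synonym 'h state = "'h \<times> 'h \<times> 'h \<times> 'h"

definition energy_space :: "'h::chilbert_space operator \<Rightarrow> real \<Rightarrow> 'h state set" where
  "energy_space A \<gamma> = pow_dom A (1/2) \<times> pow_dom A (\<gamma>/2) \<times> UNIV \<times> UNIV"

fun energy_inner ::
  "'h::chilbert_space operator \<Rightarrow> real \<Rightarrow> real \<Rightarrow> real \<Rightarrow> real \<Rightarrow> 'h state \<Rightarrow> 'h state \<Rightarrow> complex" where
  "energy_inner A \<sigma> m \<tau> \<gamma> (u\<^sub>1, v\<^sub>1, \<theta>\<^sub>1, q\<^sub>1) (u\<^sub>2, v\<^sub>2, \<theta>\<^sub>2, q\<^sub>2) =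
     complex_of_real \<sigma> * cinner (frac_pow A (1/2) u\<^sub>1) (frac_pow A (1/2) u\<^sub>2)
     + complex_of_real m * cinner (frac_pow A (\<gamma>/2) v\<^sub>1) (frac_pow A (\<gamma>/2) v\<^sub>2)
     + cinner v\<^sub>1 v\<^sub>2 + cinner \<theta>\<^sub>1 \<theta>\<^sub>2 + complex_of_real \<tau> * cinner q\<^sub>1 q\<^sub>2"

definition energy_norm ::
  "'h::chilbert_space operator \<Rightarrow> real \<Rightarrow> real \<Rightarrow> real \<Rightarrow> real \<Rightarrow> 'h state \<Rightarrow> real" where
  "energy_norm A \<sigma> m \<tau> \<gamma> U = sqrt (Re (energy_inner A \<sigma> m \<tau> \<gamma> U U))"

text \<open>
  Membership of an expansion in the Hilbert space means membership in \<open>range (embed A)\<close>;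
  \<open>inv (embed A)\<close> turns it back into a vector.
\<close>

definition system_op ::
  "'h::chilbert_space operator \<Rightarrow> real \<Rightarrow> real \<Rightarrow> real \<Rightarrow> real \<Rightarrow> real \<Rightarrow> real \<Rightarrow> 'h state operator" where
  "system_op A \<sigma> m \<tau> \<alpha> \<beta> \<gamma> =
     \<lparr>opdom = {(u, v, \<theta>, q). (u, v, \<theta>, q) \<in> energy_space A \<gamma> \<and>
         v \<in> pow_dom A (1/2) \<and>
         (\<lambda>\<mu>. \<sigma> *\<^sub>R ext_pow A 1 u \<mu> - ext_pow A \<alpha> \<theta> \<mu>) \<in> ext_space A (- \<gamma>/2) \<and>
         (\<lambda>\<mu>. - ext_pow A \<alpha> v \<mu> + ext_pow A (\<beta>/2) q \<mu>) \<in> range (embed A) \<and>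
         (\<lambda>\<mu>. embed A q \<mu> + ext_pow A (\<beta>/2) \<theta> \<mu>) \<in> range (embed A)},
      opfun = (\<lambda>(u, v, \<theta>, q).
        (v,
         - inv_I_plus_pow A m \<gamma> (\<lambda>\<mu>. \<sigma> *\<^sub>R ext_pow A 1 u \<mu> - ext_pow A \<alpha> \<theta> \<mu>),
         inv (embed A) (\<lambda>\<mu>. - ext_pow A \<alpha> v \<mu> + ext_pow A (\<beta>/2) q \<mu>),
         (1/\<tau>) *\<^sub>R inv (embed A) (\<lambda>\<mu>. - embed A q \<mu> - ext_pow A (\<beta>/2) \<theta> \<mu>)))\<rparr>"


section \<open>Operators and semigroups on a normed space given by a carrier and a norm\<close>

text \<open>
  The energy space is a proper subset of its ambient type, with a norm different from the
  ambient one, so the following notions take a carrier \<open>X\<close> and a norm \<open>N\<close> on it.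
  The operator norm is extended-real valued, so an unbounded operator has norm \<open>\<infinity>\<close>.
\<close>

definition op_norm :: "'x set \<Rightarrow> ('x \<Rightarrow> real) \<Rightarrow> ('x \<Rightarrow> 'x) \<Rightarrow> ereal" where
  "op_norm X N B = (SUP U\<in>{U\<in>X. N U \<le> 1}. ereal (N (B U)))"

definition contraction_semigroup ::
  "'x::complex_vector set \<Rightarrow> ('x \<Rightarrow> real) \<Rightarrow> (real \<Rightarrow> 'x \<Rightarrow> 'x) \<Rightarrow> bool" where
  "contraction_semigroup X N T \<longleftrightarrow>
     (\<forall>t\<ge>0. clinear_on X (T t) \<and> (\<forall>U\<in>X. T t U \<in> X \<and> N (T t U) \<le> N U)) \<and>
     (\<forall>U\<in>X. T 0 U = U) \<and>
     (\<forall>s\<ge>0. \<forall>t\<ge>0. \<forall>U\<in>X. T (s + t) U = T s (T t U)) \<and>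
     (\<forall>U\<in>X. ((\<lambda>t. N (T t U - U)) \<longlongrightarrow> 0) (at_right 0))"

definition is_generator ::
  "'x::complex_vector set \<Rightarrow> ('x \<Rightarrow> real) \<Rightarrow> (real \<Rightarrow> 'x \<Rightarrow> 'x) \<Rightarrow> 'x operator \<Rightarrow> bool" where
  "is_generator X N T B \<longleftrightarrow>
     (let has_deriv = (\<lambda>U V. ((\<lambda>t. N ((1/t) *\<^sub>R (T t U - U) - V)) \<longlongrightarrow> 0) (at_right 0))
      in opdom B = {U\<in>X. \<exists>V\<in>X. has_deriv U V} \<and>
         (\<forall>U\<in>opdom B. opfun B U \<in> X \<and> has_deriv U (opfun B U)))"

definition I_minus :: "'x::complex_vector operator \<Rightarrow> 'x operator" where
  "I_minus B = \<lparr>opdom = opdom B, opfun = (\<lambda>U. U - opfun B U)\<rparr>"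

text \<open>
  The fractional power \<open>P^(-s)\<close>, \<open>s > 0\<close>, of an invertible sectorial operator \<open>P\<close>, by Balakrishnan's
  formula: for an integer \<open>n > s\<close> (here \<open>n = \<lfloor>s\<rfloor> + 1\<close>; the value does not depend on this choice)
  \[ P^{-s} U = \frac{\Gamma(n)}{\Gamma(s)\,\Gamma(n-s)}
       \int_0^\infty \lambda^{n-s-1} (\lambda + P)^{-n} U \, d\lambda , \]
  an improper integral converging in the norm \<open>N\<close>. For \<open>0 < s < 1\<close> the factor is
  \<open>sin (\<pi> s) / \<pi>\<close>. The integrals over the compact intervals \<open>[\<epsilon>, R]\<close> are formed in the ambient
  space; if \<open>(X, N)\<close> is a Banach space continuously embedded in it, they agree with the integrals
  formed in \<open>(X, N)\<close>, since the integrand is continuous for \<open>N\<close>.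
\<close>

definition neg_power ::
  "'x::{complex_vector, real_normed_vector} set \<Rightarrow> ('x \<Rightarrow> real) \<Rightarrow> 'x operator \<Rightarrow> real \<Rightarrow> 'x \<Rightarrow> 'x" where
  "neg_power X N P s U =
     (let n = nat \<lfloor>s\<rfloor> + 1;
          c = Gamma (real n) / (Gamma s * Gamma (real n - s));
          Res = (\<lambda>l. inv_into (opdom P) (\<lambda>V. l *\<^sub>R V + opfun P V))
      in THE W. W \<in> X \<and>
           ((\<lambda>(\<epsilon>, R). N (c *\<^sub>R integral {\<epsilon>..R} (\<lambda>l. l powr (real n - s - 1) *\<^sub>R (Res l ^^ n) U) - W))
              \<longlongrightarrow> 0) (at_right 0 \<times>\<^sub>F at_top))"

end

theory Submission
  imports Defs
begin

text \<open>
  All coefficients of the system are functions of the one operator \<open>A\<close>, whose eigenvectors form a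
  complete system. The system therefore splits into blocks, one for each eigenvalue \<open>\<mu>\<close>. In the
  coordinates \<open>w = sqrt (\<sigma> \<mu>) u\<close>, \<open>p = sqrt (1 + m \<mu>^\<gamma>) v\<close>, \<open>\<theta>\<close>, \<open>r = sqrt \<tau> q\<close> the energy norm is the
  Hilbert norm and a block is the damped chain

  \<open>w' = \<omega> p\<close>, \<open>p' = - \<omega> w + \<kappa> \<theta>\<close>, \<open>\<theta>' = - \<kappa> p + \<nu> r\<close>, \<open>r' = - \<nu> \<theta> - \<delta> r\<close>

  with \<open>\<omega> = sqrt (\<sigma> \<mu> / (1 + m \<mu>^\<gamma>))\<close>, \<open>\<kappa> = \<mu>^\<alpha> / sqrt (1 + m \<mu>^\<gamma>)\<close>, \<open>\<nu> = \<mu>^(\<beta>/2) / sqrt \<tau>\<close>,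
  \<open>\<delta> = 1 / \<tau>\<close>. The condition \<open>\<alpha> > (\<beta> + 1) / 2\<close> makes \<open>\<kappa>\<close> dominant: \<open>\<omega> / \<kappa>\<close>, \<open>\<nu> / \<kappa>\<close> and
  \<open>\<omega> \<nu> / \<kappa>\<close> are bounded over the spectrum. A block is then a fast pair, essentially \<open>(p, \<theta>)\<close>, that
  rotates with frequency about \<open>\<kappa>\<close> and is damped at a rate of order \<open>(\<nu> / \<kappa>)^2\<close>, which is of the
  order \<open>\<kappa>^(-b)\<close> with the \<open>b\<close> of the theorem, and a slow pair, essentially \<open>(w, r)\<close>, on which the
  generator \<open>M\<close> of the block is small where its decay is slow.

  Upper bounds. On the fast pair \<open>M (I - M)^(-s)\<close> has size \<open>\<kappa>^(1 - s)\<close>, and the supremum over \<open>\<kappa>\<close> of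
  \<open>\<kappa>^(1 - s) exp (- c \<kappa>^(-b) t)\<close> has order \<open>t^(-(s - 1) / b)\<close>. On the slow pair a mode with decay
  rate \<open>\<rho>\<close> contributes about \<open>\<rho> exp (- \<rho> t)\<close>, which is at most \<open>1 / t\<close>. So the norm is
  \<open>O(t^(-1) + t^(-(s - 1) / b))\<close>; the choices \<open>s = 1 + b\<close> and \<open>s = 2\<close> give the two claims. Eigenvectors
  of the blocks are avoided, because they are hard to control uniformly. With a suitable \<open>\<Omega>^2 \<ge> \<kappa>^2\<close>
  (the square of the fast frequency up to smaller terms) one writes
  \<open>\<Omega>^2 M = (M^3 + \<Omega>^2 M) - M^3\<close>. The first summand nearly annihilates the fast pair, and it decays like
  \<open>1 / t\<close> by a duality argument: \<open>M\<close> is similar to its adjoint by a reflection \<open>J\<close>, hence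
  \<open>\<langle>(M^3 + \<Omega>^2 M) x(v), J y(t - v)\<rangle>\<close> is constant in \<open>v\<close> for two solutions \<open>x, y\<close>, while its integral
  over \<open>v\<close> is bounded by \<open>\<kappa>^2\<close> times the dissipation of \<open>x\<close> and \<open>y\<close>
  (lemmas \<open>slow_form_le\<close>, \<open>slow_flow_decay\<close>). For the second summand the exponential decay of the
  whole block (lemma \<open>flow_decay\<close>) is used together with \<open>\<parallel>M^3 (I - M)^(-s)\<parallel> \<le> C \<kappa>^(3 - s)\<close>
  (lemma \<open>neg_pow_bounds_high\<close>), valid for \<open>1 < s \<le> 3\<close>; since \<open>0 < b \<le> 2\<close>, this range contains
  \<open>1 + b\<close> and \<open>2\<close>.

  Sharpness. The solution that starts at \<open>M e\<close>, where \<open>e\<close> is a unit vector with only a \<open>p\<close> component,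
  has no slow part, and it keeps half of its energy up to times of order \<open>(\<kappa> / \<nu>)^2\<close>, that is \<open>\<kappa>^b\<close>
  (lemma \<open>flow_lower_bound\<close>). It is \<open>M T(t) (I - M)^(-2)\<close> applied to a vector of size at most of order
  \<open>\<kappa>^2\<close>, so the norm is at least of order \<open>1 / \<kappa>\<close> at such times. The eigenvalues are unbounded because
  the space has infinite dimension, so no power better than \<open>t^(-1/b)\<close> can hold; if
  \<open>\<alpha> \<ge> \<beta> + \<gamma>/2\<close> then \<open>b \<ge> 1\<close> and \<open>b = a\<close>.

  The rest is the passage between the blocks and the whole space: completeness of the eigenvectors
  (lemma \<open>spectral_completeness\<close>), the isometry \<open>to_state\<close> onto the energy space and the description of
  the generator through it (lemmas \<open>opdom_iff\<close>, \<open>opfun_eq\<close>), and the evaluation of the Balakrishnan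
  integral through the powers of the resolvent (lemma \<open>neg_power_eq\<close>).
\<close>

section \<open>The damped chain\<close>

definition chain :: "real \<Rightarrow> real \<Rightarrow> real \<Rightarrow> real \<Rightarrow> 'a::real_vector \<times> 'a \<times> 'a \<times> 'a \<Rightarrow> 'a \<times> 'a \<times> 'a \<times> 'a" where
  "chain \<omega> \<kappa> \<nu> \<delta> = (\<lambda>(w, p, \<theta>, r).
     (\<omega> *\<^sub>R p, \<kappa> *\<^sub>R \<theta> - \<omega> *\<^sub>R w, \<nu> *\<^sub>R r - \<kappa> *\<^sub>R p, - \<delta> *\<^sub>R r - \<nu> *\<^sub>R \<theta>))"

lemma linear_chain: "linear (chain \<omega> \<kappa> \<nu> \<delta>)"
  by (rule linearI) (auto simp: chain_def algebra_simps split: prod.split)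

lemma norm_quad: "(norm (w, p, \<theta>, r))\<^sup>2 = (norm w)\<^sup>2 + (norm p)\<^sup>2 + (norm \<theta>)\<^sup>2 + (norm r)\<^sup>2"
  by (simp add: norm_Pair)

lemma norm_quad_le: "norm (w, p, \<theta>, r) \<le> norm w + norm p + norm \<theta> + norm r"
proof -
  have "norm (w, p, \<theta>, r) \<le> norm w + norm (p, \<theta>, r)" by (rule norm_Pair_le)
  also have "norm (p, \<theta>, r) \<le> norm p + norm (\<theta>, r)" by (rule norm_Pair_le)
  also have "norm (\<theta>, r) \<le> norm \<theta> + norm r" by (rule norm_Pair_le)
  finally show ?thesis by (simp add: add.assoc)
qed

lemma nonincreasing_of_deriv:
  fixes f :: "real \<Rightarrow> real"
  assumes "0 \<le> t" and "\<And>s. 0 \<le> s \<Longrightarrow> s \<le> t \<Longrightarrow> (f has_real_derivative f' s) (at s within {0..t})"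
    and "\<And>s. 0 \<le> s \<Longrightarrow> s \<le> t \<Longrightarrow> f' s \<le> 0"
  shows "f t \<le> f 0"
proof -
  have "\<exists>s\<in>{0..t}. f t - f 0 = f' s * (t - 0)"
    using assms(1,2) by (intro mvt_very_simple) (auto simp: has_field_derivative_def)
  then show ?thesis using assms(1,3)
    by (smt (verit, best) atLeastAtMost_iff mult_nonneg_nonpos mult.commute)
qed

lemma constant_of_deriv:
  fixes f :: "real \<Rightarrow> real"
  assumes "0 \<le> t" and "\<And>s. 0 \<le> s \<Longrightarrow> s \<le> t \<Longrightarrow> (f has_real_derivative 0) (at s within {0..t})"
  shows "f t = f 0"
proof -
  have "\<exists>s\<in>{0..t}. f t - f 0 = 0 * (t - 0)"
    using assms by (intro mvt_very_simple) (simp_all only: has_field_derivative_def)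
  then show ?thesis by simp
qed

text \<open>
  Derivatives are one-sided at \<open>0\<close>, because orbits of a semigroup live on the half-line only.
\<close>

definition is_flow :: "('b::real_normed_vector \<Rightarrow> 'b) \<Rightarrow> (real \<Rightarrow> 'b) \<Rightarrow> bool" where
  "is_flow M x \<longleftrightarrow> (\<forall>t\<ge>0. (x has_vector_derivative M (x t)) (at t within {0..}))"

lemma is_flowD: "is_flow M x \<Longrightarrow> 0 \<le> s \<Longrightarrow> (x has_vector_derivative M (x s)) (at s within {0..t})"
  unfolding is_flow_def by (meson atLeastatMost_subset_iff has_vector_derivative_within_subset
      Icc_subset_Ici_iff order_refl)

lemma is_flow_image:
  assumes "is_flow M x" "bounded_linear L" "\<And>y. L (M y) = M (L y)"
  shows "is_flow M (\<lambda>t. L (x t))"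
  using assms bounded_linear.has_vector_derivative unfolding is_flow_def by fastforce

text \<open>
  All functionals below are sums of such bilinear terms, so this lemma differentiates each of them.
\<close>

lemma is_flow_form_deriv:
  fixes L1 L2 :: "'b::real_normed_vector \<Rightarrow> 'a::real_inner"
  assumes "is_flow M x" "bounded_linear L1" "bounded_linear L2" "0 \<le> s"
  shows "((\<lambda>t. inner (L1 (x t)) (L2 (x t))) has_real_derivative
     inner (L1 (M (x s))) (L2 (x s)) + inner (L1 (x s)) (L2 (M (x s)))) (at s within {0..t})"
proof -
  have "((\<lambda>t. L (x t)) has_vector_derivative L (M (x s))) (at s within {0..t})"
    if "bounded_linear L" for L :: "'b \<Rightarrow> 'a"
    using bounded_linear.has_vector_derivative[OF that is_flowD[OF assms(1,4)]] .
  from bounded_bilinear.has_vector_derivative[OF bounded_bilinear_inner this[OF assms(2)] this[OF assms(3)]]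
  show ?thesis by (simp add: has_real_derivative_iff_has_vector_derivative add.commute)
qed

lemma young: "(c::real) * x * y \<le> x\<^sup>2 / 2 + c\<^sup>2 * y\<^sup>2 / 2"
  using zero_le_power2[of "x - c * y"] by (simp add: power2_eq_square algebra_simps)

lemma coeff_inner_le:
  fixes x y :: "'a::real_inner"
  assumes "\<bar>c\<bar> \<le> C * a * b"  "a \<ge> 0" "b \<ge> 0"
  shows "c * inner x y \<le> C * (a * norm x) * (b * norm y)"
proof -
  have "c * inner x y \<le> \<bar>c\<bar> * \<bar>inner x y\<bar>" by (metis abs_ge_self abs_mult)
  also have "\<dots> \<le> (C * a * b) * (norm x * norm y)"
    using assms by (intro mult_mono Cauchy_Schwarz_ineq2) auto
  finally show ?thesis by (simp add: mult_ac)
qed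

text \<open>
  \<open>K\<close> is a common bound for all quantities that have to stay bounded over the spectrum. Every estimate
  of a block depends on \<open>K\<close> and, explicitly, on \<open>\<kappa>\<close> and \<open>\<nu> / \<kappa>\<close>; this is what makes the blocks
  uniformly controllable.
\<close>

locale damped_chain =
  fixes \<omega> \<kappa> \<nu> \<delta> K :: real
  assumes pos: "\<omega> > 0" "\<kappa> > 0" "\<nu> > 0" "\<delta> > 0" and K1: "K \<ge> 1"
    and om_le: "\<omega> \<le> K * \<kappa>" and nu_le: "\<nu> \<le> K * \<kappa>" and omnu_le: "\<omega> * \<nu> \<le> K * \<kappa>"
    and ka_ge: "1 \<le> K * \<kappa>" and om_ge: "1 \<le> K * \<omega>" and de_le: "\<delta> \<le> K" and de_ge: "1 \<le> K * \<delta>"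
begin

abbreviation M where "M \<equiv> chain \<omega> \<kappa> \<nu> \<delta>"

text \<open>
  The fast pair \<open>(p, \<theta>)\<close> is damped at a rate of order \<open>s\<^sup>2\<close>, and the slow coordinate \<open>slow_w\<close> at a rate
  of order \<open>e\<^sup>2\<close>. For these reasons \<open>s\<close> and \<open>e\<close> are the weights in the dissipation below.
\<close>

definition "s = \<nu> / \<kappa>"
definition "e = \<omega> * \<nu> / \<kappa>"
definition "g = \<kappa>\<^sup>2 / (\<kappa>\<^sup>2 + \<omega>\<^sup>2)"

text \<open>
  The coordinates \<open>w\<close> and \<open>r\<close> are corrected by small multiples of \<open>\<theta>\<close> and \<open>p\<close> such that the fast terms
  drop out of their equations: \<open>slow_w' = e r\<close> contains no \<open>p\<close>, and \<open>slow_r' = - g e slow_w - \<delta> r\<close>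
  contains no \<open>\<theta>\<close>. The factor \<open>g\<close> is the solution of the linear equation that the second cancellation
  requires.
\<close>

definition slow_w :: "'a::real_inner \<times> 'a \<times> 'a \<times> 'a \<Rightarrow> 'a" where
  "slow_w = (\<lambda>(w, p, \<theta>, r). w + (\<omega> / \<kappa>) *\<^sub>R \<theta>)"
definition slow_r :: "'a::real_inner \<times> 'a \<times> 'a \<times> 'a \<Rightarrow> 'a" where
  "slow_r = (\<lambda>(w, p, \<theta>, r). r + (g * s) *\<^sub>R p)"
definition p_of :: "'a \<times> 'a \<times> 'a \<times> 'a \<Rightarrow> 'a" where "p_of = (\<lambda>(w, p, \<theta>, r). p)"
definition th_of :: "'a \<times> 'a \<times> 'a \<times> 'a \<Rightarrow> 'a" where "th_of = (\<lambda>(w, p, \<theta>, r). \<theta>)"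
definition r_of :: "'a \<times> 'a \<times> 'a \<times> 'a \<Rightarrow> 'a" where "r_of = (\<lambda>(w, p, \<theta>, r). r)"

text \<open>
  Only \<open>r\<close> is damped directly. The other three terms are what the multipliers recover through the
  coupling, with the weights that the small damping allows.
\<close>

definition dissipation :: "'a::real_inner \<times> 'a \<times> 'a \<times> 'a \<Rightarrow> real" where
  "dissipation x = (e * norm (slow_w x))\<^sup>2 + (norm (r_of x))\<^sup>2 + (s * norm (p_of x))\<^sup>2 + (s * norm (th_of x))\<^sup>2"

lemma bounded_linear_coords:
  "bounded_linear slow_w" "bounded_linear slow_r" "bounded_linear p_of" "bounded_linear th_of" "bounded_linear r_of"
  unfolding slow_w_def slow_r_def p_of_def th_of_def r_of_def case_prod_unfold
  by (intro bounded_linear_intros)+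

lemma bounded_linear_chain: "bounded_linear (M :: 'a::real_inner \<times> 'a \<times> 'a \<times> 'a \<Rightarrow> _)"
  unfolding chain_def case_prod_unfold by (intro bounded_linear_intros)

lemma s_bounds: "s > 0" "s \<le> K" "e > 0" "e \<le> K" "g > 0" "g \<le> 1" "1 \<le> (1 + K\<^sup>2) * g" "e = \<omega> * s" "\<omega> / \<kappa> \<le> K" "\<omega> / \<kappa> > 0"
      "1 / \<kappa> \<le> K" "\<delta> / \<kappa> \<le> K\<^sup>2"
proof -
  show "s > 0" "s \<le> K" "e > 0" "e \<le> K" "e = \<omega> * s" "\<omega> / \<kappa> \<le> K" "1 / \<kappa> \<le> K" "\<omega> / \<kappa> > 0"
    using pos nu_le omnu_le om_le ka_ge by (auto simp: s_def e_def pos_divide_le_eq)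
  have p: "\<kappa>\<^sup>2 > 0" "\<kappa>\<^sup>2 + \<omega>\<^sup>2 > 0" using pos by (auto intro: add_pos_pos)
  show "g > 0" "g \<le> 1" using p by (auto simp: g_def)
  have "\<omega>\<^sup>2 \<le> K\<^sup>2 * \<kappa>\<^sup>2" using om_le pos by (metis less_imp_le power_mono power_mult_distrib)
  then show "1 \<le> (1 + K\<^sup>2) * g" using p by (simp add: g_def field_simps)
  show "\<delta> / \<kappa> \<le> K\<^sup>2" using mult_mono[OF de_le \<open>1 / \<kappa> \<le> K\<close>] pos K1 by (simp add: power2_eq_square)
qed

lemma slow_w_chain: "slow_w (M x) = e *\<^sub>R r_of x"
  using pos by (cases x) (simp add: slow_w_def chain_def r_of_def e_def algebra_simps)

lemma slow_r_chain: "slow_r (M x) = - (g * e) *\<^sub>R slow_w x - \<delta> *\<^sub>R r_of x"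
proof -
  obtain w p \<theta> r where x: "x = (w, p, \<theta>, r)" by (cases x)
  have n: "\<kappa>\<^sup>2 + \<omega>\<^sup>2 \<noteq> 0" using pos by (simp add: add_nonneg_eq_0_iff)
  have g1: "g * s * \<omega> = g * e" by (simp add: s_def e_def)
  have g2: "g * s * \<kappa> = \<nu> - g * e * (\<omega> / \<kappa>)" using n pos
    by (simp add: s_def e_def g_def divide_simps) (simp add: power2_eq_square algebra_simps)
  have "slow_r (M x) = - \<delta> *\<^sub>R r - \<nu> *\<^sub>R \<theta> + (g * s * \<kappa>) *\<^sub>R \<theta> - (g * s * \<omega>) *\<^sub>R w"
    by (simp add: x slow_r_def chain_def algebra_simps)
  then show ?thesis unfolding g1 g2 by (simp only: x slow_w_def r_of_def split_conv) (simp add: algebra_simps)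
qed

lemma inner_chain: "inner (M x) x = - \<delta> * (norm (r_of x))\<^sup>2"
  by (cases x) (simp add: chain_def r_of_def inner_simps inner_commute power2_norm_eq_inner)

lemma norm_comp_le: "norm (p_of x) \<le> norm x" "norm (th_of x) \<le> norm x" "norm (r_of x) \<le> norm x"
  "norm (fst x) \<le> norm x"
  for x :: "'a::real_inner \<times> 'a \<times> 'a \<times> 'a"
  by (cases x; auto simp: p_of_def th_of_def r_of_def norm_Pair intro!: real_le_rsqrt)+

lemma norm_slow_w_le: "norm (slow_w x) \<le> (1 + K) * norm x"
proof -
  have "norm (slow_w x) \<le> norm (fst x) + (\<omega> / \<kappa>) * norm (th_of x)"
    using s_bounds(10) norm_triangle_ineq[of "fst x" "(\<omega> / \<kappa>) *\<^sub>R th_of x"]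
      pos by (cases x) (simp add: slow_w_def th_of_def)
  also have "\<dots> \<le> norm x + K * norm x"
    using s_bounds norm_comp_le[of x] K1 by (intro add_mono mult_mono) auto
  finally show ?thesis by (simp add: algebra_simps)
qed

lemma norm_slow_r_le: "norm (slow_r x) \<le> (1 + K) * norm x"
proof -
  have "norm (slow_r x) \<le> norm (r_of x) + (g * s) * norm (p_of x)"
    using s_bounds by (cases x) (auto simp: slow_r_def r_of_def p_of_def abs_mult intro: norm_triangle_le)
  also have "\<dots> \<le> norm x + (1 * K) * norm x"
    using s_bounds norm_comp_le[of x] K1 by (intro add_mono mult_mono) auto
  finally show ?thesis by (simp add: algebra_simps)
qed

section \<open>Exponential decay of the chain\<close>

text \<open>
  The damping of \<open>r\<close> is carried along the chain by three multipliers. The first is \<open>\<langle>\<theta>, r\<rangle>\<close>: since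
  \<open>r'\<close> contains \<open>- \<nu> \<theta>\<close>, its derivative is negative in \<open>\<theta>\<close>, up to terms that contain \<open>r\<close>.
\<close>

lemma mult_tr:
  "(\<nu> / \<kappa>\<^sup>2) * (inner (th_of (M x)) (r_of x) + inner (th_of x) (r_of (M x))) \<le>
   - (s * norm (th_of x))\<^sup>2 + K\<^sup>2 * (norm (r_of x))\<^sup>2 + 1 * (s * norm (p_of x)) * (1 * norm (r_of x)) + K\<^sup>2 * (s * norm (th_of x)) * (1 * norm (r_of x))"
proof -
  obtain w p \<theta> r where x: "x = (w, p, \<theta>, r)" by (cases x)
  have "(\<nu> / \<kappa>\<^sup>2) * (inner (th_of (M x)) (r_of x) + inner (th_of x) (r_of (M x))) =
     s\<^sup>2 * (norm r)\<^sup>2 - s\<^sup>2 * (norm \<theta>)\<^sup>2 + (- s) * inner p r + (- (s * (\<delta> / \<kappa>))) * inner \<theta> r"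
    using pos by (simp add: x chain_def th_of_def r_of_def inner_simps inner_commute power2_norm_eq_inner)
      (simp add: s_def field_simps power2_eq_square[of \<kappa>] power2_eq_square[of \<nu>])
  moreover have "(- s) * inner p r \<le> 1 * (s * norm p) * (1 * norm r)"
    using s_bounds by (intro coeff_inner_le) auto
  moreover have "(- (s * (\<delta> / \<kappa>))) * inner \<theta> r \<le> K\<^sup>2 * (s * norm \<theta>) * (1 * norm r)"
  proof (rule coeff_inner_le)
    have "s * (\<delta> / \<kappa>) \<le> s * K\<^sup>2" using s_bounds by (intro mult_left_mono) auto
    then show "\<bar>- (s * (\<delta> / \<kappa>))\<bar> \<le> K\<^sup>2 * s * 1" using s_bounds pos by (simp add: mult_ac)
  qed (use s_bounds in auto)
  moreover have "s\<^sup>2 * (norm r)\<^sup>2 \<le> K\<^sup>2 * (norm r)\<^sup>2"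
    using s_bounds by (intro mult_right_mono power_mono) auto
  ultimately show ?thesis by (simp add: x r_of_def p_of_def th_of_def power_mult_distrib)
qed

text \<open>
  The second multiplier \<open>\<langle>p, \<theta>\<rangle>\<close> gains \<open>p\<close> from the term \<open>- \<kappa> p\<close> of \<open>\<theta>'\<close> and pays with \<open>\<theta>\<close>, which
  the first one controls. Replacing \<open>w\<close> by \<open>slow_w\<close> leaves the coupling with \<open>\<theta>\<close> in the weights of the
  dissipation.
\<close>

lemma mult_pt:
  "(s\<^sup>2 / \<kappa>) * (inner (p_of (M x)) (th_of x) + inner (p_of x) (th_of (M x))) \<le>
   - (s * norm (p_of x))\<^sup>2 + (1 + K\<^sup>2) * (s * norm (th_of x))\<^sup>2 + K * (e * norm (slow_w x)) * (s * norm (th_of x))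
     + K\<^sup>2 * (s * norm (p_of x)) * (1 * norm (r_of x))"
proof -
  obtain w p \<theta> r where x: "x = (w, p, \<theta>, r)" by (cases x)
  have w: "w = slow_w x - (\<omega> / \<kappa>) *\<^sub>R \<theta>" by (simp add: x slow_w_def)
  have "(s\<^sup>2 / \<kappa>) * (inner (p_of (M x)) (th_of x) + inner (p_of x) (th_of (M x))) =
     (s\<^sup>2 / \<kappa>) * (\<kappa> * (norm \<theta>)\<^sup>2 - \<omega> * inner w \<theta> + \<nu> * inner p r - \<kappa> * (norm p)\<^sup>2)"
    using pos by (simp add: x chain_def th_of_def p_of_def inner_simps inner_commute power2_norm_eq_inner)
  also have "\<dots> = (1 + (\<omega> / \<kappa>)\<^sup>2) * (s\<^sup>2 * (norm \<theta>)\<^sup>2) - s\<^sup>2 * (norm p)\<^sup>2 + (- (e * s / \<kappa>)) * inner (slow_w x) \<theta>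
       + (s\<^sup>2 * s) * inner p r"
    using pos by (subst w) (simp add: inner_simps power2_norm_eq_inner s_bounds(8), simp add: s_def field_simps power2_eq_square)
  finally have "(s\<^sup>2 / \<kappa>) * (inner (p_of (M x)) (th_of x) + inner (p_of x) (th_of (M x))) = \<dots>" .
  moreover have "(- (e * s / \<kappa>)) * inner (slow_w x) \<theta> \<le> K * (e * norm (slow_w x)) * (s * norm \<theta>)"
  proof (rule coeff_inner_le)
    have "(e * s) * (1 / \<kappa>) \<le> (e * s) * K" using s_bounds by (intro mult_left_mono) auto
    then show "\<bar>- (e * s / \<kappa>)\<bar> \<le> K * e * s" using s_bounds pos by (simp add: mult_ac)
  qed (use s_bounds in auto)
  moreover have "(s\<^sup>2 * s) * inner p r \<le> K\<^sup>2 * (s * norm p) * (1 * norm r)"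
    using s_bounds by (intro coeff_inner_le) auto
  moreover have "(1 + (\<omega> / \<kappa>)\<^sup>2) * (s\<^sup>2 * (norm \<theta>)\<^sup>2) \<le> (1 + K\<^sup>2) * (s\<^sup>2 * (norm \<theta>)\<^sup>2)"
    using s_bounds by (intro mult_right_mono add_mono power_mono) auto
  ultimately show ?thesis by (simp add: x r_of_def p_of_def th_of_def power_mult_distrib)
qed

lemma slow_r_split: "inner y (slow_r x) = inner y (r_of x) + (g * s) * inner y (p_of x)"
  by (cases x) (simp add: slow_r_def r_of_def p_of_def inner_simps)

text \<open>
  The third multiplier gains \<open>slow_w\<close> from the term \<open>- g e slow_w\<close> of \<open>slow_r'\<close>. With \<open>w\<close> and \<open>r\<close> in place of
  the slow coordinates the derivative would contain products of the undamped coordinates.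
\<close>

lemma mult_slow:
  "e * (inner (slow_w (M x)) (slow_r x) + inner (slow_w x) (slow_r (M x))) \<le>
   - g * (e * norm (slow_w x))\<^sup>2 + K\<^sup>2 * (norm (r_of x))\<^sup>2 + K\<^sup>2 * (s * norm (p_of x)) * (1 * norm (r_of x))
    + K * (e * norm (slow_w x)) * (1 * norm (r_of x))"
proof -
  have "e * (inner (slow_w (M x)) (slow_r x) + inner (slow_w x) (slow_r (M x))) =
    e\<^sup>2 * (norm (r_of x))\<^sup>2 + (e\<^sup>2 * (g * s)) * inner (p_of x) (r_of x) - g * (e\<^sup>2 * (norm (slow_w x))\<^sup>2) + (- (\<delta> * e)) * inner (slow_w x) (r_of x)"
    unfolding slow_w_chain slow_r_chain
    by (simp add: inner_simps slow_r_split power2_norm_eq_inner)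
      (simp add: inner_commute algebra_simps power2_eq_square)
  moreover have "(e\<^sup>2 * (g * s)) * inner (p_of x) (r_of x) \<le> K\<^sup>2 * (s * norm (p_of x)) * (1 * norm (r_of x))"
  proof (rule coeff_inner_le)
    have "e\<^sup>2 * g \<le> K\<^sup>2 * 1" using s_bounds by (intro mult_mono power_mono) auto
    then show "\<bar>e\<^sup>2 * (g * s)\<bar> \<le> K\<^sup>2 * s * 1" using s_bounds by (simp add: abs_mult mult.assoc[symmetric])
  qed (use s_bounds in auto)
  moreover have "(- (\<delta> * e)) * inner (slow_w x) (r_of x) \<le> K * (e * norm (slow_w x)) * (1 * norm (r_of x))"
    using s_bounds pos de_le by (intro coeff_inner_le) auto
  moreover have "e\<^sup>2 * (norm (r_of x))\<^sup>2 \<le> K\<^sup>2 * (norm (r_of x))\<^sup>2"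
    using s_bounds by (intro mult_right_mono power_mono) auto
  ultimately show ?thesis by (simp add: power_mult_distrib)
qed

text \<open>
  The weights of the multipliers. \<open>cA\<close> lets the gain in \<open>\<theta>\<close> pay for its loss in \<open>mult_pt\<close>, \<open>cB\<close> makes
  the gain in \<open>slow_w\<close> at least \<open>2\<close>, and \<open>cN\<close> lets the damping of \<open>r\<close> absorb all cross terms with
  \<open>r\<close> and keeps the functional equivalent to the squared norm.
\<close>

definition "cA = 2 + 2 * K\<^sup>2"
definition "cB = 2 * (1 + K\<^sup>2)"
definition "cN = 2 * (cA * K\<^sup>2 + K ^ 3 + cB * K * (1 + K)\<^sup>2) + 1 +
  K * (cA * K\<^sup>2 + cB * K\<^sup>2 + (cA + K\<^sup>2 + cB * K\<^sup>2)\<^sup>2 / 2 + (cA * K\<^sup>2)\<^sup>2 / 2 + (cB * K)\<^sup>2 / 2 + 1 / 2)"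

definition lyap :: "'a::real_inner \<times> 'a \<times> 'a \<times> 'a \<Rightarrow> real" where
  "lyap x = cN / 2 * inner x x + cA * (\<nu> / \<kappa>\<^sup>2) * inner (th_of x) (r_of x)
     + (s\<^sup>2 / \<kappa>) * inner (p_of x) (th_of x) + cB * e * inner (slow_w x) (slow_r x)"

definition lyap' :: "'a::real_inner \<times> 'a \<times> 'a \<times> 'a \<Rightarrow> real" where
  "lyap' x = cN / 2 * (inner (M x) x + inner x (M x))
     + cA * (\<nu> / \<kappa>\<^sup>2) * (inner (th_of (M x)) (r_of x) + inner (th_of x) (r_of (M x)))
     + (s\<^sup>2 / \<kappa>) * (inner (p_of (M x)) (th_of x) + inner (p_of x) (th_of (M x)))
     + cB * e * (inner (slow_w (M x)) (slow_r x) + inner (slow_w x) (slow_r (M x)))"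

lemma cA_pos: "cA > 0" "cB > 0" "cN \<ge> 1"
proof -
  show "cA > 0" "cB > 0" by (auto simp: cA_def cB_def add_pos_nonneg)
  then show "cN \<ge> 1" using K1 unfolding cN_def by (auto intro!: add_nonneg_nonneg)
qed

lemma lyap_deriv:
  fixes x :: "real \<Rightarrow> 'a::real_inner \<times> 'a \<times> 'a \<times> 'a"
  assumes "is_flow M x" "0 \<le> u"
  shows "((\<lambda>t. lyap (x t)) has_real_derivative lyap' (x u)) (at u within {0..t})"
proof -
  note d = is_flow_form_deriv[OF assms(1) _ _ assms(2)]
  show ?thesis unfolding lyap_def lyap'_def
    by (rule DERIV_add DERIV_cmult d bounded_linear_coords bounded_linear_ident)+
qed

lemma lyap'_le: "lyap' x \<le> - dissipation x / 2"
proof -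
  define W R P H where d: "W = e * norm (slow_w x)" "R = norm (r_of x)" "P = s * norm (p_of x)" "H = s * norm (th_of x)"
  define c1 where "c1 = cA + K\<^sup>2 + cB * K\<^sup>2"
  have N: "cN / 2 * (inner (M x) x + inner x (M x)) = - (cN * \<delta>) * R\<^sup>2"
    by (simp add: inner_commute[of x] inner_chain d)
  have 1: "cA * ((\<nu> / \<kappa>\<^sup>2) * (inner (th_of (M x)) (r_of x) + inner (th_of x) (r_of (M x)))) \<le>
    cA * (- H\<^sup>2 + K\<^sup>2 * R\<^sup>2 + P * R + K\<^sup>2 * H * R)"
    using mult_tr[of x] cA_pos by (intro mult_left_mono) (auto simp: d)
  have 2: "(s\<^sup>2 / \<kappa>) * (inner (p_of (M x)) (th_of x) + inner (p_of x) (th_of (M x))) \<le>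
      - P\<^sup>2 + (1 + K\<^sup>2) * H\<^sup>2 + K * W * H + K\<^sup>2 * P * R"
    using mult_pt[of x] by (simp add: d)
  have 3: "cB * (e * (inner (slow_w (M x)) (slow_r x) + inner (slow_w x) (slow_r (M x)))) \<le>
    cB * (- g * W\<^sup>2 + K\<^sup>2 * R\<^sup>2 + K\<^sup>2 * P * R + K * W * R)"
    using mult_slow[of x] cA_pos by (intro mult_left_mono) (auto simp: d)
  \<comment> \<open>The cross terms are distributed by Young's inequality: one half of the square of
    every gained quantity is left, and the damping of \<open>r\<close> takes all squares of
    \<open>R\<close>.\<close>
  have "2 \<le> cB * g" using s_bounds(7) by (simp add: cB_def algebra_simps)
  then have "3 / 2 * W\<^sup>2 \<le> cB * g * W\<^sup>2" by (intro mult_right_mono) auto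
  moreover have "1 * (K * \<delta>) \<ge> 1" using de_ge by simp
  then have cc: "(cA * K\<^sup>2 + cB * K\<^sup>2 + c1\<^sup>2 / 2 + (cA * K\<^sup>2)\<^sup>2 / 2 + (cB * K)\<^sup>2 / 2 + 1 / 2) \<le>
    (K * \<delta>) * (cA * K\<^sup>2 + cB * K\<^sup>2 + c1\<^sup>2 / 2 + (cA * K\<^sup>2)\<^sup>2 / 2 + (cB * K)\<^sup>2 / 2 + 1 / 2)" (is "?c \<le> _")
    using mult_right_mono[of 1 "K * \<delta>" ?c] cA_pos K1 by (simp add: add_nonneg_nonneg)
  have "(K * \<delta>) * ?c \<le> cN * \<delta>"
    using cA_pos K1 pos unfolding cN_def c1_def by (simp add: algebra_simps)
  with cc have "?c \<le> cN * \<delta>" by linarith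
  then have "?c * R\<^sup>2 \<le> cN * \<delta> * R\<^sup>2" by (intro mult_right_mono) auto
  moreover have "K * W * H \<le> W\<^sup>2 / 2 + K\<^sup>2 * H\<^sup>2 / 2" by (rule young)
  moreover have "c1 * P * R \<le> P\<^sup>2 / 2 + c1\<^sup>2 * R\<^sup>2 / 2" by (rule young)
  moreover have "(cA * K\<^sup>2) * H * R \<le> H\<^sup>2 / 2 + (cA * K\<^sup>2)\<^sup>2 * R\<^sup>2 / 2" by (rule young)
  moreover have "(cB * K) * W * R \<le> W\<^sup>2 / 2 + (cB * K)\<^sup>2 * R\<^sup>2 / 2" by (rule young)
  moreover obtain z where z: "K\<^sup>2 * H\<^sup>2 = z" "H\<^sup>2 * K\<^sup>2 = z" "0 \<le> z" by (simp add: mult.commute)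
  moreover have "cA * H\<^sup>2 = 2 * H\<^sup>2 + 2 * z" unfolding z(1)[symmetric] by (simp add: cA_def algebra_simps)
  ultimately have "- (cN * \<delta>) * R\<^sup>2 + cA * (- H\<^sup>2 + K\<^sup>2 * R\<^sup>2 + P * R + K\<^sup>2 * H * R)
     + (- P\<^sup>2 + (1 + K\<^sup>2) * H\<^sup>2 + K * W * H + K\<^sup>2 * P * R)
     + cB * (- g * W\<^sup>2 + K\<^sup>2 * R\<^sup>2 + K\<^sup>2 * P * R + K * W * R) \<le> - (W\<^sup>2 + R\<^sup>2 + P\<^sup>2 + H\<^sup>2) / 2"
    unfolding c1_def by (simp add: algebra_simps z(1,2))
  note t = this
  have "lyap' x \<le> - (W\<^sup>2 + R\<^sup>2 + P\<^sup>2 + H\<^sup>2) / 2"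
  proof -
    have "lyap' x = cN / 2 * (inner (M x) x + inner x (M x))
     + cA * ((\<nu> / \<kappa>\<^sup>2) * (inner (th_of (M x)) (r_of x) + inner (th_of x) (r_of (M x))))
     + (s\<^sup>2 / \<kappa>) * (inner (p_of (M x)) (th_of x) + inner (p_of x) (th_of (M x)))
     + cB * (e * (inner (slow_w (M x)) (slow_r x) + inner (slow_w x) (slow_r (M x))))"
      by (simp only: lyap'_def mult.assoc)
    then show ?thesis using t N 1 2 3 by linarith
  qed
  then show ?thesis by (simp add: dissipation_def d)
qed

lemma abs_coeff_inner_le:
  fixes x y :: "'a::real_inner"
  assumes "\<bar>c\<bar> \<le> C" "norm x \<le> a" "norm y \<le> b"
  shows "\<bar>c * inner x y\<bar> \<le> C * (a * b)"
proof -
  have "0 \<le> a" using assms norm_ge_zero[of x] by linarith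
  then have "\<bar>inner x y\<bar> \<le> a * b"
    by (intro order.trans[OF Cauchy_Schwarz_ineq2 mult_mono]) (use assms in auto)
  then show ?thesis using assms unfolding abs_mult by (intro mult_mono) auto
qed

lemma lyap_bounds: "(norm x)\<^sup>2 / 2 \<le> lyap x" "lyap x \<le> cN * (norm x)\<^sup>2"
proof -
  have abs3: "\<bar>a\<bar> \<le> a' \<Longrightarrow> \<bar>b\<bar> \<le> b' \<Longrightarrow> \<bar>c\<bar> \<le> c' \<Longrightarrow> u = a + b + c \<Longrightarrow> d = a' + b' + c' \<Longrightarrow> \<bar>u\<bar> \<le> d"
    for a b c a' b' c' u d :: real by linarith
  define D where "D = cA * K\<^sup>2 + K ^ 3 + cB * K * (1 + K)\<^sup>2"
  have "\<bar>cA * (\<nu> / \<kappa>\<^sup>2) * inner (th_of x) (r_of x)\<bar> \<le> (cA * K\<^sup>2) * (norm x * norm x)"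
  proof (rule abs_coeff_inner_le)
    have "cA * (s * (1 / \<kappa>)) \<le> cA * (K * K)" using s_bounds cA_pos pos K1 by (intro mult_left_mono mult_mono) auto
    then show "\<bar>cA * (\<nu> / \<kappa>\<^sup>2)\<bar> \<le> cA * K\<^sup>2" using cA_pos pos by (simp add: s_def power2_eq_square)
  qed (auto simp: norm_comp_le)
  moreover have "\<bar>(s\<^sup>2 / \<kappa>) * inner (p_of x) (th_of x)\<bar> \<le> K^3 * (norm x * norm x)"
  proof (rule abs_coeff_inner_le)
    have "s\<^sup>2 * (1 / \<kappa>) \<le> K\<^sup>2 * K" using s_bounds pos by (intro mult_mono power_mono) auto
    then show "\<bar>s\<^sup>2 / \<kappa>\<bar> \<le> K ^ 3" using pos by (simp add: power2_eq_square power3_eq_cube)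
  qed (auto simp: norm_comp_le)
  moreover have "\<bar>cB * e * inner (slow_w x) (slow_r x)\<bar> \<le> (cB * K) * (((1 + K) * norm x) * ((1 + K) * norm x))"
    using cA_pos s_bounds by (intro abs_coeff_inner_le norm_slow_w_le norm_slow_r_le) auto
  moreover have "lyap x - cN / 2 * (norm x)\<^sup>2 = cA * (\<nu> / \<kappa>\<^sup>2) * inner (th_of x) (r_of x)
      + (s\<^sup>2 / \<kappa>) * inner (p_of x) (th_of x) + cB * e * inner (slow_w x) (slow_r x)"
    by (simp add: lyap_def power2_norm_eq_inner)
  moreover have "D * (norm x)\<^sup>2 = (cA * K\<^sup>2) * (norm x * norm x) + K^3 * (norm x * norm x) +
      (cB * K) * (((1 + K) * norm x) * ((1 + K) * norm x))"
    by (simp add: D_def power2_eq_square algebra_simps)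
  ultimately have "\<bar>lyap x - cN / 2 * (norm x)\<^sup>2\<bar> \<le> D * (norm x)\<^sup>2"
    using abs3 by blast
  moreover have "D * (norm x)\<^sup>2 \<le> (cN - 1) / 2 * (norm x)\<^sup>2"
    using K1 cA_pos unfolding D_def cN_def by (intro mult_right_mono) (auto simp: field_simps)
  moreover have "(cN - 1) / 2 * (norm x)\<^sup>2 = cN / 2 * (norm x)\<^sup>2 - (norm x)\<^sup>2 / 2" by (simp add: field_simps)
  moreover have "0 \<le> (norm x)\<^sup>2" "cN * (norm x)\<^sup>2 = cN / 2 * (norm x)\<^sup>2 + cN / 2 * (norm x)\<^sup>2" by auto
  ultimately show "(norm x)\<^sup>2 / 2 \<le> lyap x" "lyap x \<le> cN * (norm x)\<^sup>2" by linarith+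
qed

text \<open>
  The weakest term of the dissipation decides: all others have weights at least of order \<open>s\<^sup>2\<close>, the
  one of \<open>slow_w\<close> because \<open>e = \<omega> s\<close> and \<open>\<omega>\<close> is bounded below.
\<close>

lemma dissipation_ge: "s\<^sup>2 * (norm x)\<^sup>2 \<le> 4 * K\<^sup>2 * dissipation x"
proof -
  obtain w p \<theta> r where x: "x = (w, p, \<theta>, r)" by (cases x)
  have n2: "(norm (a + b))\<^sup>2 \<le> 2 * (norm a)\<^sup>2 + 2 * (norm b)\<^sup>2" for a b :: 'a
  proof -
    have "(norm (a + b))\<^sup>2 \<le> (norm a + norm b)\<^sup>2" by (intro power_mono norm_triangle_ineq) auto
    also have "\<dots> \<le> 2 * (norm a)\<^sup>2 + 2 * (norm b)\<^sup>2"
      using sum_squares_bound[of "norm a" "norm b"] by (simp add: power2_sum)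
    finally show ?thesis .
  qed
  have KK: "1 \<le> K\<^sup>2" using K1 by simp
  have "norm w = norm (slow_w x + (- (\<omega> / \<kappa>)) *\<^sub>R \<theta>)" by (simp add: x slow_w_def)
  then have "(norm w)\<^sup>2 \<le> 2 * (norm (slow_w x))\<^sup>2 + 2 * ((\<omega> / \<kappa>)\<^sup>2 * (norm \<theta>)\<^sup>2)"
    using n2[of "slow_w x" "(- (\<omega> / \<kappa>)) *\<^sub>R \<theta>"] by (simp add: power_mult_distrib power_divide)
  moreover have "(\<omega> / \<kappa>)\<^sup>2 * (norm \<theta>)\<^sup>2 \<le> K\<^sup>2 * (norm \<theta>)\<^sup>2"
    using s_bounds by (intro mult_right_mono power_mono) auto
  ultimately have "(norm w)\<^sup>2 \<le> 2 * (norm (slow_w x))\<^sup>2 + 2 * (K\<^sup>2 * (norm \<theta>)\<^sup>2)" by linarith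
  then have "s\<^sup>2 * (norm w)\<^sup>2 \<le> s\<^sup>2 * (2 * (norm (slow_w x))\<^sup>2 + 2 * (K\<^sup>2 * (norm \<theta>)\<^sup>2))"
    by (intro mult_left_mono) auto
  moreover have "s\<^sup>2 * (norm (slow_w x))\<^sup>2 \<le> K\<^sup>2 * (e * norm (slow_w x))\<^sup>2"
  proof -
    have "1\<^sup>2 \<le> (K * \<omega>)\<^sup>2" using om_ge by (intro power_mono) auto
    then have "1 * (s\<^sup>2 * (norm (slow_w x))\<^sup>2) \<le> (K * \<omega>)\<^sup>2 * (s\<^sup>2 * (norm (slow_w x))\<^sup>2)" by (intro mult_right_mono) auto
    then show ?thesis by (simp add: s_bounds(8) power_mult_distrib mult_ac)
  qed
  moreover have "s\<^sup>2 * (norm r)\<^sup>2 \<le> K\<^sup>2 * (norm r)\<^sup>2"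
    using s_bounds by (intro mult_right_mono power_mono) auto
  moreover have "1 * (s\<^sup>2 * (norm p)\<^sup>2) \<le> K\<^sup>2 * (s\<^sup>2 * (norm p)\<^sup>2)"
    "1 * (s\<^sup>2 * (norm \<theta>)\<^sup>2) \<le> K\<^sup>2 * (s\<^sup>2 * (norm \<theta>)\<^sup>2)"
    using KK by (intro mult_right_mono; simp)+
  moreover have "0 \<le> K\<^sup>2 * (norm r)\<^sup>2" "0 \<le> K\<^sup>2 * (s\<^sup>2 * (norm p)\<^sup>2)" "0 \<le> K\<^sup>2 * (s\<^sup>2 * (norm \<theta>)\<^sup>2)" "0 \<le> K\<^sup>2 * (e * norm (slow_w x))\<^sup>2"
    by auto
  moreover have "s\<^sup>2 * (norm x)\<^sup>2 = s\<^sup>2 * (norm w)\<^sup>2 + s\<^sup>2 * (norm p)\<^sup>2 + s\<^sup>2 * (norm \<theta>)\<^sup>2 + s\<^sup>2 * (norm r)\<^sup>2"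
    by (simp add: x norm_quad algebra_simps)
  moreover have "4 * K\<^sup>2 * dissipation x = 4 * (K\<^sup>2 * (e * norm (slow_w x))\<^sup>2) + 4 * (K\<^sup>2 * (norm r)\<^sup>2)
      + 4 * (K\<^sup>2 * (s\<^sup>2 * (norm p)\<^sup>2)) + 4 * (K\<^sup>2 * (s\<^sup>2 * (norm \<theta>)\<^sup>2))"
    by (simp add: x dissipation_def r_of_def p_of_def th_of_def power_mult_distrib algebra_simps)
  moreover have "s\<^sup>2 * (2 * (norm (slow_w x))\<^sup>2 + 2 * (K\<^sup>2 * (norm \<theta>)\<^sup>2)) =
     2 * (s\<^sup>2 * (norm (slow_w x))\<^sup>2) + 2 * (K\<^sup>2 * (s\<^sup>2 * (norm \<theta>)\<^sup>2))"
    by (simp add: algebra_simps)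
  ultimately show ?thesis by linarith
qed

text \<open>
  Gronwall's argument for \<open>lyap\<close>, since \<open>lyap' \<le> - dissipation / 2 \<le> - c lyap\<close> with \<open>c\<close> of order \<open>s\<^sup>2\<close>.
\<close>

lemma flow_decay:
  fixes x :: "real \<Rightarrow> 'a::real_inner \<times> 'a \<times> 'a \<times> 'a"
  assumes "is_flow M x" "0 \<le> t"
  shows "(norm (x t))\<^sup>2 \<le> 2 * cN * exp (- (s\<^sup>2 / (8 * K\<^sup>2 * cN)) * t) * (norm (x 0))\<^sup>2"
proof -
  define c where "c = s\<^sup>2 / (8 * K\<^sup>2 * cN)"
  have "exp (c * t) * lyap (x t) \<le> exp (c * 0) * lyap (x 0)"
  proof (rule nonincreasing_of_deriv[OF assms(2)])
    fix u assume u: "0 \<le> u" "u \<le> t"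
    show "((\<lambda>t. exp (c * t) * lyap (x t)) has_real_derivative
        exp (c * u) * lyap' (x u) + (c * exp (c * u)) * lyap (x u)) (at u within {0..t})"
      by (rule derivative_eq_intros lyap_deriv[OF assms(1) u(1)] refl | simp)+
    have "c * lyap (x u) \<le> c * (cN * (norm (x u))\<^sup>2)"
      using cA_pos by (intro mult_left_mono lyap_bounds(2)) (auto simp: c_def)
    also have "\<dots> = s\<^sup>2 * (norm (x u))\<^sup>2 / (8 * K\<^sup>2)" using cA_pos by (simp add: c_def)
    also have "\<dots> \<le> dissipation (x u) / 2" using dissipation_ge[of "x u"] K1 by (simp add: field_simps)
    finally have "lyap' (x u) + c * lyap (x u) \<le> 0" using lyap'_le[of "x u"] by simp
    then have "exp (c * u) * (lyap' (x u) + c * lyap (x u)) \<le> 0" by (simp add: mult_le_0_iff)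
    then show "exp (c * u) * lyap' (x u) + (c * exp (c * u)) * lyap (x u) \<le> 0" by (simp add: algebra_simps)
  qed
  then have "lyap (x t) \<le> exp (- c * t) * lyap (x 0)" by (simp add: exp_minus field_simps)
  also have "\<dots> \<le> exp (- c * t) * (cN * (norm (x 0))\<^sup>2)" by (intro mult_left_mono lyap_bounds(2)) auto
  finally have "lyap (x t) \<le> cN * exp (- c * t) * (norm (x 0))\<^sup>2" by (simp add: mult_ac)
  then show ?thesis using lyap_bounds(1)[of "x t"] unfolding c_def[symmetric] by (simp add: mult_ac)
qed

section \<open>The slow part of the generator\<close>

text \<open>
  \<open>freq_sq\<close> is the squared frequency of the fast pair up to smaller terms, so \<open>slow = M^3 + freq_sq M\<close>
  nearly annihilates fast modes. The correction \<open>h\<close> is chosen such that the products of \<open>p\<close> and \<open>\<theta>\<close>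
  cancel exactly in the bilinear form of \<open>slow\<close>, once \<open>w\<close> is expressed by \<open>slow_w\<close>; without it their
  coefficient would be too large for the weights of the dissipation.
\<close>

definition "h = \<omega>\<^sup>2 * \<nu>\<^sup>2 / (\<kappa>\<^sup>2 + \<omega>\<^sup>2)"
definition "freq_sq = \<kappa>\<^sup>2 + \<omega>\<^sup>2 + \<nu>\<^sup>2 - h"

definition slow :: "'a::real_inner \<times> 'a \<times> 'a \<times> 'a \<Rightarrow> 'a \<times> 'a \<times> 'a \<times> 'a" where
  "slow x = M (M (M x)) + freq_sq *\<^sub>R M x"

text \<open>
  The time reversal that turns \<open>M\<close> into its adjoint: \<open>\<langle>M x, flip y\<rangle> = \<langle>x, flip (M y)\<rangle>\<close>.
\<close>

definition flip :: "'a::real_inner \<times> 'a \<times> 'a \<times> 'a \<Rightarrow> 'a \<times> 'a \<times> 'a \<times> 'a" where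
  "flip = (\<lambda>(w, p, \<theta>, r). (w, - p, \<theta>, - r))"

lemma flip_simps: "flip (flip x) = x" "norm (flip x) = norm x" "slow_w (flip x) = slow_w x" "p_of (flip x) = - p_of x"
  "th_of (flip x) = th_of x" "r_of (flip x) = - r_of x" "inner (M x) (flip y) = inner x (flip (M y))"
  by (cases x; cases y; simp add: flip_def slow_w_def p_of_def th_of_def r_of_def norm_Pair chain_def inner_simps algebra_simps)+

lemma freq_sq_ge: "\<kappa>\<^sup>2 \<le> freq_sq"
proof -
  have "\<omega>\<^sup>2 * \<nu>\<^sup>2 \<le> (\<kappa>\<^sup>2 + \<omega>\<^sup>2) * \<nu>\<^sup>2" by (simp add: algebra_simps)
  then have "h \<le> \<nu>\<^sup>2" using pos unfolding h_def by (simp add: divide_simps add_pos_pos mult_ac)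
  then show ?thesis by (simp add: freq_sq_def)
qed

lemma slow_components:
  "slow (w, p, \<theta>, r) = ((\<omega> * \<nu> * \<kappa>) *\<^sub>R r + (\<omega> * (\<nu>\<^sup>2 - h)) *\<^sub>R p,
    - (\<omega> * (\<nu>\<^sup>2 - h)) *\<^sub>R w - (h * \<kappa>) *\<^sub>R \<theta> - (\<kappa> * \<nu> * \<delta>) *\<^sub>R r,
    (h * \<kappa>) *\<^sub>R p + (\<delta> * \<nu>\<^sup>2) *\<^sub>R \<theta> + (\<nu> * (\<omega>\<^sup>2 + \<delta>\<^sup>2 - h)) *\<^sub>R r,
    - (\<omega> * \<nu> * \<kappa>) *\<^sub>R w - (\<nu> * (\<omega>\<^sup>2 + \<delta>\<^sup>2 - h)) *\<^sub>R \<theta> - (\<kappa> * \<nu> * \<delta>) *\<^sub>R p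
      - (\<delta> * (\<kappa>\<^sup>2 + \<omega>\<^sup>2 + \<delta>\<^sup>2 - \<nu>\<^sup>2 - h)) *\<^sub>R r)"
  by (simp add: slow_def chain_def freq_sq_def algebra_simps power2_eq_square)

lemma slow_form:
  "inner (slow x) y =
     (\<omega> * \<nu> * \<kappa>) * inner (r_of x) (slow_w y) + (\<omega> * (\<nu>\<^sup>2 - h)) * inner (p_of x) (slow_w y)
   - (\<omega> * (\<nu>\<^sup>2 - h)) * inner (slow_w x) (p_of y) - (\<kappa> * \<nu> * \<delta>) * inner (r_of x) (p_of y)
   + (\<delta> * \<nu>\<^sup>2) * inner (th_of x) (th_of y) + (\<nu> * (\<delta>\<^sup>2 - h)) * inner (r_of x) (th_of y)
   - (\<omega> * \<nu> * \<kappa>) * inner (slow_w x) (r_of y) - (\<kappa> * \<nu> * \<delta>) * inner (p_of x) (r_of y)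
   - (\<nu> * (\<delta>\<^sup>2 - h)) * inner (th_of x) (r_of y) - (\<delta> * (\<kappa>\<^sup>2 + \<omega>\<^sup>2 + \<delta>\<^sup>2 - \<nu>\<^sup>2 - h)) * inner (r_of x) (r_of y)"
proof -
  obtain w p \<theta> r where x: "x = (w, p, \<theta>, r)" by (cases x)
  obtain w' p' \<theta>' r' where y: "y = (w', p', \<theta>', r')" by (cases y)
  have n: "\<kappa>\<^sup>2 + \<omega>\<^sup>2 \<noteq> 0" using pos by (simp add: add_nonneg_eq_0_iff)
  have h: "h * \<kappa>\<^sup>2 + h * \<omega>\<^sup>2 = \<omega>\<^sup>2 * \<nu>\<^sup>2" using n by (simp add: h_def divide_simps algebra_simps)
  define k where "k = \<omega> / \<kappa>"
  have c1: "h * \<kappa> = \<omega> * (\<nu>\<^sup>2 - h) * k"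
    using h pos by (simp add: k_def field_simps power2_eq_square)
  have c2: "\<nu> * \<omega>\<^sup>2 = \<omega> * \<nu> * \<kappa> * k" using pos by (simp add: k_def field_simps power2_eq_square)
  have W: "w = slow_w x - k *\<^sub>R \<theta>" "w' = slow_w y - k *\<^sub>R \<theta>'" by (auto simp: x y slow_w_def k_def)
  define u v where "u = slow_w x" "v = slow_w y"
  define a b c1 c2 where "a = \<omega> * \<nu> * \<kappa>" "b = \<omega> * (\<nu>\<^sup>2 - h)" "c1 = \<kappa> * \<nu> * \<delta>" "c2 = \<delta> * (\<kappa>\<^sup>2 + \<omega>\<^sup>2 + \<delta>\<^sup>2 - \<nu>\<^sup>2 - h)"
  define d where "d = \<nu> * (\<delta>\<^sup>2 - h)"
  have d': "\<nu> * (\<omega>\<^sup>2 + \<delta>\<^sup>2 - h) = a * k + d" using c2 by (simp add: a_b_c1_c2_def d_def algebra_simps)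
  have "inner (slow x) y = inner (a *\<^sub>R r + b *\<^sub>R p) w' + inner (- b *\<^sub>R w - (b * k) *\<^sub>R \<theta> - c1 *\<^sub>R r) p'
    + inner ((b * k) *\<^sub>R p + (\<delta> * \<nu>\<^sup>2) *\<^sub>R \<theta> + (a * k + d) *\<^sub>R r) \<theta>'
    + inner (- a *\<^sub>R w - (a * k + d) *\<^sub>R \<theta> - c1 *\<^sub>R p - c2 *\<^sub>R r) r'"
    unfolding x y slow_components d' c1 by (simp add: a_b_c1_c2_def)
  also have "\<dots> = a * inner r v + b * inner p v - b * inner u p' - c1 * inner r p'
   + (\<delta> * \<nu>\<^sup>2) * inner \<theta> \<theta>' + d * inner r \<theta>' - a * inner u r' - c1 * inner p r'
   - d * inner \<theta> r' - c2 * inner r r'"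
    unfolding W u_v_def[symmetric] by (simp add: inner_simps algebra_simps)
  finally show ?thesis by (simp add: x y u_v_def a_b_c1_c2_def d_def p_of_def th_of_def r_of_def)
qed

lemma h_bounds: "0 \<le> h" "h \<le> \<nu>\<^sup>2" "h \<le> e\<^sup>2"
proof -
  have n: "\<kappa>\<^sup>2 + \<omega>\<^sup>2 > 0" "\<kappa>\<^sup>2 > 0" using pos by (auto simp: add_pos_pos)
  show "0 \<le> h" unfolding h_def by simp
  have "\<omega>\<^sup>2 * \<nu>\<^sup>2 \<le> \<nu>\<^sup>2 * (\<kappa>\<^sup>2 + \<omega>\<^sup>2)" by (simp add: algebra_simps)
  then show "h \<le> \<nu>\<^sup>2" using n unfolding h_def by (simp add: pos_divide_le_eq)
  have "h \<le> \<omega>\<^sup>2 * \<nu>\<^sup>2 / \<kappa>\<^sup>2" unfolding h_def using n by (intro divide_left_mono) auto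
  then show "h \<le> e\<^sup>2" by (simp add: e_def power_divide power_mult_distrib)
qed

text \<open>
  Every coefficient in \<open>slow_form\<close> is at most a constant times \<open>\<kappa>\<^sup>2\<close> and the two weights that the
  dissipation attaches to the coordinates involved. The parameter \<open>u\<close> is kept free, to balance later
  two solutions of different size.
\<close>

lemma slow_form_le:
  assumes u: "u > 0"
  shows "inner (slow x) y \<le> (20 * K^5) * \<kappa>\<^sup>2 * (u * dissipation x + dissipation y / u)"
proof -
  define C where "C = 5 * K^5 * \<kappa>\<^sup>2"
  have powK: "K^i \<le> K^j" if "i \<le> j" for i j using K1 that by (intro power_increasing) auto
  have C: "c * \<kappa>\<^sup>2 \<le> C" if "c \<le> 5 * K^5" for c using that by (simp add: C_def mult_right_mono)
  have C1: "\<kappa>\<^sup>2 \<le> C" using C[of 1] powK[of 0 5] by simp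
  have CK: "K * \<kappa>\<^sup>2 \<le> C" using C[of K] powK[of 1 5] K1 by simp
  note sb = s_bounds h_bounds pos K1 de_le
  have nu: "\<nu> = s * \<kappa>" "\<omega> * \<nu> = e * \<kappa>" using pos by (auto simp: s_def e_def)
  have nk: "\<kappa> * \<nu> = \<kappa>\<^sup>2 * s" "\<nu>\<^sup>2 = \<kappa>\<^sup>2 * (s * s)"
    using pos by (auto simp: s_def power2_eq_square)
  have a1: "\<omega> * \<nu> * \<kappa> \<le> C * e"
  proof -
    have "\<omega> * \<nu> * \<kappa> = \<kappa>\<^sup>2 * e" by (simp add: nu(2) power2_eq_square)
    then show ?thesis using mult_right_mono[OF C1, of e] s_bounds(3) by simp
  qed
  have "\<bar>\<omega> * (\<nu>\<^sup>2 - h)\<bar> \<le> \<omega> * \<nu>\<^sup>2" using sb by (simp add: abs_mult)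
  also have "\<omega> * \<nu>\<^sup>2 = (\<omega> * \<nu>) * \<nu>" by (simp add: power2_eq_square)
  also have "\<dots> = (e * \<kappa>) * (s * \<kappa>)" by (subst nu(2)) (subst nu(1), rule refl)
  also have "\<dots> = \<kappa>\<^sup>2 * (s * e)" by (simp add: power2_eq_square)
  also have "\<dots> \<le> C * (s * e)" using C1 sb by (intro mult_right_mono) auto
  finally have a2: "\<bar>\<omega> * (\<nu>\<^sup>2 - h)\<bar> \<le> C * s * e" by (simp only: mult.assoc)
  have "\<kappa> * \<nu> * \<delta> = \<delta> * (\<kappa>\<^sup>2 * s)" unfolding nk(1) by (rule mult.commute)
  also have "\<dots> \<le> K * (\<kappa>\<^sup>2 * s)" using sb by (intro mult_right_mono) auto
  also have "\<dots> \<le> C * s" using mult_right_mono[OF CK, of s] sb by (simp add: mult_ac)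
  finally have a3: "\<kappa> * \<nu> * \<delta> \<le> C * s" .
  have "\<delta> * \<nu>\<^sup>2 = \<delta> * (\<kappa>\<^sup>2 * (s * s))" unfolding nk(2) ..
  also have "\<dots> \<le> K * (\<kappa>\<^sup>2 * (s * s))" using sb by (intro mult_right_mono) auto
  also have "\<dots> \<le> C * (s * s)" using mult_right_mono[OF CK, of "s * s"] sb by (simp add: mult_ac)
  finally have a4: "\<delta> * \<nu>\<^sup>2 \<le> C * s * s" by (simp add: mult_ac)
  have "\<bar>\<delta>\<^sup>2 - h\<bar> \<le> \<bar>\<delta>\<^sup>2\<bar> + \<bar>h\<bar>" by (rule abs_triangle_ineq4)
  also have "\<dots> \<le> \<delta>\<^sup>2 + e\<^sup>2" using h_bounds by simp
  also have "\<dots> \<le> K\<^sup>2 + K\<^sup>2" using sb by (intro add_mono power_mono) auto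
  also have "\<dots> \<le> 2 * K\<^sup>2 * (K * \<kappa>)" using mult_left_mono[OF ka_ge, of "2 * K\<^sup>2"] by simp
  finally have "\<nu> * \<bar>\<delta>\<^sup>2 - h\<bar> \<le> \<nu> * (2 * K\<^sup>2 * (K * \<kappa>))" using sb by (intro mult_left_mono) auto
  also have "\<dots> = (2 * K ^ 3) * (\<kappa> * \<nu>)" by (simp add: power2_eq_square power3_eq_cube)
  also have "\<dots> = (2 * K ^ 3) * \<kappa>\<^sup>2 * s" unfolding nk(1) by (rule mult.assoc[symmetric])
  also have "\<dots> \<le> C * s"
  proof (intro mult_right_mono C)
    have "K^3 \<le> K^5" "1 \<le> K^5" using powK one_le_power[OF K1] by auto
    then show "2 * K^3 \<le> 5 * K^5" by linarith
  qed (use s_bounds in auto)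
  finally have a5: "\<bar>\<nu> * (\<delta>\<^sup>2 - h)\<bar> \<le> C * s" using sb by (simp add: abs_mult)
  have "\<bar>\<kappa>\<^sup>2 + \<omega>\<^sup>2 + \<delta>\<^sup>2 - \<nu>\<^sup>2 - h\<bar> \<le> \<kappa>\<^sup>2 + \<omega>\<^sup>2 + \<delta>\<^sup>2 + 2 * \<nu>\<^sup>2"
    using h_bounds zero_le_power2[of \<kappa>] zero_le_power2[of \<omega>] zero_le_power2[of \<delta>] zero_le_power2[of \<nu>] by linarith
  also have "\<dots> \<le> \<kappa>\<^sup>2 + (K * \<kappa>)\<^sup>2 + (K\<^sup>2 * \<kappa>)\<^sup>2 + 2 * (K * \<kappa>)\<^sup>2"
    using sb om_le nu_le by (intro add_mono power_mono mult_left_mono) (auto simp: pos_divide_le_eq)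
  also have "\<dots> = (1 + 3 * K\<^sup>2 + K^4) * \<kappa>\<^sup>2" by (simp add: power_mult_distrib algebra_simps)
  also have "\<dots> \<le> (5 * K^4) * \<kappa>\<^sup>2" using powK[of 2 4] powK[of 0 4] by (intro mult_right_mono) auto
  finally have "\<delta> * \<bar>\<kappa>\<^sup>2 + \<omega>\<^sup>2 + \<delta>\<^sup>2 - \<nu>\<^sup>2 - h\<bar> \<le> K * ((5 * K^4) * \<kappa>\<^sup>2)"
    using sb by (intro mult_mono) auto
  then have a6: "\<bar>\<delta> * (\<kappa>\<^sup>2 + \<omega>\<^sup>2 + \<delta>\<^sup>2 - \<nu>\<^sup>2 - h)\<bar> \<le> C"
    using sb by (simp add: abs_mult C_def power_Suc[of K 4, simplified] mult_ac)
  define W R P H where d: "W = e * norm (slow_w x)" "R = norm (r_of x)" "P = s * norm (p_of x)" "H = s * norm (th_of x)"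
  define W' R' P' H' where d': "W' = e * norm (slow_w y)" "R' = norm (r_of y)" "P' = s * norm (p_of y)" "H' = s * norm (th_of y)"
  have nn: "W \<ge> 0" "R \<ge> 0" "P \<ge> 0" "H \<ge> 0" "W' \<ge> 0" "R' \<ge> 0" "P' \<ge> 0" "H' \<ge> 0" using sb by (auto simp: d d')
  have t: "(\<omega> * \<nu> * \<kappa>) * inner (r_of x) (slow_w y) \<le> C * (1 * norm (r_of x)) * (e * norm (slow_w y))"
    "(\<omega> * (\<nu>\<^sup>2 - h)) * inner (p_of x) (slow_w y) \<le> C * (s * norm (p_of x)) * (e * norm (slow_w y))"
    "- (\<omega> * (\<nu>\<^sup>2 - h)) * inner (slow_w x) (p_of y) \<le> C * (e * norm (slow_w x)) * (s * norm (p_of y))"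
    "- (\<kappa> * \<nu> * \<delta>) * inner (r_of x) (p_of y) \<le> C * (1 * norm (r_of x)) * (s * norm (p_of y))"
    "(\<delta> * \<nu>\<^sup>2) * inner (th_of x) (th_of y) \<le> C * (s * norm (th_of x)) * (s * norm (th_of y))"
    "(\<nu> * (\<delta>\<^sup>2 - h)) * inner (r_of x) (th_of y) \<le> C * (1 * norm (r_of x)) * (s * norm (th_of y))"
    "- (\<omega> * \<nu> * \<kappa>) * inner (slow_w x) (r_of y) \<le> C * (e * norm (slow_w x)) * (1 * norm (r_of y))"
    "- (\<kappa> * \<nu> * \<delta>) * inner (p_of x) (r_of y) \<le> C * (s * norm (p_of x)) * (1 * norm (r_of y))"
    "- (\<nu> * (\<delta>\<^sup>2 - h)) * inner (th_of x) (r_of y) \<le> C * (s * norm (th_of x)) * (1 * norm (r_of y))"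
    "- (\<delta> * (\<kappa>\<^sup>2 + \<omega>\<^sup>2 + \<delta>\<^sup>2 - \<nu>\<^sup>2 - h)) * inner (r_of x) (r_of y) \<le> C * (1 * norm (r_of x)) * (1 * norm (r_of y))"
    by (rule coeff_inner_le; use sb a1 a2 a3 a4 a5 a6 in \<open>simp add: mult_ac\<close>)+
  have "inner (slow x) y \<le> C * R * W' + C * P * W' + C * W * P' + C * R * P' + C * H * H' + C * R * H'
     + C * W * R' + C * P * R' + C * H * R' + C * R * R'"
    unfolding slow_form using t by (simp add: d d')
  also have "\<dots> = C * (R * W' + P * W' + W * P' + R * P' + H * H' + R * H' + W * R' + P * R' + H * R' + R * R')"
    by (simp add: algebra_simps)
  also have "\<dots> \<le> C * ((W + R + P + H) * (W' + R' + P' + H'))"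
    using nn C1 sb by (intro mult_left_mono) (auto simp: algebra_simps intro!: add_nonneg_nonneg order.trans[OF _ C1])
  also have "\<dots> \<le> C * (u * (W + R + P + H)\<^sup>2 + (W' + R' + P' + H')\<^sup>2 / u)"
  proof (intro mult_left_mono)
    define X Y where "X = W + R + P + H" "Y = W' + R' + P' + H'"
    have "0 \<le> (u * X - Y)\<^sup>2 / u + (u * X\<^sup>2 + Y\<^sup>2 / u)" using u by simp
    also have "\<dots> = 2 * (u * X\<^sup>2 + Y\<^sup>2 / u - X * Y)" using u by (simp add: power2_eq_square field_simps)
    finally show "X * Y \<le> u * X\<^sup>2 + Y\<^sup>2 / u" by simp
  qed (use C1 order.trans[OF _ C1] in auto)
  also have "\<dots> \<le> C * (u * (4 * dissipation x) + (4 * dissipation y) / u)"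
  proof (intro mult_left_mono add_mono divide_right_mono)
    have sq: "(a + b + c + d)\<^sup>2 \<le> 4 * (a\<^sup>2 + b\<^sup>2 + c\<^sup>2 + d\<^sup>2)" for a b c d :: real
      using sum_squares_bound[of a b] sum_squares_bound[of a c] sum_squares_bound[of a d] sum_squares_bound[of b c]
        sum_squares_bound[of b d] sum_squares_bound[of c d]
      by (simp add: power2_eq_square algebra_simps)
    show "(W + R + P + H)\<^sup>2 \<le> 4 * dissipation x" "(W' + R' + P' + H')\<^sup>2 \<le> 4 * dissipation y"
      using sq by (simp_all add: dissipation_def d d')
  qed (use u C1 order.trans[OF _ C1] in auto)
  finally show ?thesis by (simp add: C_def algebra_simps)
qed

lemma dissipation_flip: "dissipation (flip x) = dissipation x"
  by (simp add: dissipation_def flip_simps)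

lemma bounded_linear_flip: "bounded_linear (flip :: 'a::real_inner \<times> 'a \<times> 'a \<times> 'a \<Rightarrow> _)"
  unfolding flip_def case_prod_unfold by (intro bounded_linear_intros bounded_linear_minus)

lemma bounded_linear_slow: "bounded_linear (slow :: 'a::real_inner \<times> 'a \<times> 'a \<times> 'a \<Rightarrow> _)"
  unfolding slow_def by (intro bounded_linear_intros bounded_linear_chain bounded_linear_compose[OF bounded_linear_chain])

lemma slow_commute: "slow (M x) = M (slow x)"
  unfolding slow_def by (simp add: linear_add[OF linear_chain] linear_scale[OF linear_chain])

text \<open>
  The derivative falls once on \<open>x\<close> and once, with the opposite sign, on \<open>y\<close>; as \<open>M\<close> commutes with
  \<open>slow\<close> and moves across \<open>flip\<close>, the two contributions cancel.
\<close>

lemma flow_pairing_constant: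
  fixes x y :: "real \<Rightarrow> 'a::real_inner \<times> 'a \<times> 'a \<times> 'a"
  assumes "is_flow M x" "is_flow M y" "0 \<le> u" "u \<le> t"
  shows "((\<lambda>v. inner (slow (x v)) (flip (y (t - v)))) has_real_derivative 0) (at u within {0..t})"
proof -
  have x: "((\<lambda>v. slow (x v)) has_vector_derivative slow (M (x u))) (at u within {0..t})"
    using bounded_linear.has_vector_derivative[OF bounded_linear_slow is_flowD[OF assms(1,3)]] .
  have "((\<lambda>v. t - v) has_vector_derivative -1) (at u within {0..t})"
    by (auto intro!: derivative_eq_intros)
  moreover have "(y has_vector_derivative M (y (t - u))) (at (t - u) within (\<lambda>v. t - v) ` {0..t})"
    using is_flowD[OF assms(2), of "t - u" t] assms(4) by simp
  ultimately have "(y \<circ> (\<lambda>v. t - v) has_vector_derivative (-1) *\<^sub>R M (y (t - u))) (at u within {0..t})"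
    by (rule vector_diff_chain_within)
  then have y: "((\<lambda>v. flip (y (t - v))) has_vector_derivative flip ((-1) *\<^sub>R M (y (t - u)))) (at u within {0..t})"
    by (intro bounded_linear.has_vector_derivative[OF bounded_linear_flip]) (simp add: comp_def)
  have fm: "flip (- z) = - flip z" for z :: "'a \<times> 'a \<times> 'a \<times> 'a" by (cases z) (simp add: flip_def)
  from bounded_bilinear.has_vector_derivative[OF bounded_bilinear_inner x y]
  show ?thesis by (simp add: has_real_derivative_iff_has_vector_derivative fm inner_minus_right slow_commute flip_simps(7))
qed

text \<open>
  The pairing is constant in time, so \<open>t\<close> times its value is its integral over \<open>[0, t]\<close>, and by
  \<open>slow_form_le\<close> this is controlled by the integrals of the two dissipations, which the decrease of
  \<open>lyap\<close> bounds by the initial energies. The argument is written without integrals, as monotonicity of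
  a combination of \<open>lyap\<close> along both solutions.
\<close>

lemma slow_flow_pairing:
  fixes x y :: "real \<Rightarrow> 'a::real_inner \<times> 'a \<times> 'a \<times> 'a"
  assumes "is_flow M x" "is_flow M y" "0 \<le> t" "a > 0"
  shows "t * inner (slow (x t)) (flip (y 0)) \<le> (40 * K^5 * cN) * \<kappa>\<^sup>2 * (a * (norm (x 0))\<^sup>2 + (norm (y 0))\<^sup>2 / a)"
proof -
  define c where "c = 20 * K^5 * \<kappa>\<^sup>2"
  define P where "P = inner (slow (x t)) (flip (y 0))"
  have c0: "c \<ge> 0" using K1 by (simp add: c_def)
  have P: "inner (slow (x u)) (flip (y (t - u))) = P" if "0 \<le> u" "u \<le> t" for u
  proof -
    have "inner (slow (x u)) (flip (y (t - u))) = inner (slow (x 0)) (flip (y (t - 0)))" if "0 \<le> u" "u \<le> t" for u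
      using that DERIV_subset[OF flow_pairing_constant[OF assms(1,2), of _ t], of _ "{0..u}"]
      by (intro constant_of_deriv[of u]) auto
    from this[OF that] this[of t] assms(3) show ?thesis by (simp add: P_def)
  qed
  \<comment> \<open>\<open>F\<close> decreases: the slope \<open>P\<close> of the first term is
    compensated by the dissipation of both solutions, one of them run backwards in time.\<close>
  define F where "F = (\<lambda>u. u * P + 2 * c * a * lyap (x u) - 2 * c / a * lyap (y (t - u)))"
  have "F t \<le> F 0"
  proof (rule nonincreasing_of_deriv[OF assms(3)])
    fix u assume u: "0 \<le> u" "u \<le> t"
    have "((\<lambda>v. t - v) has_real_derivative -1) (at u within {0..t})" by (auto intro!: derivative_eq_intros)
    moreover have "((\<lambda>v. lyap (y v)) has_real_derivative lyap' (y (t - u))) (at (t - u) within (\<lambda>v. t - v) ` {0..t})"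
      using lyap_deriv[OF assms(2), of "t - u" t] u by simp
    ultimately have y: "((\<lambda>v. lyap (y (t - v))) has_real_derivative lyap' (y (t - u)) * (-1)) (at u within {0..t})"
      using DERIV_image_chain[of "\<lambda>v. lyap (y v)" "lyap' (y (t - u))" "\<lambda>v. t - v" u "{0..t}" "-1"] by (auto simp: comp_def)
    show "(F has_real_derivative (P + 2 * c * a * lyap' (x u) - 2 * c / a * (lyap' (y (t - u)) * (-1)))) (at u within {0..t})"
      unfolding F_def by (rule derivative_eq_intros lyap_deriv[OF assms(1) u(1)] y refl | simp)+
    have "P \<le> c * (a * dissipation (x u) + dissipation (y (t - u)) / a)"
      using slow_form_le[OF assms(4), of "x u" "flip (y (t - u))"] P[OF u] by (simp add: c_def dissipation_flip)
    moreover have "2 * c * a * lyap' (x u) \<le> 2 * c * a * (- dissipation (x u) / 2)"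
      using c0 assms(4) by (intro mult_left_mono lyap'_le) auto
    moreover have "2 * c / a * lyap' (y (t - u)) \<le> 2 * c / a * (- dissipation (y (t - u)) / 2)"
      using c0 assms(4) by (intro mult_left_mono lyap'_le) auto
    ultimately show "P + 2 * c * a * lyap' (x u) - 2 * c / a * (lyap' (y (t - u)) * (-1)) \<le> 0"
      by (simp add: algebra_simps add_divide_distrib)
  qed
  then have "t * P \<le> 2 * c * a * (lyap (x 0) - lyap (x t)) + 2 * c / a * (lyap (y 0) - lyap (y t))"
    by (simp add: F_def algebra_simps diff_divide_distrib)
  also have "\<dots> \<le> 2 * c * a * (cN * (norm (x 0))\<^sup>2) + 2 * c / a * (cN * (norm (y 0))\<^sup>2)"
  proof (intro add_mono mult_left_mono)
    have "0 \<le> lyap z" for z :: "'a \<times> 'a \<times> 'a \<times> 'a"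
      using lyap_bounds(1)[of z] by (meson divide_nonneg_pos order_trans zero_le_power2 zero_less_numeral)
    then show "lyap (x 0) - lyap (x t) \<le> cN * (norm (x 0))\<^sup>2" "lyap (y 0) - lyap (y t) \<le> cN * (norm (y 0))\<^sup>2"
      using lyap_bounds(2) by (smt (verit))+
  qed (use c0 assms(4) in auto)
  finally show ?thesis using assms(4) by (simp add: P_def c_def field_simps)
qed

text \<open>
  Duality: the second solution starts at the flipped vector whose norm is sought. The free parameter
  balances the two energies.
\<close>

lemma slow_flow_decay:
  fixes x y :: "real \<Rightarrow> 'a::real_inner \<times> 'a \<times> 'a \<times> 'a"
  assumes "is_flow M x" "is_flow M y" "y 0 = flip (slow (x t))" "0 \<le> t"
  shows "t * norm (slow (x t)) \<le> (80 * K^5 * cN) * \<kappa>\<^sup>2 * norm (x 0)"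
proof (cases "x 0 = 0 \<or> slow (x t) = 0")
  case True
  have "x t = 0" if "x 0 = 0" using flow_decay[OF assms(1,4)] that by simp
  moreover have "slow 0 = (0 :: 'a \<times> 'a \<times> 'a \<times> 'a)" by (rule linear_0[OF bounded_linear.linear[OF bounded_linear_slow]])
  ultimately have "slow (x t) = 0" using True by auto
  then show ?thesis using K1 cA_pos by simp
next
  case False
  define n X where "n = norm (slow (x t))" "X = norm (x 0)"
  have p: "n > 0" "X > 0" using False by (auto simp: n_X_def)
  have "t * n\<^sup>2 \<le> (40 * K^5 * cN) * \<kappa>\<^sup>2 * (n / X * X\<^sup>2 + n\<^sup>2 / (n / X))"
    using slow_flow_pairing[OF assms(1,2,4), of "n / X"] p by (simp add: assms(3) flip_simps n_X_def power2_norm_eq_inner)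
  also have "\<dots> = ((80 * K^5 * cN) * \<kappa>\<^sup>2 * X) * n" using p by (simp add: power2_eq_square field_simps)
  finally show ?thesis using p by (simp add: n_X_def power2_eq_square)
qed

section \<open>Solutions without slow component\<close>

lemma flow_norm_le:
  fixes x :: "real \<Rightarrow> 'a::real_inner \<times> 'a \<times> 'a \<times> 'a"
  assumes "is_flow M x" "0 \<le> t"
  shows "norm (x t) \<le> norm (x 0)"
proof -
  have "inner (x t) (x t) \<le> inner (x 0) (x 0)"
  proof (rule nonincreasing_of_deriv[OF assms(2)])
    fix u assume "0 \<le> u" "u \<le> t"
    then show "((\<lambda>t. inner (x t) (x t)) has_real_derivative inner (M (x u)) (x u) + inner (x u) (M (x u))) (at u within {0..t})"
      using is_flow_form_deriv[OF assms(1) bounded_linear_ident bounded_linear_ident] by simp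
    show "inner (M (x u)) (x u) + inner (x u) (M (x u)) \<le> 0"
      using pos by (simp add: inner_commute[of "x u" "M (x u)"] inner_chain)
  qed
  then show ?thesis by (simp add: power2_norm_eq_inner[symmetric] power2_le_iff_abs_le)
qed

text \<open>
  The cross term of \<open>slow_energy\<close> produces damping of \<open>slow_w\<close>; it has to be small against the main
  terms for the form to stay positive.
\<close>

definition "cE = 1 / (8 * K^5)"

text \<open>
  The energy of the slow pair. The weight \<open>g\<close> makes the coupling between \<open>slow_w\<close> and \<open>slow_r\<close> skew.
\<close>

definition slow_energy :: "'a::real_inner \<times> 'a \<times> 'a \<times> 'a \<Rightarrow> real" where
  "slow_energy x = g * inner (slow_w x) (slow_w x) + inner (slow_r x) (slow_r x) + cE * e * inner (slow_w x) (slow_r x)"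

definition slow_energy' :: "'a::real_inner \<times> 'a \<times> 'a \<times> 'a \<Rightarrow> real" where
  "slow_energy' x = g * (inner (slow_w (M x)) (slow_w x) + inner (slow_w x) (slow_w (M x)))
     + (inner (slow_r (M x)) (slow_r x) + inner (slow_r x) (slow_r (M x)))
     + cE * e * (inner (slow_w (M x)) (slow_r x) + inner (slow_w x) (slow_r (M x)))"

lemma g_ge: "1 / (2 * K\<^sup>2) \<le> g"
proof -
  have "1 * g \<le> K\<^sup>2 * g" using K1 s_bounds by (intro mult_right_mono) auto
  with s_bounds(7) have "1 \<le> 2 * K\<^sup>2 * g" by (simp add: algebra_simps)
  then show ?thesis using K1 by (simp add: pos_divide_le_eq mult_ac)
qed

lemma slow_energy_nonneg: "slow_energy x \<ge> 0"
proof -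
  have "cE * e \<le> 1 / (8 * K^5) * K" using s_bounds K1 unfolding cE_def by (intro mult_left_mono) auto
  also have "\<dots> = 1 / (8 * K^4)" using K1 by (simp add: power_numeral_reduce field_simps)
  finally have c: "cE * e \<le> 1 / (8 * K^4)" .
  have KK: "1 \<le> K\<^sup>2" "K^4 = K\<^sup>2 * K\<^sup>2" using one_le_power[OF K1] by (simp_all add: power_add[symmetric])
  have c1: "1 / (8 * K^4) \<le> 1 / (2 * K\<^sup>2)"
    using KK power_increasing[of 2 4 K] K1 by (intro divide_left_mono) (linarith, auto)
  have "1 / (2 * K\<^sup>2) \<le> 1 / 1" using KK(1) by (intro divide_left_mono) (linarith, use K1 in auto)
  then have c2: "1 / (2 * K\<^sup>2) \<le> 1" by simp
  have "\<bar>cE * e * inner (slow_w x) (slow_r x)\<bar> \<le> (cE * e) * (norm (slow_w x) * norm (slow_r x))"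
    using s_bounds(3) K1 by (intro abs_coeff_inner_le) (auto simp: cE_def abs_mult)
  also have "\<dots> \<le> (cE * e) * ((norm (slow_w x))\<^sup>2 + (norm (slow_r x))\<^sup>2)"
  proof (intro mult_left_mono)
    have "2 * (norm (slow_w x) * norm (slow_r x)) \<le> (norm (slow_w x))\<^sup>2 + (norm (slow_r x))\<^sup>2"
      using sum_squares_bound[of "norm (slow_w x)" "norm (slow_r x)"] by simp
    moreover have "0 \<le> norm (slow_w x) * norm (slow_r x)" by simp
    ultimately show "norm (slow_w x) * norm (slow_r x) \<le> (norm (slow_w x))\<^sup>2 + (norm (slow_r x))\<^sup>2" by linarith
    show "0 \<le> cE * e" using s_bounds(3) K1 by (simp add: cE_def)
  qed
  also have "\<dots> = (cE * e) * (norm (slow_w x))\<^sup>2 + (cE * e) * (norm (slow_r x))\<^sup>2" by (simp add: algebra_simps)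
  also have "\<dots> \<le> g * (norm (slow_w x))\<^sup>2 + 1 * (norm (slow_r x))\<^sup>2"
    using c c1 c2 g_ge by (intro add_mono mult_right_mono) auto
  finally show ?thesis unfolding slow_energy_def by (simp add: power2_norm_eq_inner)
qed

lemma weighted_young: "0 < c \<Longrightarrow> (x::real) * y \<le> c * x\<^sup>2 + y\<^sup>2 / (4 * c)"
proof -
  assume c: "0 < c"
  have "0 \<le> (2 * c * x - y)\<^sup>2 / (4 * c)" using c by simp
  also have "\<dots> = c * x\<^sup>2 + y\<^sup>2 / (4 * c) - x * y" using c by (simp add: power2_eq_square field_simps)
  finally show ?thesis by simp
qed

text \<open>
  The slow pair is damped on its own and is driven by the fast pair only through \<open>s p\<close>. This makes the
  energy transferred into it proportional to \<open>s\<^sup>2\<close>.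
\<close>

lemma slow_energy'_le: "slow_energy' x \<le> - (norm (slow_r x))\<^sup>2 / K + 71 * K^7 * (s * norm (p_of x))\<^sup>2"
proof -
  define W R P where d: "W = e * norm (slow_w x)" "R = norm (slow_r x)" "P = s * norm (p_of x)"
  have powK: "K^i \<le> K^j" if "i \<le> j" for i j using K1 that by (intro power_increasing) auto
  note sb = s_bounds pos K1 de_le
  have nn: "W \<ge> 0" "R \<ge> 0" "P \<ge> 0" using sb by (auto simp: d)
  have ce: "cE > 0" "cE \<le> 1" "cE * K^5 = 1 / 8"
  proof -
    have "1 \<le> 8 * K^5" using one_le_power[OF K1, of 5] by linarith
    then show "cE \<le> 1" using K1 unfolding cE_def by (subst pos_divide_le_eq) auto
  qed (use K1 in \<open>auto simp: cE_def\<close>)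
  have r: "r_of x = slow_r x - (g * s) *\<^sub>R p_of x" by (cases x) (simp add: slow_r_def p_of_def r_of_def)
  have "slow_energy' x = (- (2 * g * e * (g * s))) * inner (slow_w x) (p_of x) - 2 * \<delta> * R\<^sup>2 + (2 * \<delta> * (g * s)) * inner (slow_r x) (p_of x)
     + cE * e\<^sup>2 * R\<^sup>2 + (- (cE * e\<^sup>2 * (g * s))) * inner (slow_r x) (p_of x) - cE * g * W\<^sup>2
     + (- (cE * e * \<delta>)) * inner (slow_w x) (slow_r x) + (cE * e * \<delta> * (g * s)) * inner (slow_w x) (p_of x)"
    unfolding slow_energy'_def slow_w_chain slow_r_chain r
    by (simp add: inner_simps d power_mult_distrib power2_norm_eq_inner inner_commute[of "p_of x"] inner_commute[of "slow_r x" "slow_w x"])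
      (simp add: algebra_simps power2_eq_square)
  moreover have "(- (2 * g * e * (g * s))) * inner (slow_w x) (p_of x) \<le> 2 * (e * norm (slow_w x)) * (s * norm (p_of x))"
  proof (rule coeff_inner_le)
    have "(g * g) * (2 * e * s) \<le> 1 * (2 * e * s)" using sb by (intro mult_right_mono mult_le_one) auto
    then show "\<bar>- (2 * g * e * (g * s))\<bar> \<le> 2 * e * s" using sb by (simp add: mult_ac)
  qed (use sb in auto)
  moreover have gs: "g * s \<le> s" using sb by (intro mult_left_le_one_le) auto
  have "(2 * \<delta> * (g * s)) * inner (slow_r x) (p_of x) \<le> (2 * K) * (1 * norm (slow_r x)) * (s * norm (p_of x))"
  proof (rule coeff_inner_le)
    show "\<bar>2 * \<delta> * (g * s)\<bar> \<le> 2 * K * 1 * s" using sb gs by (simp add: abs_mult mult_mono)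
  qed (use sb in auto)
  moreover have "(- (cE * e\<^sup>2 * (g * s))) * inner (slow_r x) (p_of x) \<le> 1 * (1 * norm (slow_r x)) * (s * norm (p_of x))"
  proof (rule coeff_inner_le)
    have "e\<^sup>2 \<le> K^5" using s_bounds by (intro order.trans[OF power_mono powK]) auto
    then have "cE * e\<^sup>2 \<le> cE * K^5" using ce by (intro mult_left_mono) auto
    then have "(cE * e\<^sup>2) * (g * s) \<le> 1 * s" using sb gs ce by (intro mult_mono) auto
    then show "\<bar>- (cE * e\<^sup>2 * (g * s))\<bar> \<le> 1 * 1 * s" using sb ce by (simp add: abs_mult)
  qed (use sb in auto)
  moreover have "(- (cE * e * \<delta>)) * inner (slow_w x) (slow_r x) \<le> (cE * K) * (e * norm (slow_w x)) * (1 * norm (slow_r x))"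
    using sb ce by (intro coeff_inner_le) (auto simp: abs_mult mult_ac mult_left_mono)
  moreover have "(cE * e * \<delta> * (g * s)) * inner (slow_w x) (p_of x) \<le> (cE * K) * (e * norm (slow_w x)) * (s * norm (p_of x))"
  proof (rule coeff_inner_le)
    have "(cE * e) * (\<delta> * (g * s)) \<le> (cE * e) * (K * s)" using sb gs ce by (intro mult_left_mono mult_mono) auto
    then show "\<bar>cE * e * \<delta> * (g * s)\<bar> \<le> cE * K * e * s" using sb ce by (simp add: abs_mult mult_ac)
  qed (use sb in auto)
  moreover have "cE * e\<^sup>2 * R\<^sup>2 \<le> cE * K\<^sup>2 * R\<^sup>2" using sb ce by (intro mult_right_mono mult_left_mono power_mono) auto
  moreover have "cE * (1 / (2 * K\<^sup>2)) * W\<^sup>2 \<le> cE * g * W\<^sup>2" using g_ge ce by (intro mult_right_mono mult_left_mono) auto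
  moreover have "(1 / K) * R\<^sup>2 \<le> \<delta> * R\<^sup>2" using de_ge sb by (intro mult_right_mono) (auto simp: field_simps)
  ultimately have 1: "slow_energy' x \<le> 2 * W * P - 2 * ((1 / K) * R\<^sup>2) + 2 * K * R * P + cE * K\<^sup>2 * R\<^sup>2 + R * P
     - cE * (1 / (2 * K\<^sup>2)) * W\<^sup>2 + cE * K * W * R + cE * K * W * P"
    by (simp add: d mult_ac)
  \<comment> \<open>The damping \<open>4 a W\<^sup>2\<close> of \<open>slow_w\<close> is spread over
    the three products that contain \<open>W\<close>.\<close>
  define a where "a = cE / (8 * K\<^sup>2)"
  have a0: "a > 0" using ce sb by (simp add: a_def)
  have a4: "cE * (1 / (2 * K\<^sup>2)) * W\<^sup>2 = 4 * (a * W\<^sup>2)" by (simp add: a_def)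
  have b1: "2 * W * P \<le> a * W\<^sup>2 + P\<^sup>2 / a" using weighted_young[OF a0, of W "2 * P"] by (simp add: power_mult_distrib mult_ac)
  have b1': "P\<^sup>2 / a = 64 * K^7 * P\<^sup>2" using sb by (simp add: a_def cE_def power_numeral_reduce)
  have ca: "(cE * K * y)\<^sup>2 / (4 * a) = 2 * (cE * K^4 * y\<^sup>2)" for y
    using sb ce by (simp add: a_def power_mult_distrib power_numeral_reduce field_simps)
  have cE4: "cE * K^4 = 1 / (8 * K)" using sb by (simp add: cE_def power_numeral_reduce)
  have "W * (cE * K * R) \<le> a * W\<^sup>2 + (cE * K * R)\<^sup>2 / (4 * a)" by (rule weighted_young[OF a0])
  then have b2: "cE * K * W * R \<le> a * W\<^sup>2 + 2 * ((1 / (8 * K)) * R\<^sup>2)" unfolding ca cE4 by (simp add: mult_ac)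
  have "W * (cE * K * P) \<le> a * W\<^sup>2 + (cE * K * P)\<^sup>2 / (4 * a)" by (rule weighted_young[OF a0])
  moreover have "(cE * K * P)\<^sup>2 / (4 * a) \<le> 2 * (1 * P\<^sup>2)"
  proof -
    have "cE * K^4 \<le> cE * K^5" using ce by (intro mult_left_mono powK) auto
    then show ?thesis unfolding ca ce(3) by (intro mult_left_mono mult_right_mono) auto
  qed
  ultimately have b3: "cE * K * W * P \<le> a * W\<^sup>2 + 2 * P\<^sup>2" by (simp add: mult_ac)
  have b4: "R * (2 * K * P) \<le> 1 / (4 * K) * R\<^sup>2 + (2 * K * P)\<^sup>2 / (4 * (1 / (4 * K)))"
    using sb by (intro weighted_young) auto
  have b4': "(2 * K * P)\<^sup>2 / (4 * (1 / (4 * K))) = 4 * K^3 * P\<^sup>2" using sb by (simp add: power_mult_distrib power_numeral_reduce)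
  have b5: "R * P \<le> 1 / (4 * K) * R\<^sup>2 + P\<^sup>2 / (4 * (1 / (4 * K)))" using sb by (intro weighted_young) auto
  have b5': "P\<^sup>2 / (4 * (1 / (4 * K))) = K * P\<^sup>2" using sb by simp
  have "cE * K\<^sup>2 \<le> cE * K^4" using ce powK[of 2 4] by (intro mult_left_mono) auto
  then have "cE * K\<^sup>2 \<le> 1 / (8 * K)" using sb by (simp add: cE_def power_numeral_reduce)
  then have b6: "cE * K\<^sup>2 * R\<^sup>2 \<le> 1 / (8 * K) * R\<^sup>2" by (intro mult_right_mono) auto
  have P: "K^i * P\<^sup>2 \<le> K^7 * P\<^sup>2" if "i \<le> 7" for i using powK that by (intro mult_right_mono) auto
  have RK: "1 / (8 * K) * R\<^sup>2 = R\<^sup>2 / K / 8" "1 / (4 * K) * R\<^sup>2 = R\<^sup>2 / K / 4" "1 / K * R\<^sup>2 = R\<^sup>2 / K" by auto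
  have "0 \<le> R\<^sup>2 / K" "0 \<le> a * W\<^sup>2" using sb a0 by auto
  then have "slow_energy' x \<le> - R\<^sup>2 / K + (64 * K^7 * P\<^sup>2 + 2 * P\<^sup>2 + 4 * K^3 * P\<^sup>2 + K * P\<^sup>2)"
    using 1 b1 b2 b3 b4 b5 b6 unfolding a4 b1' b4' b5' RK by (simp add: mult_ac)
  also have "\<dots> \<le> - R\<^sup>2 / K + 71 * K^7 * P\<^sup>2" using P[of 0] P[of 1] P[of 3] by (simp add: mult_ac)
  finally show ?thesis by (simp add: d)
qed

text \<open>
  Energy is lost through \<open>r\<close> only, and \<open>r = slow_r - g s p\<close>. The slow energy starts at zero, so the loss
  through \<open>slow_r\<close> is at most what the fast pair has fed into it; both parts are at most of order
  \<open>s\<^sup>2 t\<close> times the initial energy.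
\<close>

lemma flow_lower_bound:
  fixes x :: "real \<Rightarrow> 'a::real_inner \<times> 'a \<times> 'a \<times> 'a"
  assumes "is_flow M x" "0 \<le> t" "slow_w (x 0) = 0" "slow_r (x 0) = 0"
  shows "(1 - 288 * K^9 * s\<^sup>2 * t) * (norm (x 0))\<^sup>2 \<le> (norm (x t))\<^sup>2"
proof -
  define c where "c = 288 * K^9 * s\<^sup>2 * (norm (x 0))\<^sup>2"
  \<comment> \<open>The factor \<open>4 K\<^sup>2\<close> makes the damping of \<open>slow_r\<close>
    in the slow energy balance the loss of energy through \<open>slow_r\<close>, which is at most
    \<open>4 K R\<^sup>2\<close>.\<close>
  define F where "F = (\<lambda>t. 4 * K\<^sup>2 * slow_energy (x t) - inner (x t) (x t) - c * t)"
  have "F t \<le> F 0"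
  proof (rule nonincreasing_of_deriv[OF assms(2)])
    fix u assume u: "0 \<le> u" "u \<le> t"
    note d = is_flow_form_deriv[OF assms(1) _ _ u(1)]
    have "((\<lambda>t. slow_energy (x t)) has_real_derivative slow_energy' (x u)) (at u within {0..t})"
      unfolding slow_energy_def slow_energy'_def
      by (rule DERIV_add DERIV_cmult d bounded_linear_coords)+
    then show "(F has_real_derivative 4 * K\<^sup>2 * slow_energy' (x u)
        - (inner (M (x u)) (x u) + inner (x u) (M (x u))) - c * 1) (at u within {0..t})"
      unfolding F_def by (intro DERIV_diff DERIV_cmult DERIV_ident d[OF bounded_linear_ident bounded_linear_ident])
    define R P where d: "R = norm (slow_r (x u))" "P = s * norm (p_of (x u))"
    have PP: "P\<^sup>2 \<le> s\<^sup>2 * (norm (x 0))\<^sup>2"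
      unfolding d power_mult_distrib using flow_norm_le[OF assms(1) u(1)] norm_comp_le(1)[of "x u"]
      by (intro mult_left_mono power_mono) auto
    have "r_of (x u) = slow_r (x u) - (g * s) *\<^sub>R p_of (x u)" by (cases "x u") (simp add: slow_r_def p_of_def r_of_def)
    then have "norm (r_of (x u)) \<le> R + norm ((g * s) *\<^sub>R p_of (x u))" by (simp only: norm_triangle_ineq4 d)
    also have "norm ((g * s) *\<^sub>R p_of (x u)) \<le> P"
      using s_bounds mult_right_mono[of "g * s" s "norm (p_of (x u))"] by (simp add: d abs_mult mult_left_le_one_le)
    finally have "(norm (r_of (x u)))\<^sup>2 \<le> (R + P)\<^sup>2" by (intro power_mono) auto
    then have r: "(norm (r_of (x u)))\<^sup>2 \<le> 2 * R\<^sup>2 + 2 * P\<^sup>2" using sum_squares_bound[of R P] by (simp add: power2_sum)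
    have "2 * \<delta> * (norm (r_of (x u)))\<^sup>2 \<le> 2 * K * (2 * R\<^sup>2 + 2 * P\<^sup>2)" using r de_le pos K1 by (intro mult_mono) auto
    moreover have "4 * K\<^sup>2 * slow_energy' (x u) \<le> 4 * K\<^sup>2 * (- R\<^sup>2 / K + 71 * K^7 * P\<^sup>2)"
      using slow_energy'_le[of "x u"] by (intro mult_left_mono) (auto simp: d)
    moreover have "4 * K\<^sup>2 * (- R\<^sup>2 / K + 71 * K^7 * P\<^sup>2) = - 4 * K * R\<^sup>2 + 284 * (K^9 * P\<^sup>2)"
      using K1 by (simp add: power_numeral_reduce algebra_simps)
    moreover have "K * P\<^sup>2 \<le> K^9 * P\<^sup>2" using K1 power_increasing[of 1 9 K] by (intro mult_right_mono) auto
    moreover have "K^9 * P\<^sup>2 \<le> K^9 * (s\<^sup>2 * (norm (x 0))\<^sup>2)" using PP K1 by (intro mult_left_mono) auto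
    ultimately show "4 * K\<^sup>2 * slow_energy' (x u) - (inner (M (x u)) (x u) + inner (x u) (M (x u))) - c * 1 \<le> 0"
      unfolding c_def inner_commute[of "x u" "M (x u)"] inner_chain
      by (simp add: algebra_simps)
  qed
  moreover have "slow_energy (x 0) = 0" using assms(3,4) by (simp add: slow_energy_def)
  ultimately have "4 * K\<^sup>2 * slow_energy (x t) + inner (x 0) (x 0) - c * t \<le> inner (x t) (x t)"
    by (simp add: F_def)
  moreover have "0 \<le> 4 * K\<^sup>2 * slow_energy (x t)" using slow_energy_nonneg[of "x t"] by simp
  ultimately show ?thesis by (simp add: c_def power2_norm_eq_inner algebra_simps)
qed

section \<open>The resolvent of the chain\<close>

lemma norm_chain_le:
  fixes x :: "'a::real_inner \<times> 'a \<times> 'a \<times> 'a"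
  shows "norm (M x) \<le> 7 * K\<^sup>2 * \<kappa> * norm x"
proof -
  obtain w p \<theta> r where x: "x = (w, p, \<theta>, r)" by (cases x)
  have c: "norm w \<le> norm x" "norm p \<le> norm x" "norm \<theta> \<le> norm x" "norm r \<le> norm x"
    using norm_comp_le[of x] by (auto simp: x p_of_def th_of_def r_of_def)
  have "norm (M x) \<le> norm (\<omega> *\<^sub>R p) + norm (\<kappa> *\<^sub>R \<theta> - \<omega> *\<^sub>R w) + norm (\<nu> *\<^sub>R r - \<kappa> *\<^sub>R p) + norm (- \<delta> *\<^sub>R r - \<nu> *\<^sub>R \<theta>)"
    unfolding x chain_def split_conv by (rule norm_quad_le)
  also have "\<dots> \<le> \<omega> * norm x + (\<kappa> * norm x + \<omega> * norm x) + (\<nu> * norm x + \<kappa> * norm x) + (\<delta> * norm x + \<nu> * norm x)"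
    using pos c by (intro add_mono order.trans[OF norm_triangle_ineq4 add_mono]) (auto intro!: mult_left_mono)
  also have "\<dots> = (2 * \<omega> + 2 * \<kappa> + 2 * \<nu> + \<delta>) * norm x" by (simp add: algebra_simps)
  also have "\<dots> \<le> (7 * K\<^sup>2 * \<kappa>) * norm x"
  proof (intro mult_right_mono)
    have "\<delta> \<le> K\<^sup>2 * \<kappa>" using s_bounds pos by (simp add: pos_divide_le_eq)
    moreover have "1 * \<kappa> \<le> K\<^sup>2 * \<kappa>" using one_le_power[OF K1] pos by (intro mult_right_mono) auto
    moreover have "K * \<kappa> \<le> K\<^sup>2 * \<kappa>" using power_increasing[of 1 2 K] K1 pos by (intro mult_right_mono) auto
    ultimately show "2 * \<omega> + 2 * \<kappa> + 2 * \<nu> + \<delta> \<le> 7 * K\<^sup>2 * \<kappa>" using om_le nu_le by simp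
  qed auto
  finally show ?thesis .
qed

text \<open>
  Eliminating \<open>w\<close> and \<open>r\<close> leaves two equations for \<open>p\<close> and \<open>\<theta>\<close> with the positive determinant
  \<open>A D + \<kappa>\<^sup>2\<close>.
\<close>

lemma resolvent_ex:
  fixes x :: "'a::real_inner \<times> 'a \<times> 'a \<times> 'a"
  assumes l: "l > 0"
  shows "\<exists>y. l *\<^sub>R y - M y = x"
proof -
  obtain a b c d where x: "x = (a, b, c, d)" by (cases x)
  define A D where "A = l + \<omega>\<^sup>2 / l" "D = l + \<nu>\<^sup>2 / (l + \<delta>)"
  have p: "l + \<delta> > 0" "A > 0" "D > 0" using l pos by (auto simp: A_D_def add_pos_nonneg)
  define E where "E = A * D + \<kappa>\<^sup>2"
  have E: "E > 0" using p unfolding E_def by (intro add_pos_nonneg) auto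
  define F G where "F = b - (\<omega> / l) *\<^sub>R a" "G = c + (\<nu> / (l + \<delta>)) *\<^sub>R d"
  define P H where "P = (1 / E) *\<^sub>R (D *\<^sub>R F + \<kappa> *\<^sub>R G)" "H = (1 / E) *\<^sub>R (A *\<^sub>R G - \<kappa> *\<^sub>R F)"
  have 1: "A *\<^sub>R P - \<kappa> *\<^sub>R H = F"
  proof -
    have "A *\<^sub>R P - \<kappa> *\<^sub>R H = (1 / E) *\<^sub>R (E *\<^sub>R F)" by (simp add: P_H_def E_def algebra_simps power2_eq_square)
    then show ?thesis using E by simp
  qed
  have 2: "D *\<^sub>R H + \<kappa> *\<^sub>R P = G"
  proof -
    have "D *\<^sub>R H + \<kappa> *\<^sub>R P = (1 / E) *\<^sub>R (E *\<^sub>R G)" by (simp add: P_H_def E_def algebra_simps power2_eq_square)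
    then show ?thesis using E by simp
  qed
  define W where "W = (1 / l) *\<^sub>R (a + \<omega> *\<^sub>R P)"
  define R where "R = (1 / (l + \<delta>)) *\<^sub>R (d - \<nu> *\<^sub>R H)"
  have w: "l *\<^sub>R W - \<omega> *\<^sub>R P = a" using l by (simp add: W_def)
  have r: "(l + \<delta>) *\<^sub>R R + \<nu> *\<^sub>R H = d" using p by (simp add: R_def)
  have "l *\<^sub>R P + \<omega> *\<^sub>R W - \<kappa> *\<^sub>R H = b"
    using 1 by (simp add: W_def A_D_def F_G_def algebra_simps power2_eq_square)
  moreover have "l *\<^sub>R H + \<kappa> *\<^sub>R P - \<nu> *\<^sub>R R = c"
    using 2 by (simp add: R_def A_D_def F_G_def algebra_simps power2_eq_square)
  ultimately have "l *\<^sub>R (W, P, H, R) - M (W, P, H, R) = x"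
    using w r by (simp add: x chain_def algebra_simps)
  then show ?thesis by blast
qed

text \<open>
  \<open>M\<close> is dissipative; the second bound follows from \<open>M y = l y - x\<close>.
\<close>

lemma resolvent_norm:
  fixes x :: "'a::real_inner \<times> 'a \<times> 'a \<times> 'a"
  assumes l: "l > 0" and y: "l *\<^sub>R y - M y = x"
  shows "norm y \<le> norm x / l" "norm (M y) \<le> 2 * norm x"
proof -
  have "l * (norm y)\<^sup>2 \<le> inner (l *\<^sub>R y - M y) y"
    using pos by (simp add: inner_diff_left inner_chain power2_norm_eq_inner)
  also have "\<dots> \<le> norm x * norm y" unfolding y by (rule norm_cauchy_schwarz)
  finally have "(l * norm y) * norm y \<le> norm x * norm y" by (simp add: power2_eq_square)
  then have a: "l * norm y \<le> norm x"
    by (cases "norm y = 0") (use mult_right_le_imp_le in auto)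
  then show "norm y \<le> norm x / l" using l by (simp add: field_simps)
  have "M y = l *\<^sub>R y - x" using y by auto
  then have "norm (M y) \<le> norm (l *\<^sub>R y) + norm x" using norm_triangle_ineq4 by metis
  then show "norm (M y) \<le> 2 * norm x" using a l by simp
qed

end

section \<open>Complex inner products and orthogonal projections\<close>

instance chilbert_space \<subseteq> banach ..

text \<open>
  Needed for limits along filters that are not sequential: unordered sums and improper integrals
  with two free end points.
\<close>

lemma tendsto_of_cauchy_net:
  fixes f :: "'b \<Rightarrow> 'a::banach"
  assumes "F \<noteq> bot" and "\<And>e. e > 0 \<Longrightarrow> \<exists>P. eventually P F \<and> (\<forall>x y. P x \<and> P y \<longrightarrow> dist (f x) (f y) < e)"
  shows "\<exists>L. (f \<longlongrightarrow> L) F"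
proof -
  have "cauchy_filter (filtermap f F)" using assms(2) by (simp add: cauchy_filter_metric_filtermap)
  moreover have "complete (UNIV::'a set)"
    by (meson Cauchy_convergent UNIV_I complete_def convergent_def)
  ultimately show ?thesis
    using complete_uniform[where S="UNIV :: 'a set"] assms(1) by (force simp add: filterlim_def)
qed

lemma cinner_scaleR_left: "cinner (r *\<^sub>R x) y = complex_of_real r * cinner x y"
  by (simp add: scaleR_scaleC cinner_scaleC_left)

lemma cinner_scaleC_right: "cinner x (c *\<^sub>C y) = cnj c * cinner x y"
  by (subst (1 2) cinner_commute) (simp add: cinner_scaleC_left)

lemma cinner_self: "cinner x x = complex_of_real ((norm x)\<^sup>2)"
proof (rule complex_eqI)
  have "cinner x x = cnj (cinner x x)" by (rule cinner_commute)
  then have "Im (cinner x x) = Im (cnj (cinner x x))" by (rule arg_cong)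
  then show "Im (cinner x x) = Im (complex_of_real ((norm x)\<^sup>2))" by simp
qed (simp add: power2_norm_eq_inner inner_eq_Re_cinner)

lemma Im_cinner: "Im (cinner x y) = inner x (\<i> *\<^sub>C y)"
  by (simp add: inner_eq_Re_cinner cinner_scaleC_right)

lemma norm_scaleC: "norm (c *\<^sub>C x) = cmod c * norm (x::'a::complex_inner)"
proof -
  have "complex_of_real ((norm (c *\<^sub>C x))\<^sup>2) = complex_of_real ((cmod c * norm x)\<^sup>2)"
    using complex_norm_square[of c] unfolding cinner_self[symmetric] cinner_scaleC_left cinner_scaleC_right
    by (simp add: cinner_self power_mult_distrib mult.assoc[symmetric])
  then have "(norm (c *\<^sub>C x))\<^sup>2 = (cmod c * norm x)\<^sup>2" using of_real_eq_iff by blast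
  then show ?thesis by (simp add: power2_eq_iff_nonneg)
qed

text \<open>
  The imaginary part of \<open>cinner y z\<close> is \<open>inner y (\<i> z)\<close>, so for a complex subspace real and complex
  orthogonality agree. This allows working with the real inner product throughout.
\<close>

lemma cinner_orthogonal_iff:
  assumes "\<And>c z. z \<in> E \<Longrightarrow> c *\<^sub>C z \<in> E"
  shows "(\<forall>z\<in>E. cinner y z = 0) \<longleftrightarrow> (\<forall>z\<in>E. inner y z = 0)"
proof (intro iffI ballI)
  fix z assume "\<forall>z\<in>E. inner y z = 0" "z \<in> E"
  then show "cinner y z = 0" using assms[of z \<i>] by (auto simp: complex_eq_iff inner_eq_Re_cinner[symmetric] Im_cinner)
qed (auto simp: inner_eq_Re_cinner)

text \<open>
  A minimising sequence for the distance is a Cauchy sequence by the parallelogram law.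
\<close>

lemma closed_subspace_projection:
  fixes x :: "'a::{real_inner, complete_space}"
  assumes S: "subspace S" "closed S"
  shows "\<exists>y\<in>S. \<forall>z\<in>S. inner (x - y) z = 0"
proof -
  define D where "D = (INF y\<in>S. (norm (x - y))\<^sup>2)"
  have bdd: "bdd_below ((\<lambda>y. (norm (x - y))\<^sup>2) ` S)" by (rule bdd_belowI[of _ 0]) auto
  have D: "D \<le> (norm (x - y))\<^sup>2" if "y \<in> S" for y unfolding D_def by (rule cINF_lower[OF bdd that])
  have "\<exists>y\<in>S. (norm (x - y))\<^sup>2 < D + 1 / real (Suc n)" for n
    using cINF_less_iff[OF _ bdd, of "D + 1 / real (Suc n)"] subspace_0[OF S(1)] unfolding D_def by auto
  then obtain Y where Y: "\<And>n. Y n \<in> S" "\<And>n. (norm (x - Y n))\<^sup>2 < D + 1 / real (Suc n)" by metis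
  have par: "(norm (Y i - Y j))\<^sup>2 \<le> 2 / real (Suc i) + 2 / real (Suc j)" for i j
  proof -
    have "(1/2) *\<^sub>R (Y i + Y j) \<in> S" using Y(1) S(1) by (intro subspace_scale subspace_add)
    then have "4 * D \<le> 4 * (norm (x - (1/2) *\<^sub>R (Y i + Y j)))\<^sup>2" using D by simp
    also have "\<dots> = (norm (2 *\<^sub>R (x - (1/2) *\<^sub>R (Y i + Y j))))\<^sup>2" by (simp add: power_mult_distrib)
    also have "2 *\<^sub>R (x - (1/2) *\<^sub>R (Y i + Y j)) = (x - Y i) + (x - Y j)" by (simp add: algebra_simps scaleR_2)
    finally have 1: "4 * D \<le> (norm ((x - Y i) + (x - Y j)))\<^sup>2" .
    have "(norm (Y i - Y j))\<^sup>2 + (norm ((x - Y i) + (x - Y j)))\<^sup>2 = 2 * (norm (x - Y i))\<^sup>2 + 2 * (norm (x - Y j))\<^sup>2"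
      by (simp add: power2_norm_eq_inner inner_simps inner_commute)
    then show ?thesis using 1 Y(2)[of i] Y(2)[of j] by simp
  qed
  have "Cauchy Y"
  proof (rule metric_CauchyI)
    fix e :: real assume e: "e > 0"
    obtain N0 :: nat where "4 / e\<^sup>2 < real N0" using reals_Archimedean2 by blast
    then obtain N where N: "4 / e\<^sup>2 < real (Suc N)" by (intro that[of N0]) auto
    have "dist (Y i) (Y j) < e" if "i \<ge> N" "j \<ge> N" for i j
    proof -
      have "2 / real (Suc i) \<le> 2 / real (Suc N)" "2 / real (Suc j) \<le> 2 / real (Suc N)"
        using that by (auto intro!: divide_left_mono)
      moreover have "4 / real (Suc N) < e\<^sup>2" using N e by (simp add: field_simps)
      ultimately have "(norm (Y i - Y j))\<^sup>2 < e\<^sup>2" using par[of i j] by simp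
      then show ?thesis using e by (simp add: dist_norm power_less_imp_less_base)
    qed
    then show "\<exists>M. \<forall>m\<ge>M. \<forall>n\<ge>M. dist (Y m) (Y n) < e" by blast
  qed
  then obtain y where y: "Y \<longlonglongrightarrow> y" using Cauchy_convergent convergent_def by blast
  have yS: "y \<in> S" using closed_sequentially[OF S(2)] Y(1) y by blast
  have "(\<lambda>n. (norm (x - Y n))\<^sup>2) \<longlonglongrightarrow> (norm (x - y))\<^sup>2" by (intro tendsto_intros y)
  moreover have "(\<lambda>n. D + 1 / real (Suc n)) \<longlonglongrightarrow> D + 0"
    by (intro tendsto_intros LIMSEQ_Suc lim_1_over_n)
  ultimately have le: "(norm (x - y))\<^sup>2 \<le> D" using Y(2) by (intro LIMSEQ_le) (auto intro: less_imp_le)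
  have "inner (x - y) z = 0" if z: "z \<in> S" for z
  proof (cases "z = 0")
    case False
    define t where "t = inner (x - y) z / inner z z"
    have "y + t *\<^sub>R z \<in> S" using yS z S(1) by (intro subspace_add subspace_scale)
    then have "(norm (x - y))\<^sup>2 \<le> (norm (x - y - t *\<^sub>R z))\<^sup>2" using D le by (metis diff_diff_eq order_trans)
    also have "\<dots> = (norm (x - y))\<^sup>2 - 2 * t * inner (x - y) z + t\<^sup>2 * inner z z"
      by (simp only: power2_norm_eq_inner inner_diff_left inner_diff_right inner_scaleR_left inner_scaleR_right)
        (simp add: inner_commute algebra_simps power2_eq_square)
    also have "\<dots> = (norm (x - y))\<^sup>2 - (inner (x - y) z)\<^sup>2 / inner z z"
      using False by (simp add: t_def power2_eq_square field_simps)
    finally have "(inner (x - y) z)\<^sup>2 / inner z z \<le> 0" by simp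
    moreover have "inner z z > 0" using False by simp
    ultimately show ?thesis by (simp add: divide_le_0_iff)
  qed simp
  then show ?thesis using yS by blast
qed

section \<open>Positive operators with compact resolvent\<close>

locale positive_operator =
  fixes A :: "'h::chilbert_space operator"
  assumes sa: "selfadjoint A" and pd: "positive_definite A" and cr: "compact_resolvent A"
begin

abbreviation "D \<equiv> opdom A"
abbreviation "f \<equiv> opfun A"
abbreviation "E \<equiv> eigenspace A"
abbreviation "P \<equiv> eigproj A"

lemma D_closed: "0 \<in> D" "x \<in> D \<Longrightarrow> y \<in> D \<Longrightarrow> x + y \<in> D" "x \<in> D \<Longrightarrow> c *\<^sub>C x \<in> D" "x \<in> D \<Longrightarrow> r *\<^sub>R x \<in> D"
  "x \<in> D \<Longrightarrow> y \<in> D \<Longrightarrow> x - y \<in> D"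
proof -
  have s: "complex_vector.subspace D" using sa by (auto simp: selfadjoint_def clinear_on_def)
  show "0 \<in> D" "x \<in> D \<Longrightarrow> y \<in> D \<Longrightarrow> x + y \<in> D" "x \<in> D \<Longrightarrow> c *\<^sub>C x \<in> D" "x \<in> D \<Longrightarrow> r *\<^sub>R x \<in> D"
    "x \<in> D \<Longrightarrow> y \<in> D \<Longrightarrow> x - y \<in> D"
    using s complex_vector.subspace_diff[OF s, of x y] by (auto simp: complex_vector.subspace_def scaleR_scaleC)
qed

lemma f_linear: "x \<in> D \<Longrightarrow> y \<in> D \<Longrightarrow> f (x + y) = f x + f y" "x \<in> D \<Longrightarrow> f (c *\<^sub>C x) = c *\<^sub>C f x"
  "x \<in> D \<Longrightarrow> f (r *\<^sub>R x) = r *\<^sub>R f x" "x \<in> D \<Longrightarrow> y \<in> D \<Longrightarrow> f (x - y) = f x - f y" "f 0 = 0"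
proof -
  have a: "f (x + y) = f x + f y" if "x \<in> D" "y \<in> D" for x y using sa that by (auto simp: selfadjoint_def clinear_on_def)
  have s: "f (c *\<^sub>C x) = c *\<^sub>C f x" if "x \<in> D" for x c using sa that by (auto simp: selfadjoint_def clinear_on_def)
  have r: "f (r *\<^sub>R x) = r *\<^sub>R f x" if "x \<in> D" for x r using s[OF that] by (simp add: scaleR_scaleC)
  show "x \<in> D \<Longrightarrow> y \<in> D \<Longrightarrow> f (x + y) = f x + f y" "x \<in> D \<Longrightarrow> f (c *\<^sub>C x) = c *\<^sub>C f x"
    "x \<in> D \<Longrightarrow> f (r *\<^sub>R x) = r *\<^sub>R f x" using a s r by auto
  show "x \<in> D \<Longrightarrow> y \<in> D \<Longrightarrow> f (x - y) = f x - f y"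
    using a[of "x - y" y] D_closed(5) by (simp add: algebra_simps)
  show "f 0 = 0" using r[of 0 0] D_closed(1) by simp
qed

lemma f_sym: "x \<in> D \<Longrightarrow> y \<in> D \<Longrightarrow> inner (f x) y = inner x (f y)"
  using sa unfolding selfadjoint_def inner_eq_Re_cinner by metis

text \<open>
  The maximality contained in self-adjointness, tested with the real inner product only; the imaginary
  parts follow by replacing \<open>x\<close> with \<open>\<i> x\<close>.
\<close>

lemma f_adjoint:
  assumes "\<And>x. x \<in> D \<Longrightarrow> inner (f x) y = inner x z"
  shows "y \<in> D" "f y = z"
proof -
  have "cinner (f x) y = cinner x z" if x: "x \<in> D" for x
  proof (rule complex_eqI)
    show "Re (cinner (f x) y) = Re (cinner x z)" using assms[OF x] by (simp add: inner_eq_Re_cinner)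
    have "inner (f (\<i> *\<^sub>C x)) y = inner (\<i> *\<^sub>C x) z" using assms D_closed(3) x by blast
    then show "Im (cinner (f x) y) = Im (cinner x z)"
      by (simp add: f_linear(2)[OF x] inner_eq_Re_cinner cinner_scaleC_left)
  qed
  then show "y \<in> D" "f y = z" using sa unfolding selfadjoint_def by blast+
qed

lemma f_pos: "x \<in> D \<Longrightarrow> inner (f x) x \<ge> 0" "x \<in> D \<Longrightarrow> x \<noteq> 0 \<Longrightarrow> inner (f x) x > 0"
proof -
  show gt: "x \<in> D \<Longrightarrow> x \<noteq> 0 \<Longrightarrow> inner (f x) x > 0"
    using pd unfolding positive_definite_def inner_eq_Re_cinner by blast
  show "x \<in> D \<Longrightarrow> inner (f x) x \<ge> 0" using gt by (cases "x = 0") auto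
qed

lemma f_closed:
  assumes "\<And>n. X n \<in> D" "X \<longlonglongrightarrow> x" "(\<lambda>n. f (X n)) \<longlonglongrightarrow> y"
  shows "x \<in> D" "f x = y"
proof -
  have "inner (f d) x = inner d y" if "d \<in> D" for d
  proof (rule LIMSEQ_unique)
    show "(\<lambda>n. inner (f d) (X n)) \<longlonglongrightarrow> inner (f d) x" by (intro tendsto_intros assms)
    have "(\<lambda>n. inner d (f (X n))) \<longlonglongrightarrow> inner d y" by (intro tendsto_intros assms)
    then show "(\<lambda>n. inner (f d) (X n)) \<longlonglongrightarrow> inner d y" using f_sym[OF that assms(1)] by simp
  qed
  then show "x \<in> D" "f x = y" using f_adjoint by blast+
qed

lemma shift_bound: "x \<in> D \<Longrightarrow> norm x \<le> norm (f x + x)"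
proof -
  assume x: "x \<in> D"
  have "norm x * norm x \<le> inner (f x + x) x" using f_pos(1)[OF x] by (simp add: inner_simps power2_norm_eq_inner[symmetric] power2_eq_square)
  also have "\<dots> \<le> norm (f x + x) * norm x" by (rule norm_cauchy_schwarz)
  finally show ?thesis using norm_ge_zero mult_right_le_imp_le by (cases "norm x = 0") (auto simp: mult_le_cancel_right)
qed

text \<open>
  The range of \<open>A + 1\<close> is closed by \<open>shift_bound\<close>. A vector orthogonal to it lies in the domain of the
  adjoint \<open>A\<close> and is an eigenvector for \<open>-1\<close>, hence zero by positivity.
\<close>

lemma shift_surj: "\<exists>x\<in>D. f x + x = y"
proof -
  define S where "S = (\<lambda>x. f x + x) ` D"
  have "subspace S" unfolding S_def
  proof (rule subspaceI)
    show "0 \<in> (\<lambda>x. f x + x) ` D" using D_closed(1) f_linear(5) by force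
    show "u + v \<in> (\<lambda>x. f x + x) ` D" if uv: "u \<in> (\<lambda>x. f x + x) ` D" "v \<in> (\<lambda>x. f x + x) ` D" for u v
    proof -
      obtain a b where "a \<in> D" "b \<in> D" "u = f a + a" "v = f b + b" using uv by auto
      then have "u + v = f (a + b) + (a + b)" "a + b \<in> D" using f_linear D_closed by (auto simp: algebra_simps)
      then show ?thesis by blast
    qed
    show "c *\<^sub>R u \<in> (\<lambda>x. f x + x) ` D" if u: "u \<in> (\<lambda>x. f x + x) ` D" for c u
    proof -
      obtain a where "a \<in> D" "u = f a + a" using u by auto
      then have "c *\<^sub>R u = f (c *\<^sub>R a) + c *\<^sub>R a" "c *\<^sub>R a \<in> D" using f_linear D_closed by (auto simp: algebra_simps)
      then show ?thesis by blast
    qed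
  qed
  moreover have "closed S"
  proof (rule iffD2[OF closed_sequential_limits], intro allI impI)
    fix Y l assume Y: "(\<forall>n. Y n \<in> S) \<and> Y \<longlonglongrightarrow> l"
    then obtain X where X: "\<And>n. X n \<in> D" "\<And>n. Y n = f (X n) + X n" unfolding S_def image_iff by metis
    have "dist (X i) (X j) \<le> dist (Y i) (Y j)" for i j
      using shift_bound[of "X i - X j"] X D_closed f_linear by (simp add: dist_norm algebra_simps)
    moreover have "Cauchy Y" using Y LIMSEQ_imp_Cauchy by blast
    ultimately have "Cauchy X" unfolding Cauchy_def by (meson le_less_trans)
    then obtain x where x: "X \<longlonglongrightarrow> x" using Cauchy_convergent convergent_def by blast
    have "(\<lambda>n. Y n - X n) \<longlonglongrightarrow> l - x" using Y x by (intro tendsto_intros) auto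
    then have "(\<lambda>n. f (X n)) \<longlonglongrightarrow> l - x" using X(2) by simp
    from f_closed[OF X(1) x this] show "l \<in> S" unfolding S_def by (auto intro!: image_eqI[of _ _ x])
  qed
  ultimately obtain s where s: "s \<in> S" "\<forall>z\<in>S. inner (y - s) z = 0" using closed_subspace_projection by blast
  have "inner (f x) (y - s) = inner x (- (y - s))" if "x \<in> D" for x
  proof -
    have "f x + x \<in> S" using that by (auto simp: S_def)
    then have "inner (f x + x) (y - s) = 0" using s(2) inner_commute by metis
    then show ?thesis by (simp add: inner_add_left inner_minus_right del: minus_diff_eq)
  qed
  from f_adjoint[OF this] have d: "y - s \<in> D" "f (y - s) = - (y - s)" by auto
  have "- inner (y - s) (y - s) \<ge> 0" using f_pos(1)[OF d(1)] unfolding d(2) inner_minus_left .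
  then have "inner (y - s) (y - s) = 0" using inner_ge_zero[of "y - s"] by linarith
  then have "y - s = 0" by (simp only: inner_eq_zero_iff)
  then show ?thesis using s(1) by (auto simp: S_def)
qed

text \<open>
  \<open>K = (A + 1)^(-1)\<close>, a bounded positive operator with the same eigenvectors as \<open>A\<close>.
\<close>

definition K where "K y = (SOME x. x \<in> D \<and> f x + x = y)"

lemma K: "K y \<in> D" "f (K y) + K y = y"
  using someI_ex[of "\<lambda>x. x \<in> D \<and> f x + x = y"] shift_surj[of y] unfolding K_def by blast+

lemma K_unique: "x \<in> D \<Longrightarrow> f x + x = y \<Longrightarrow> K y = x"
  using shift_bound[of "K y - x"] K[of y] D_closed f_linear by (simp add: algebra_simps)

lemma K_linear: "K (r *\<^sub>R x) = r *\<^sub>R K x" "K (x - y) = K x - K y"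
proof -
  show "K (r *\<^sub>R x) = r *\<^sub>R K x"
    using K[of x] D_closed(4) by (intro K_unique) (auto simp: f_linear(3)[OF K(1)] scaleR_right_distrib[symmetric])
  show "K (x - y) = K x - K y"
  proof (rule K_unique)
    show "K x - K y \<in> D" using K(1) D_closed(5) by blast
    have "f (K x - K y) + (K x - K y) = (f (K x) + K x) - (f (K y) + K y)"
      by (simp add: f_linear(4)[OF K(1) K(1)])
    then show "f (K x - K y) + (K x - K y) = x - y" by (simp add: K(2))
  qed
qed

lemma K_norm: "norm (K y) \<le> norm y" using shift_bound[OF K(1)] K(2) by simp

lemma K_sym: "inner (K x) y = inner x (K y)"
proof -
  have "inner (K x) (f (K y) + K y) = inner (f (K x) + K x) (K y)"
    by (simp add: inner_simps f_sym[OF K(1) K(1)])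
  then show ?thesis by (simp add: K)
qed

lemma K_pos: "inner (K x) x \<ge> 0" "x \<noteq> 0 \<Longrightarrow> inner (K x) x > 0"
proof -
  have eq: "inner (K x) x = inner (f (K x)) (K x) + (norm (K x))\<^sup>2"
    by (subst (2) K(2)[of x, symmetric]) (simp add: inner_simps power2_norm_eq_inner inner_commute)
  then show "inner (K x) x \<ge> 0" using f_pos(1)[OF K(1)[of x]] by simp
  assume "x \<noteq> 0"
  then have "K x \<noteq> 0" using K(2)[of x] f_linear(5) by auto
  then have "(norm (K x))\<^sup>2 > 0" by simp
  then show "inner (K x) x > 0" unfolding eq using f_pos(1)[OF K(1)[of x]] by linarith
qed

text \<open>
  Compactness passes from the resolvent at the given point \<open>z\<close> to the one at \<open>-1\<close>: on the unit ball
  \<open>K y\<close> has a bounded image under \<open>z - A\<close>, so it lies in a multiple of the compact set.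
\<close>

lemma K_compact: "\<exists>C. compact C \<and> (\<forall>y. norm y \<le> 1 \<longrightarrow> K y \<in> C)"
proof -
  obtain z where bij: "bij_betw (\<lambda>x. z *\<^sub>C x - f x) D UNIV"
    and cp: "compact (closure (inv_into D (\<lambda>x. z *\<^sub>C x - f x) ` cball 0 1))"
    using cr unfolding compact_resolvent_def by blast
  define G where "G = (\<lambda>x. z *\<^sub>C x - f x)"
  define C0 where "C0 = closure (inv_into D G ` cball 0 1)"
  define c where "c = cmod (z + 1) + 1"
  have c: "c > 0" unfolding c_def by (simp add: add_nonneg_pos)
  have "K y \<in> (\<lambda>x. c *\<^sub>R x) ` C0" if y: "norm y \<le> 1" for y
  proof -
    define k where "k = (1 / c) *\<^sub>R K y"
    have kD: "k \<in> D" unfolding k_def using K D_closed by auto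
    have "f (K y) = y - K y" using K(2)[of y] by (metis add_diff_cancel_right')
    then have "G (K y) = (z + 1) *\<^sub>C K y - y" by (simp add: G_def scaleC_add_left scaleC_one)
    then have "norm (G (K y)) \<le> cmod (z + 1) * norm (K y) + norm y" by (metis norm_scaleC norm_triangle_ineq4)
    also have "\<dots> \<le> cmod (z + 1) * 1 + 1" using K_norm[of y] y by (intro add_mono mult_left_mono) auto
    finally have n: "norm (G (K y)) \<le> c" by (simp add: c_def)
    have "G k = (1 / c) *\<^sub>R G (K y)" unfolding G_def k_def f_linear(3)[OF K(1)]
      by (simp add: scaleR_scaleC scaleC_scaleC mult.commute complex_vector.scale_right_diff_distrib)
    then have "norm (G k) \<le> 1" using n c by (simp add: divide_le_eq)
    then have "inv_into D G (G k) \<in> C0" unfolding C0_def by (intro subsetD[OF closure_subset] imageI) simp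
    moreover have "inv_into D G (G k) = k" using bij kD unfolding G_def[symmetric] by (simp add: bij_betw_inv_into_left)
    ultimately have "k \<in> C0" by simp
    then show ?thesis using c by (auto intro!: image_eqI[of _ _ k] simp: k_def)
  qed
  moreover have "compact ((\<lambda>x. c *\<^sub>R x) ` C0)" using cp unfolding C0_def G_def by (rule compact_scaling)
  ultimately show ?thesis by blast
qed

section \<open>Eigenspaces and their completeness\<close>

lemma E_iff: "e \<in> E \<mu> \<longleftrightarrow> e \<in> D \<and> f e = \<mu> *\<^sub>R e" by (simp add: eigenspace_def)

lemma E_closed_ops: "0 \<in> E \<mu>" "x \<in> E \<mu> \<Longrightarrow> y \<in> E \<mu> \<Longrightarrow> x + y \<in> E \<mu>" "x \<in> E \<mu> \<Longrightarrow> c *\<^sub>C x \<in> E \<mu>"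
  "x \<in> E \<mu> \<Longrightarrow> r *\<^sub>R x \<in> E \<mu>" "x \<in> E \<mu> \<Longrightarrow> y \<in> E \<mu> \<Longrightarrow> x - y \<in> E \<mu>" "x \<in> E \<mu> \<Longrightarrow> - x \<in> E \<mu>"
proof -
  have s: "r *\<^sub>R x \<in> E \<mu>" if "x \<in> E \<mu>" for r x using that by (auto simp: E_iff D_closed f_linear mult.commute)
  show "0 \<in> E \<mu>" "x \<in> E \<mu> \<Longrightarrow> y \<in> E \<mu> \<Longrightarrow> x + y \<in> E \<mu>" "x \<in> E \<mu> \<Longrightarrow> y \<in> E \<mu> \<Longrightarrow> x - y \<in> E \<mu>"
    by (auto simp: E_iff D_closed f_linear algebra_simps)
  show "x \<in> E \<mu> \<Longrightarrow> c *\<^sub>C x \<in> E \<mu>" by (auto simp: E_iff D_closed f_linear scaleR_scaleC scaleC_scaleC mult.commute)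
  show "x \<in> E \<mu> \<Longrightarrow> r *\<^sub>R x \<in> E \<mu>" by (rule s)
  show "x \<in> E \<mu> \<Longrightarrow> - x \<in> E \<mu>" using s[of x "-1"] by simp
qed

lemma E_subspace: "subspace (E \<mu>)" using E_closed_ops by (auto intro: subspaceI)

lemma E_closed: "closed (E \<mu>)"
proof (rule iffD2[OF closed_sequential_limits], intro allI impI)
  fix X l assume X: "(\<forall>n. X n \<in> E \<mu>) \<and> X \<longlonglongrightarrow> l"
  then have "(\<lambda>n. \<mu> *\<^sub>R X n) \<longlonglongrightarrow> \<mu> *\<^sub>R l" by (intro tendsto_intros) auto
  moreover have "f (X n) = \<mu> *\<^sub>R X n" for n using X E_iff by auto
  ultimately show "l \<in> E \<mu>" using f_closed[of X l "\<mu> *\<^sub>R l"] X E_iff by auto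
qed

lemma E_pos: "e \<in> E \<mu> \<Longrightarrow> e \<noteq> 0 \<Longrightarrow> \<mu> > 0"
proof -
  assume e: "e \<in> E \<mu>" "e \<noteq> 0"
  then have "inner (f e) e > 0" using f_pos(2) E_iff by blast
  then have "\<mu> * inner e e > 0" using e unfolding E_iff by simp
  moreover have "inner e e > 0" using e by simp
  ultimately show ?thesis using zero_less_mult_pos2 by blast
qed

lemma E_orthogonal: "x \<in> E \<mu> \<Longrightarrow> y \<in> E \<nu> \<Longrightarrow> \<mu> \<noteq> \<nu> \<Longrightarrow> inner x y = 0"
  using f_sym[of x y] by (auto simp: E_iff)

text \<open>
  The defining description of \<open>eigproj\<close>, with the real inner product in place of the complex one.
\<close>

lemma P_in: "P \<mu> x \<in> E \<mu>" and P_orth: "z \<in> E \<mu> \<Longrightarrow> inner (x - P \<mu> x) z = 0"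
  and P_unique: "y \<in> E \<mu> \<Longrightarrow> (\<And>z. z \<in> E \<mu> \<Longrightarrow> inner (x - y) z = 0) \<Longrightarrow> P \<mu> x = y"
proof -
  have eq: "P \<mu> x = (THE y. y \<in> E \<mu> \<and> (\<forall>z\<in>E \<mu>. inner (x - y) z = 0))"
    unfolding eigproj_def using cinner_orthogonal_iff[of "E \<mu>"] E_closed_ops(3) by presburger
  obtain y0 where y0: "y0 \<in> E \<mu>" "\<forall>z\<in>E \<mu>. inner (x - y0) z = 0"
    using closed_subspace_projection[OF E_subspace E_closed] by blast
  have un: "y = y0" if "y \<in> E \<mu> \<and> (\<forall>z\<in>E \<mu>. inner (x - y) z = 0)" for y
  proof -
    have "y - y0 \<in> E \<mu>" using that y0 E_closed_ops by auto
    then have "inner (x - y0) (y - y0) = 0" "inner (x - y) (y - y0) = 0" using that y0(2) by blast+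
    then have "inner (y - y0) (y - y0) = 0" by (simp add: inner_diff_left)
    then show ?thesis by simp
  qed
  have P: "P \<mu> x = y0" unfolding eq by (rule the_equality) (use y0 in blast, use un in blast)
  show "P \<mu> x \<in> E \<mu>" and P_orth: "z \<in> E \<mu> \<Longrightarrow> inner (x - P \<mu> x) z = 0" using P y0 by blast+
  show "y \<in> E \<mu> \<Longrightarrow> (\<And>z. z \<in> E \<mu> \<Longrightarrow> inner (x - y) z = 0) \<Longrightarrow> P \<mu> x = y" using P un by blast
qed

lemma P_zero_iff: "P \<mu> x = 0 \<longleftrightarrow> (\<forall>e\<in>E \<mu>. inner x e = 0)"
proof
  assume "P \<mu> x = 0"
  then show "\<forall>e\<in>E \<mu>. inner x e = 0" using P_orth[of _ \<mu> x] by simp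
next
  assume "\<forall>e\<in>E \<mu>. inner x e = 0"
  then show "P \<mu> x = 0" by (intro P_unique E_closed_ops) simp
qed

lemma P_same: "e \<in> E \<mu> \<Longrightarrow> P \<mu> e = e" by (rule P_unique) auto
lemma P_other: "e \<in> E \<nu> \<Longrightarrow> \<mu> \<noteq> \<nu> \<Longrightarrow> P \<mu> e = 0"
  unfolding P_zero_iff by (metis E_orthogonal)

lemma P_norm: "norm (P \<mu> x) \<le> norm x"
proof -
  have "inner (x - P \<mu> x) (P \<mu> x) = 0" using P_orth P_in by blast
  then have "norm (P \<mu> x) * norm (P \<mu> x) = inner x (P \<mu> x)" by (simp add: inner_simps power2_norm_eq_inner[symmetric] power2_eq_square)
  also have "\<dots> \<le> norm x * norm (P \<mu> x)" by (rule norm_cauchy_schwarz)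
  finally show ?thesis by (cases "norm (P \<mu> x) = 0") (auto simp: mult_le_cancel_right)
qed

lemma P_linear: "bounded_linear (P \<mu>)"
proof (rule bounded_linear_intro[of _ 1])
  show "P \<mu> (x + y) = P \<mu> x + P \<mu> y" for x y
  proof (rule P_unique)
    show "P \<mu> x + P \<mu> y \<in> E \<mu>" by (rule E_closed_ops(2)[OF P_in P_in])
    fix z assume z: "z \<in> E \<mu>"
    have "inner (x + y - (P \<mu> x + P \<mu> y)) z = inner (x - P \<mu> x) z + inner (y - P \<mu> y) z"
      by (simp add: inner_add_left inner_diff_left)
    then show "inner (x + y - (P \<mu> x + P \<mu> y)) z = 0" using P_orth[OF z] by simp
  qed
  show "P \<mu> (r *\<^sub>R x) = r *\<^sub>R P \<mu> x" for r x
  proof (rule P_unique)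
    show "r *\<^sub>R P \<mu> x \<in> E \<mu>" by (rule E_closed_ops(4)[OF P_in])
    show "inner (r *\<^sub>R x - r *\<^sub>R P \<mu> x) z = 0" if "z \<in> E \<mu>" for z
      using P_orth[OF that, of x] by (simp add: scaleR_right_diff_distrib[symmetric])
  qed
qed (use P_norm in simp)

lemma K_eigen:
  assumes e: "e \<in> E \<mu>"
  shows "K e = (1 / (1 + \<mu>)) *\<^sub>R e"
proof (rule K_unique)
  show D: "(1 / (1 + \<mu>)) *\<^sub>R e \<in> D" using e E_iff D_closed(4) by blast
  have fe: "f e = \<mu> *\<^sub>R e" "e \<in> D" using e E_iff by auto
  show "f ((1 / (1 + \<mu>)) *\<^sub>R e) + (1 / (1 + \<mu>)) *\<^sub>R e = e"
  proof (cases "e = 0")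
    case False
    then have "\<mu> > 0" using E_pos[OF e] by auto
    have "f ((1 / (1 + \<mu>)) *\<^sub>R e) + (1 / (1 + \<mu>)) *\<^sub>R e = (1 / (1 + \<mu>) * \<mu> + 1 / (1 + \<mu>)) *\<^sub>R e"
      unfolding f_linear(3)[OF fe(2)] fe(1) by (simp add: scaleR_left_distrib)
    also have "1 / (1 + \<mu>) * \<mu> + 1 / (1 + \<mu>) = 1" using \<open>\<mu> > 0\<close> by (simp add: field_simps)
    finally show ?thesis by simp
  qed (simp add: f_linear(5))
qed

text \<open>
  Let \<open>V\<close> be the orthogonal complement of all eigenvectors. It is invariant under \<open>K\<close>. If it were not
  zero, then \<open>\<langle>K u, u\<rangle>\<close> would, by compactness, attain its supremum \<open>L > 0\<close> on the unit sphere of \<open>V\<close>, and a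
  maximiser is an eigenvector of \<open>K\<close> for \<open>L\<close>, hence one of \<open>A\<close> for \<open>1/L - 1\<close>, inside \<open>V\<close>.
\<close>

lemma spectral_completeness:
  assumes "\<And>\<mu>. P \<mu> x = 0"
  shows "x = 0"
proof (rule ccontr)
  assume x0: "x \<noteq> 0"
  define V where "V = {x. \<forall>\<mu>. \<forall>e\<in>E \<mu>. inner x e = 0}"
  have V: "r *\<^sub>R u - s *\<^sub>R v \<in> V" if "u \<in> V" "v \<in> V" for u v r s using that by (auto simp: V_def inner_simps)
  have V1: "r *\<^sub>R u \<in> V" if "u \<in> V" for u r using that by (auto simp: V_def inner_simps)
  have KV: "K u \<in> V" if "u \<in> V" for u using that by (auto simp: V_def K_sym K_eigen)
  have xV: "x \<in> V" using assms P_zero_iff by (auto simp: V_def)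
  define S where "S = (\<lambda>u. inner (K u) u) ` {u\<in>V. norm u = 1}"
  define L where "L = Sup S"
  have "inner (K u) u \<le> 1" if "norm u = 1" for u
    using norm_cauchy_schwarz[of "K u" u] K_norm[of u] that by simp
  then have bdd: "bdd_above S" unfolding S_def by (auto intro!: bdd_aboveI[of _ 1])
  define x1 where "x1 = (1 / norm x) *\<^sub>R x"
  have x1: "x1 \<in> V" "norm x1 = 1" using x0 V1[OF xV] by (auto simp: x1_def)
  then have "x1 \<noteq> 0" by auto
  then have L0: "L > 0" using K_pos(2)[of x1] x1 cSup_upper[OF _ bdd, of "inner (K x1) x1"] by (auto simp: L_def S_def)
  have up: "inner (K u) u \<le> L * (norm u)\<^sup>2" if u: "u \<in> V" for u
  proof (cases "u = 0")
    case False
    define u1 where "u1 = (1 / norm u) *\<^sub>R u"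
    have "u1 \<in> V" "norm u1 = 1" using False V1[OF u] by (auto simp: u1_def)
    then have "inner (K u1) u1 \<le> L" unfolding L_def by (intro cSup_upper[OF _ bdd]) (auto simp: S_def)
    then show ?thesis using False by (simp add: u1_def K_linear power2_eq_square field_simps)
  qed simp
  \<comment> \<open>A Cauchy--Schwarz inequality for the positive form \<open>\<langle>K u,
    u\<rangle>\<close>: it is evaluated at \<open>L u - K u\<close>.\<close>
  have key: "(norm (K u))\<^sup>2 \<le> L * inner (K u) u" if u: "u \<in> V" for u
  proof -
    define a where "a = K u"
    have "0 \<le> inner (K (L *\<^sub>R u - a)) (L *\<^sub>R u - a)" by (rule K_pos)
    also have "\<dots> = L\<^sup>2 * inner (K u) u - 2 * L * inner a a + inner (K a) a"
      by (simp add: K_linear inner_simps a_def[symmetric] K_sym[of a u] power2_eq_square inner_commute[of u a] algebra_simps)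
    also have "inner (K a) a \<le> L * inner a a" using up[OF KV[OF u]] by (simp add: a_def power2_norm_eq_inner)
    finally have "L * inner a a \<le> L * (L * inner (K u) u)" by (simp add: power2_eq_square algebra_simps)
    then show ?thesis using L0 by (simp add: a_def power2_norm_eq_inner)
  qed
  have "\<exists>u\<in>V. norm u = 1 \<and> L - 1 / real (Suc n) < inner (K u) u" for n
  proof -
    have "S \<noteq> {}" using x1 by (auto simp: S_def)
    moreover have "L - 1 / real (Suc n) < Sup S" by (simp add: L_def)
    ultimately obtain s where "s \<in> S" "L - 1 / real (Suc n) < s" using less_cSup_iff[OF _ bdd] by blast
    then show ?thesis by (auto simp: S_def)
  qed
  then obtain X where X: "\<And>n. X n \<in> V" "\<And>n. norm (X n) = 1" "\<And>n. L - 1 / real (Suc n) < inner (K (X n)) (X n)" by metis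
  \<comment> \<open>A maximising sequence consists of approximate eigenvectors.\<close>
  have "(norm (K (X n) - L *\<^sub>R X n))\<^sup>2 \<le> L * (1 / real (Suc n))" for n
  proof -
    have "(norm (K (X n) - L *\<^sub>R X n))\<^sup>2 = (norm (K (X n)))\<^sup>2 - 2 * L * inner (K (X n)) (X n) + L * L * (norm (X n))\<^sup>2"
      by (simp add: power2_norm_eq_inner inner_simps inner_commute)
    also have "\<dots> \<le> L * (L - inner (K (X n)) (X n))" using key[OF X(1)[of n]] by (simp add: X(2) power2_eq_square algebra_simps)
    also have "\<dots> \<le> L * (1 / real (Suc n))" using X(3)[of n] L0 by (intro mult_left_mono) auto
    finally show ?thesis .
  qed
  moreover have "(\<lambda>n. L * (1 / real (Suc n))) \<longlonglongrightarrow> L * 0" by (intro tendsto_intros LIMSEQ_Suc lim_1_over_n)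
  ultimately have "(\<lambda>n. (norm (K (X n) - L *\<^sub>R X n))\<^sup>2) \<longlonglongrightarrow> 0"
    using tendsto_sandwich[of "\<lambda>_. 0" "\<lambda>n. (norm (K (X n) - L *\<^sub>R X n))\<^sup>2" sequentially "\<lambda>n. L * (1 / real (Suc n))" 0] by auto
  then have "(\<lambda>n. sqrt ((norm (K (X n) - L *\<^sub>R X n))\<^sup>2)) \<longlonglongrightarrow> sqrt 0" by (rule tendsto_real_sqrt)
  then have d0: "(\<lambda>n. K (X n) - L *\<^sub>R X n) \<longlonglongrightarrow> 0" by (simp add: tendsto_norm_zero_iff)
  obtain C where C: "compact C" "\<And>y. norm y \<le> 1 \<Longrightarrow> K y \<in> C" using K_compact by blast
  then have "seq_compact C" by (simp add: compact_eq_seq_compact_metric)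
  then obtain l r where r: "strict_mono r" "((\<lambda>n. K (X n)) \<circ> r) \<longlonglongrightarrow> l"
    using C(2) X(2) unfolding seq_compact_def by (metis order_refl)
  have "(\<lambda>n. K (X (r n)) - (K (X (r n)) - L *\<^sub>R X (r n))) \<longlonglongrightarrow> l - 0"
    using r LIMSEQ_subseq_LIMSEQ[OF d0 r(1)] by (intro tendsto_diff) (auto simp: comp_def)
  then have Ll: "(\<lambda>n. L *\<^sub>R X (r n)) \<longlonglongrightarrow> l" by simp
  define y where "y = (1 / L) *\<^sub>R l"
  have "(\<lambda>n. (1 / L) *\<^sub>R L *\<^sub>R X (r n)) \<longlonglongrightarrow> y" unfolding y_def by (intro tendsto_scaleR tendsto_const Ll)
  then have y: "(\<lambda>n. X (r n)) \<longlonglongrightarrow> y" using L0 by simp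
  have ny: "norm y = 1"
    using LIMSEQ_unique[OF tendsto_norm[OF y], of 1] by (simp add: X(2))
  have yV: "y \<in> V"
  proof -
    have "inner y e = 0" if "e \<in> E \<mu>" for e \<mu>
    proof (rule LIMSEQ_unique)
      show "(\<lambda>n. inner (X (r n)) e) \<longlonglongrightarrow> inner y e" by (intro tendsto_intros y)
      show "(\<lambda>n. inner (X (r n)) e) \<longlonglongrightarrow> 0" using X(1) that by (simp add: V_def)
    qed
    then show ?thesis by (simp add: V_def)
  qed
  have "(\<lambda>n. K (X (r n) - y)) \<longlonglongrightarrow> 0"
  proof (rule Lim_null_comparison)
    show "\<forall>\<^sub>F n in sequentially. norm (K (X (r n) - y)) \<le> norm (X (r n) - y)" using K_norm by simp
    show "(\<lambda>n. norm (X (r n) - y)) \<longlonglongrightarrow> 0" using y by (simp add: LIM_zero tendsto_norm_zero)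
  qed
  then have "(\<lambda>n. K (X (r n))) \<longlonglongrightarrow> K y" by (simp add: K_linear LIM_zero_iff)
  then have "K y = l" using r(2) LIMSEQ_unique unfolding comp_def by blast
  then have Ky: "K y = L *\<^sub>R y" using L0 by (simp add: y_def)
  have "y \<in> E (1 / L - 1)"
  proof -
    have yK: "y = (1 / L) *\<^sub>R K y" using Ky L0 by simp
    then have yD: "y \<in> D" using K(1) D_closed(4) by metis
    have "L *\<^sub>R f y + L *\<^sub>R y = y" using K(2)[of y] unfolding Ky f_linear(3)[OF yD] .
    then have "(1 / L) *\<^sub>R (L *\<^sub>R f y) = (1 / L) *\<^sub>R (y - L *\<^sub>R y)" by (metis add_diff_cancel_right')
    then have "f y = (1 / L - 1) *\<^sub>R y" using L0 by (simp add: algebra_simps)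
    then show ?thesis using yD E_iff by blast
  qed
  then have "inner y y = 0" using yV by (auto simp: V_def)
  then show False using ny by simp
qed

section \<open>Expansions in eigenvectors\<close>

lemma norm_sum_orthogonal:
  assumes "\<And>\<mu>. z \<mu> \<in> E \<mu>" "finite F"
  shows "(norm (sum z F))\<^sup>2 = (\<Sum>\<mu>\<in>F. (norm (z \<mu>))\<^sup>2)"
  using assms(2)
proof (induction F)
  case (insert a F)
  have "inner (z a) (sum z F) = 0"
    unfolding inner_sum_right using insert(2) assms(1) by (intro sum.neutral) (metis E_orthogonal)
  then have "(norm (z a + sum z F))\<^sup>2 = (norm (z a))\<^sup>2 + (norm (sum z F))\<^sup>2"
    by (simp add: power2_norm_eq_inner inner_simps inner_commute)
  then show ?case using insert by simp
qed simp

lemma riesz_fischer: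
  assumes z: "\<And>\<mu>. z \<mu> \<in> E \<mu>" and sm: "(\<lambda>\<mu>. (norm (z \<mu>))\<^sup>2) summable_on UNIV"
  shows "\<exists>y. (z has_sum y) UNIV"
proof -
  define q where "q = sum (\<lambda>\<mu>. (norm (z \<mu>))\<^sup>2)"
  obtain L where L: "(q \<longlongrightarrow> L) (finite_subsets_at_top UNIV)"
    using sm unfolding summable_on_def has_sum_def q_def by blast
  have "\<exists>y. (sum z \<longlongrightarrow> y) (finite_subsets_at_top UNIV)"
  proof (rule tendsto_of_cauchy_net)
    fix e :: real assume e: "e > 0"
    then have "e\<^sup>2 / 16 > 0" by simp
    then have "\<forall>\<^sub>F F in finite_subsets_at_top UNIV. dist (q F) L < e\<^sup>2 / 16" using L tendstoD by blast
    then obtain F0 where F0: "finite F0" "\<And>F. finite F \<Longrightarrow> F0 \<subseteq> F \<Longrightarrow> dist (q F) L < e\<^sup>2 / 16"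
      unfolding eventually_finite_subsets_at_top by auto
    have near: "norm (sum z F - sum z F0) < e / 2" if F: "finite F" "F0 \<subseteq> F" for F
    proof -
      have "(norm (sum z F - sum z F0))\<^sup>2 = q (F - F0)"
        using F norm_sum_orthogonal[of z "F - F0"] z by (simp add: sum_diff q_def)
      also have "\<dots> = q F - q F0" using F by (simp add: sum_diff q_def)
      also have "\<dots> < e\<^sup>2 / 8" using F0(2)[OF F] F0(2)[OF F0(1) order_refl] unfolding dist_real_def by linarith
      also have "\<dots> \<le> (e / 2)\<^sup>2" by (simp add: power2_eq_square)
      finally show ?thesis by (rule power2_less_imp_less) (use e in simp)
    qed
    have "dist (sum z F) (sum z G) < e" if "finite F \<and> F0 \<subseteq> F" "finite G \<and> F0 \<subseteq> G" for F G
    proof -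
      have "sum z F - sum z G = (sum z F - sum z F0) - (sum z G - sum z F0)" by simp
      then have "norm (sum z F - sum z G) \<le> norm (sum z F - sum z F0) + norm (sum z G - sum z F0)"
        by (metis norm_triangle_ineq4)
      then show ?thesis using near[of F] near[of G] that by (simp add: dist_norm)
    qed
    then show "\<exists>P. eventually P (finite_subsets_at_top UNIV) \<and> (\<forall>x y. P x \<and> P y \<longrightarrow> dist (sum z x) (sum z y) < e)"
      using F0(1) by (intro exI[of _ "\<lambda>F. finite F \<and> F0 \<subseteq> F"]) (auto simp: eventually_finite_subsets_at_top)
  qed simp
  then show ?thesis by (simp add: has_sum_def)
qed

lemma P_has_sum:
  assumes z: "\<And>\<mu>. z \<mu> \<in> E \<mu>" and y: "(z has_sum y) UNIV"
  shows "P \<mu> y = z \<mu>"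
proof -
  have "((\<lambda>\<nu>. P \<mu> (z \<nu>)) has_sum P \<mu> y) UNIV" by (rule has_sum_bounded_linear[OF P_linear y])
  moreover have "((\<lambda>\<nu>. P \<mu> (z \<nu>)) has_sum z \<mu>) UNIV"
  proof -
    have "((\<lambda>\<nu>. P \<mu> (z \<nu>)) has_sum z \<mu>) {\<mu>}" using P_same[OF z] by (simp add: has_sum_finiteI)
    then show ?thesis by (rule has_sum_cong_neutral[THEN iffD1, rotated -1]) (use P_other[OF z] in auto)
  qed
  ultimately show ?thesis by (rule has_sum_unique)
qed

lemma bessel: "finite F \<Longrightarrow> (\<Sum>\<mu>\<in>F. (norm (P \<mu> x))\<^sup>2) \<le> (norm x)\<^sup>2"
proof -
  assume F: "finite F"
  define y where "y = (\<Sum>\<mu>\<in>F. P \<mu> x)"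
  have n: "(norm y)\<^sup>2 = (\<Sum>\<mu>\<in>F. (norm (P \<mu> x))\<^sup>2)" unfolding y_def by (rule norm_sum_orthogonal[OF P_in F])
  have "inner x (P \<mu> x) = (norm (P \<mu> x))\<^sup>2" for \<mu>
    using P_orth[OF P_in, where x=x and \<mu>=\<mu>] by (simp add: inner_diff_left power2_norm_eq_inner)
  then have "inner x y = (norm y)\<^sup>2" unfolding n by (simp add: y_def inner_sum_right)
  moreover have "inner x y \<le> norm x * norm y" by (rule norm_cauchy_schwarz)
  ultimately have "norm y \<le> norm x" by (cases "norm y = 0") (auto simp: power2_eq_square)
  then show ?thesis unfolding n[symmetric] by (simp add: power_mono)
qed

lemma P_summable: "(\<lambda>\<mu>. (norm (P \<mu> x))\<^sup>2) summable_on UNIV"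
  by (rule nonneg_bdd_above_summable_on) (auto intro!: bdd_aboveI[of _ "(norm x)\<^sup>2"] bessel)

lemma P_ext: "(\<And>\<mu>. P \<mu> x = P \<mu> y) \<Longrightarrow> x = y"
  using spectral_completeness[of "x - y"] by (simp add: linear_diff[OF bounded_linear.linear[OF P_linear]])

lemma P_expansion: "((\<lambda>\<mu>. P \<mu> x) has_sum x) UNIV"
proof -
  obtain y where y: "((\<lambda>\<mu>. P \<mu> x) has_sum y) UNIV" using riesz_fischer[OF P_in P_summable] by blast
  have "y = x" by (rule P_ext) (rule P_has_sum[OF P_in y])
  then show ?thesis using y by simp
qed

lemma parseval: "((\<lambda>\<mu>. (norm (P \<mu> x))\<^sup>2) has_sum (norm x)\<^sup>2) UNIV"
proof -
  have "((\<lambda>F. (norm (sum (\<lambda>\<mu>. P \<mu> x) F))\<^sup>2) \<longlongrightarrow> (norm x)\<^sup>2) (finite_subsets_at_top UNIV)"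
    using P_expansion[of x] unfolding has_sum_def by (intro tendsto_intros)
  moreover have "\<forall>\<^sub>F F in finite_subsets_at_top UNIV. (norm (sum (\<lambda>\<mu>. P \<mu> x) F))\<^sup>2 = (\<Sum>\<mu>\<in>F. (norm (P \<mu> x))\<^sup>2)"
    by (rule eventually_finite_subsets_at_top_weakI) (rule norm_sum_orthogonal[OF P_in])
  ultimately show ?thesis unfolding has_sum_def using tendsto_cong by fastforce
qed

section \<open>Location of the spectrum\<close>

text \<open>
  On such a sequence \<open>K e\<close> would have mutual distances at least \<open>1 / (1 + c)\<close>, which compactness
  excludes. The eigenvalues \<open>\<mu> n\<close> may repeat, so this limits both the number of eigenvalues below \<open>c\<close> and
  their multiplicities.
\<close>

lemma orthonormal_compact_finite:
  fixes e :: "nat \<Rightarrow> 'h"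
  assumes "\<And>n. norm (e n) = 1" "\<And>i j. i \<noteq> j \<Longrightarrow> inner (e i) (e j) = 0"
    and "\<And>n. e n \<in> E (\<mu> n)" "\<And>n. \<mu> n \<le> c"
  shows False
proof -
  have mu: "\<mu> n > 0" for n using E_pos[OF assms(3)[of n]] assms(1)[of n] by fastforce
  obtain C where C: "compact C" "\<And>y. norm y \<le> 1 \<Longrightarrow> K y \<in> C" using K_compact by blast
  then have "seq_compact C" by (simp add: compact_eq_seq_compact_metric)
  moreover have "\<forall>n. K (e n) \<in> C" using assms(1) C(2) by simp
  ultimately obtain l r where r: "strict_mono r" "((\<lambda>n. K (e n)) \<circ> r) \<longlonglongrightarrow> l"
    unfolding seq_compact_def by metis
  then have "Cauchy ((\<lambda>n. K (e n)) \<circ> r)" using LIMSEQ_imp_Cauchy by blast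
  note cauchy = this
  define d where "d = 1 / (1 + c)"
  have c: "c > 0" using mu[of 0] assms(4)[of 0] by simp
  then have "d > 0" by (simp add: d_def)
  with cauchy obtain N where N: "\<And>m n. m \<ge> N \<Longrightarrow> n \<ge> N \<Longrightarrow> dist (K (e (r m))) (K (e (r n))) < d"
    unfolding Cauchy_def comp_def by blast
  define i j where "i = r N" "j = r (Suc N)"
  have ij: "i \<noteq> j" using r(1) by (simp add: i_j_def strict_mono_eq)
  have "(norm (K (e i) - K (e j)))\<^sup>2 = (1 / (1 + \<mu> i))\<^sup>2 + (1 / (1 + \<mu> j))\<^sup>2"
  proof -
    have "inner (e k) (e k) = 1" for k using assms(1) norm_eq_1 by blast
    then show ?thesis unfolding K_eigen[OF assms(3)] power2_norm_eq_inner
      by (simp add: inner_diff_left inner_diff_right assms(2)[OF ij] assms(2)[OF ij[symmetric]] power2_eq_square)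
  qed
  moreover have "d\<^sup>2 \<le> (1 / (1 + \<mu> i))\<^sup>2"
    unfolding d_def using assms(4)[of i] mu[of i] by (intro power_mono divide_left_mono) auto
  moreover have "0 \<le> (1 / (1 + \<mu> j))\<^sup>2" by simp
  ultimately have "d\<^sup>2 \<le> (norm (K (e i) - K (e j)))\<^sup>2" by linarith
  then have "d \<le> norm (K (e i) - K (e j))" by (rule power2_le_imp_le) simp
  then show False using N[of N "Suc N"] by (simp add: dist_norm i_j_def)
qed

lemma unit_vector: "E \<mu> \<noteq> {0} \<Longrightarrow> \<exists>e\<in>E \<mu>. norm e = 1"
proof -
  assume "E \<mu> \<noteq> {0}"
  then obtain x where x: "x \<in> E \<mu>" "x \<noteq> 0" using E_closed_ops(1)[of \<mu>] by blast
  then show ?thesis using E_closed_ops(4)[OF x(1), of "1 / norm x"] by (intro bexI[of _ "(1 / norm x) *\<^sub>R x"]) auto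
qed

lemma finite_spectrum_below: "finite {\<mu>. E \<mu> \<noteq> {0} \<and> \<mu> \<le> c}"
proof (rule ccontr)
  assume "infinite {\<mu>. E \<mu> \<noteq> {0} \<and> \<mu> \<le> c}"
  from infinite_countable_subset[OF this]
  obtain g :: "nat \<Rightarrow> real" where g: "inj g" "range g \<subseteq> {\<mu>. E \<mu> \<noteq> {0} \<and> \<mu> \<le> c}"
    by (elim exE conjE)
  have gn: "E (g n) \<noteq> {0}" "g n \<le> c" for n using subsetD[OF g(2) rangeI, of n] by simp_all
  define e where "e = (\<lambda>n. SOME v. v \<in> E (g n) \<and> norm v = 1)"
  have e: "e n \<in> E (g n)" "norm (e n) = 1" for n
    using someI_ex[of "\<lambda>v. v \<in> E (g n) \<and> norm v = 1"] unit_vector[OF gn(1)] unfolding e_def by blast+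
  show False
  proof (rule orthonormal_compact_finite[of e g c])
    show "inner (e i) (e j) = 0" if "i \<noteq> j" for i j
      using E_orthogonal[OF e(1) e(1)] g(1) that by (simp add: inj_eq)
  qed (rule e gn)+
qed

lemma spectrum_gap: "\<exists>\<mu>1>0. \<forall>\<mu>. E \<mu> \<noteq> {0} \<longrightarrow> \<mu>1 \<le> \<mu>"
proof -
  define S where "S = insert 1 {\<mu>. E \<mu> \<noteq> {0} \<and> \<mu> \<le> 1}"
  have S: "finite S" "S \<noteq> {}" using finite_spectrum_below[of 1] by (auto simp: S_def)
  have "\<mu> > 0" if m: "\<mu> \<in> S" for \<mu>
  proof (cases "\<mu> = 1")
    case False
    then obtain e where "e \<in> E \<mu>" "norm e = 1" using m unit_vector by (auto simp: S_def)
    then show ?thesis using E_pos by fastforce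
  qed simp
  then have "Min S > 0" using S by simp
  moreover have "Min S \<le> \<mu>" if "E \<mu> \<noteq> {0}" for \<mu>
  proof (cases "\<mu> \<le> 1")
    case True
    then show ?thesis using S that by (intro Min_le) (auto simp: S_def)
  next
    case False
    then have "Min S \<le> 1" using S by (intro Min_le) (auto simp: S_def)
    then show ?thesis using False by simp
  qed
  ultimately show ?thesis by blast
qed

text \<open>
  If the spectrum is bounded, it is finite. If moreover no unit eigenvector is orthogonal to \<open>B\<close>, then
  every eigenspace lies in the span of \<open>B\<close>, and by the expansion so does the whole space.
\<close>

lemma finite_eigenbasis_step:
  assumes bounded: "\<And>\<mu>. E \<mu> \<noteq> {0} \<Longrightarrow> \<mu> \<le> c"
    and infinite_dimensional: "\<not> (\<exists>B::'h set. finite B \<and> complex_vector.span B = UNIV)"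
    and B: "finite B" "\<And>b. b \<in> B \<Longrightarrow> norm b = 1" "\<And>b. b \<in> B \<Longrightarrow> \<exists>\<mu>. b \<in> E \<mu>"
      "\<And>b b'. b \<in> B \<Longrightarrow> b' \<in> B \<Longrightarrow> b \<noteq> b' \<Longrightarrow> cinner b b' = 0"
  shows "\<exists>e \<mu>. e \<in> E \<mu> \<and> norm e = 1 \<and> (\<forall>b\<in>B. cinner b e = 0)"
proof (rule ccontr)
  assume no: "\<nexists>e \<mu>. e \<in> E \<mu> \<and> norm e = 1 \<and> (\<forall>b\<in>B. cinner b e = 0)"
  have *: "x \<in> complex_vector.span B" if x: "x \<in> E \<mu>" for x \<mu>
  proof -
    define y where "y = (\<Sum>b\<in>B \<inter> E \<mu>. cinner x b *\<^sub>C b)"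
    have yE: "y \<in> E \<mu>" unfolding y_def
      by (rule subspace_sum[OF E_subspace]) (auto intro: E_closed_ops)
    have orth: "cinner (x - y) b = 0" if b: "b \<in> B" for b
    proof (cases "b \<in> E \<mu>")
      case True
      have cs: "cinner (sum g S) z = (\<Sum>i\<in>S. cinner (g i) z)" if "finite S" for g :: "'h \<Rightarrow> 'h" and S z
        using that cinner_scaleR_left[of 0 0 z] by (induction S) (auto simp: cinner_add_left)
      have "cinner y b = (\<Sum>b'\<in>B \<inter> E \<mu>. cinner x b' * cinner b' b)"
        unfolding y_def using B(1) by (subst cs) (auto simp: cinner_scaleC_left)
      also have "\<dots> = (\<Sum>b'\<in>B \<inter> E \<mu>. if b' = b then cinner x b else 0)"
        using B(2)[OF b] B(4) b by (intro sum.cong) (auto simp: cinner_self)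
      also have "\<dots> = cinner x b" using B(1) b True by simp
      finally show ?thesis using cinner_add_left[of "x - y" y b] by simp
    next
      case False
      then obtain \<nu> where nu: "b \<in> E \<nu>" "\<mu> \<noteq> \<nu>" using B(3)[OF b] by auto
      have xy: "x - y \<in> E \<mu>" by (rule E_closed_ops(5)[OF x yE])
      show ?thesis
        using E_orthogonal[OF xy nu] E_orthogonal[OF xy E_closed_ops(3)[OF nu(1)] nu(2), of \<i>]
        by (intro complex_eqI) (auto simp: Im_cinner inner_eq_Re_cinner[symmetric])
    qed
    have "x - y = 0"
    proof (rule ccontr)
      assume n: "x - y \<noteq> 0"
      define e where "e = (1 / norm (x - y)) *\<^sub>R (x - y)"
      have "e \<in> E \<mu>" unfolding e_def using x yE E_closed_ops by blast
      moreover have "norm e = 1" using n by (simp add: e_def)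
      moreover have "cinner b e = 0" if "b \<in> B" for b
        using orth[OF that] cinner_commute[of b e] by (simp add: e_def cinner_scaleR_left)
      ultimately show False using no by blast
    qed
    then have "x = y" by simp
    also have "y \<in> complex_vector.span B" unfolding y_def
      by (intro complex_vector.span_sum complex_vector.span_scale complex_vector.span_base) auto
    finally show ?thesis .
  qed
  have "x \<in> complex_vector.span B" for x
  proof -
    define F where "F = {\<mu>. E \<mu> \<noteq> {0} \<and> \<mu> \<le> c}"
    have F: "finite F" unfolding F_def by (rule finite_spectrum_below)
    have z: "P \<mu> x = 0" if "\<mu> \<notin> F" for \<mu> using that bounded P_in[of \<mu> x] by (auto simp: F_def)
    have "((\<lambda>\<mu>. P \<mu> x) has_sum x) F"
      by (rule has_sum_cong_neutral[THEN iffD1, OF _ _ _ P_expansion]) (use z in auto)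
    then have "x = (\<Sum>\<mu>\<in>F. P \<mu> x)" using has_sum_unique[OF _ has_sum_finite[OF F]] by blast
    also have "\<dots> \<in> complex_vector.span B" by (rule complex_vector.span_sum, rule *, rule P_in)
    finally show ?thesis .
  qed
  then show False using infinite_dimensional B(1) by blast
qed

text \<open>
  Otherwise the preceding step, iterated, yields an infinite orthonormal sequence of eigenvectors with
  bounded eigenvalues.
\<close>

lemma spectrum_unbounded:
  assumes "\<not> (\<exists>B::'h set. finite B \<and> complex_vector.span B = UNIV)"
  shows "\<exists>\<mu>>c. E \<mu> \<noteq> {0}"
proof (rule ccontr)
  assume "\<not> (\<exists>\<mu>>c. E \<mu> \<noteq> {0})"
  then have bd: "\<And>\<mu>. E \<mu> \<noteq> {0} \<Longrightarrow> \<mu> \<le> c" by force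
  define admissible where "admissible = (\<lambda>(g :: nat \<Rightarrow> 'h) n e. (\<exists>\<mu>. e \<in> E \<mu>) \<and> norm e = 1 \<and> (\<forall>i<n. cinner (g i) e = 0))"
  have "\<exists>g. \<forall>n. admissible g n (g n)"
  proof (rule dependent_wellorder_choice)
    fix n :: nat and g assume IH: "\<And>i. i < n \<Longrightarrow> admissible g i (g i)"
    have sym: "cinner b b' = 0" if bb: "b \<in> g ` {..<n}" "b' \<in> g ` {..<n}" "b \<noteq> b'" for b b'
    proof -
      obtain i j where ij: "i < n" "j < n" "b = g i" "b' = g j" using bb by auto
      then have "i < j \<or> j < i" using bb(3) by (metis linorder_neqE_nat)
      then show ?thesis using IH[OF ij(1)] IH[OF ij(2)] ij cinner_commute[of b b'] by (auto simp: admissible_def)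
    qed
    obtain e \<mu> where "e \<in> E \<mu>" "norm e = 1" "\<forall>b\<in>g ` {..<n}. cinner b e = 0"
      using finite_eigenbasis_step[OF bd assms, of "g ` {..<n}"] IH sym by (auto simp: admissible_def)
    then show "\<exists>r. admissible g n r" by (auto simp: admissible_def)
  qed (auto simp: admissible_def)
  then obtain g where g: "\<And>n. admissible g n (g n)" by blast
  then obtain \<mu> where mu: "\<And>n. g n \<in> E (\<mu> n)" by (auto simp: admissible_def) metis
  show False
  proof (rule orthonormal_compact_finite[OF _ _ mu])
    show n1: "norm (g n) = 1" for n using g by (simp add: admissible_def)
    show "inner (g i) (g j) = 0" if "i \<noteq> j" for i j
      using g[of i] g[of j] that cinner_commute[of "g i" "g j"] by (cases i j rule: linorder_cases) (auto simp: admissible_def inner_eq_Re_cinner)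
    show "\<mu> n \<le> c" for n
      using bd[of "\<mu> n"] mu[of n] n1[of n] by fastforce
  qed
qed

section \<open>Functions of the operator\<close>

definition mu_min :: real where "mu_min = (SOME \<mu>1. \<mu>1 > 0 \<and> (\<forall>\<mu>. E \<mu> \<noteq> {0} \<longrightarrow> \<mu>1 \<le> \<mu>))"

lemma mu_min: "mu_min > 0" "E \<mu> \<noteq> {0} \<Longrightarrow> mu_min \<le> \<mu>"
  using someI_ex[OF spectrum_gap] unfolding mu_min_def by blast+

text \<open>
  Block estimates are proved for \<open>\<mu> \<ge> mu_min\<close> only; this lemma disposes of all other values of \<open>\<mu>\<close>.
\<close>

lemma off_spectrum: "\<not> mu_min \<le> \<mu> \<Longrightarrow> e \<in> E \<mu> \<Longrightarrow> e = 0"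
  using mu_min(2)[of \<mu>] by auto

lemma P_add: "P \<mu> (x + y) = P \<mu> x + P \<mu> y" and P_diff: "P \<mu> (x - y) = P \<mu> x - P \<mu> y"
  and P_scale: "P \<mu> (c *\<^sub>R x) = c *\<^sub>R P \<mu> x" and P_minus: "P \<mu> (- x) = - P \<mu> x"
proof -
  interpret bounded_linear "P \<mu>" by (rule P_linear)
  show "P \<mu> (x + y) = P \<mu> x + P \<mu> y" "P \<mu> (x - y) = P \<mu> x - P \<mu> y" "P \<mu> (c *\<^sub>R x) = c *\<^sub>R P \<mu> x" "P \<mu> (- x) = - P \<mu> x"
    by (rule add diff scale neg)+
qed

lemma expansion_ex:
  assumes "\<And>\<mu>. z \<mu> \<in> E \<mu>" "(\<lambda>\<mu>. (norm (z \<mu>))\<^sup>2) summable_on UNIV"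
  shows "\<exists>y. \<forall>\<mu>. P \<mu> y = z \<mu>"
  using riesz_fischer[OF assms] P_has_sum[of z, OF assms(1)] by blast

lemma summable_mono:
  fixes a b :: "real \<Rightarrow> real"
  assumes "b summable_on UNIV" "\<And>\<mu>. 0 \<le> a \<mu>" "\<And>\<mu>. a \<mu> \<le> c * b \<mu>"
  shows "a summable_on UNIV"
proof (rule summable_on_comparison_test)
  show "(\<lambda>\<mu>. c * b \<mu>) summable_on UNIV" using assms(1) by (rule summable_on_cmult_right)
qed (use assms in auto)

lemma norm_sq_le:
  fixes x :: "'a::real_normed_vector" and y :: "'b::real_normed_vector"
  shows "c \<ge> 0 \<Longrightarrow> norm x \<le> c * norm y \<Longrightarrow> (norm x)\<^sup>2 \<le> c\<^sup>2 * (norm y)\<^sup>2"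
  unfolding power_mult_distrib[symmetric] by (rule power_mono) auto

lemma norm_le_blockwise:
  assumes "c \<ge> 0" "\<And>\<mu>. norm (P \<mu> x) \<le> c * norm (P \<mu> y)"
  shows "norm x \<le> c * norm y"
proof -
  have "(norm x)\<^sup>2 \<le> c\<^sup>2 * (norm y)\<^sup>2"
    by (rule has_sum_mono[OF parseval has_sum_cmult_right[OF parseval]]) (rule norm_sq_le[OF assms])
  then have "(norm x)\<^sup>2 \<le> (c * norm y)\<^sup>2" by (simp only: power_mult_distrib)
  then show ?thesis by (rule power2_le_imp_le) (use assms(1) in simp)
qed

text \<open>
  The operator \<open>\<phi>(A)\<close> of the functional calculus and its domain.
\<close>

definition fun_calc :: "(real \<Rightarrow> real) \<Rightarrow> 'h \<Rightarrow> 'h" where "fun_calc \<phi> x = (\<Sum>\<^sub>\<infinity>\<mu>. \<phi> \<mu> *\<^sub>R P \<mu> x)"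
definition fun_dom :: "(real \<Rightarrow> real) \<Rightarrow> 'h set" where
  "fun_dom \<phi> = {x. (\<lambda>\<mu>. (norm (\<phi> \<mu> *\<^sub>R P \<mu> x))\<^sup>2) summable_on UNIV}"

lemma P_fun_calc: "x \<in> fun_dom \<phi> \<Longrightarrow> P \<mu> (fun_calc \<phi> x) = \<phi> \<mu> *\<^sub>R P \<mu> x"
proof -
  assume "x \<in> fun_dom \<phi>"
  then have "\<exists>y. ((\<lambda>\<mu>. \<phi> \<mu> *\<^sub>R P \<mu> x) has_sum y) UNIV"
    using riesz_fischer[of "\<lambda>\<mu>. \<phi> \<mu> *\<^sub>R P \<mu> x"] E_closed_ops(4)[OF P_in] by (simp add: fun_dom_def)
  then show ?thesis unfolding fun_calc_def using P_has_sum[of "\<lambda>\<mu>. \<phi> \<mu> *\<^sub>R P \<mu> x"] E_closed_ops(4)[OF P_in]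
    by (metis (no_types, lifting) infsumI)
qed

lemma fun_dom_bounded:
  assumes "\<And>\<mu>. mu_min \<le> \<mu> \<Longrightarrow> \<bar>\<phi> \<mu>\<bar> \<le> B"
  shows "x \<in> fun_dom \<phi>"
proof -
  have "(norm (\<phi> \<mu> *\<^sub>R P \<mu> x))\<^sup>2 \<le> B\<^sup>2 * (norm (P \<mu> x))\<^sup>2" for \<mu>
  proof (cases "mu_min \<le> \<mu>")
    case True
    have "0 \<le> B" using assms[of mu_min] by simp
    then show ?thesis using assms[OF True] by (intro norm_sq_le) (auto intro: mult_right_mono)
  next
    case False
    then show ?thesis using off_spectrum[OF _ P_in] by simp
  qed
  then show ?thesis unfolding fun_dom_def mem_Collect_eq by (rule summable_mono[OF P_summable[of x] zero_le_power2])
qed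

lemma bounded_linear_fun_calc:
  assumes B: "\<And>\<mu>. mu_min \<le> \<mu> \<Longrightarrow> \<bar>\<phi> \<mu>\<bar> \<le> B"
  shows "bounded_linear (fun_calc \<phi>)"
proof (rule bounded_linear_intro)
  have d: "x \<in> fun_dom \<phi>" for x by (rule fun_dom_bounded[OF B])
  note p = P_fun_calc[OF d]
  show "fun_calc \<phi> (x + y) = fun_calc \<phi> x + fun_calc \<phi> y" for x y by (rule P_ext) (simp add: p P_add scaleR_add_right)
  show "fun_calc \<phi> (r *\<^sub>R x) = r *\<^sub>R fun_calc \<phi> x" for r x by (rule P_ext) (simp add: p P_scale mult.commute)
  have B0: "0 \<le> B" using B[of mu_min] by simp
  show "norm (fun_calc \<phi> x) \<le> norm x * B" for x
  proof (subst mult.commute, rule norm_le_blockwise[OF B0])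
    show "norm (P \<mu> (fun_calc \<phi> x)) \<le> B * norm (P \<mu> x)" for \<mu>
      using B[of \<mu>] off_spectrum[OF _ P_in, of \<mu> x] unfolding p by (cases "mu_min \<le> \<mu>") (auto intro: mult_right_mono)
  qed
qed

section \<open>Blocks of four vectors\<close>

text \<open>
  Off the spectrum these blocks vanish, so sums over the spectrum may be written as sums over all real \<open>\<mu>\<close>.
\<close>

definition block :: "real \<Rightarrow> 'h state \<Rightarrow> 'h state" where "block \<mu> = (\<lambda>(a, b, c, d). (P \<mu> a, P \<mu> b, P \<mu> c, P \<mu> d))"
definition block_space :: "real \<Rightarrow> 'h state set" where "block_space \<mu> = E \<mu> \<times> E \<mu> \<times> E \<mu> \<times> E \<mu>"

lemma block_in: "block \<mu> x \<in> block_space \<mu>" by (cases x) (simp add: block_def block_space_def P_in)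

lemma block_linear: "bounded_linear (block \<mu>)"
  unfolding block_def case_prod_unfold
  by (intro bounded_linear_Pair bounded_linear_compose[OF P_linear] bounded_linear_fst bounded_linear_compose[OF bounded_linear_fst] bounded_linear_compose[OF bounded_linear_snd] bounded_linear_snd)

lemma block_ext: "(\<And>\<mu>. block \<mu> x = block \<mu> y) \<Longrightarrow> x = y"
  by (cases x; cases y; simp add: block_def) (metis P_ext)

lemma block_same: "y \<in> block_space \<mu> \<Longrightarrow> block \<mu> y = y" by (cases y) (auto simp: block_def block_space_def P_same)

lemma block_off_spectrum: "\<not> mu_min \<le> \<mu> \<Longrightarrow> block \<mu> x = 0"
  using off_spectrum[OF _ P_in] by (cases x) (simp add: block_def zero_prod_def)

lemma block_parseval: "((\<lambda>\<mu>. (norm (block \<mu> x))\<^sup>2) has_sum (norm x)\<^sup>2) UNIV"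
proof -
  obtain a b c d where x: "x = (a, b, c, d)" by (cases x)
  show ?thesis unfolding x block_def split_conv norm_quad by (intro has_sum_add parseval)
qed

lemma block_norm: "norm (block \<mu> x) \<le> norm x"
proof -
  have "(norm (block \<mu> x))\<^sup>2 \<le> (norm x)\<^sup>2"
    using finite_sum_le_has_sum[OF block_parseval[of x], of "{\<mu>}"] by simp
  then show ?thesis by (rule power2_le_imp_le) simp
qed

lemma block_norm_le_blockwise:
  assumes "c \<ge> 0" "\<And>\<mu>. norm (block \<mu> x) \<le> c * norm (block \<mu> y)"
  shows "norm x \<le> c * norm y"
proof -
  have "(norm x)\<^sup>2 \<le> c\<^sup>2 * (norm y)\<^sup>2"
    by (rule has_sum_mono[OF block_parseval has_sum_cmult_right[OF block_parseval]]) (rule norm_sq_le[OF assms])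
  then have "(norm x)\<^sup>2 \<le> (c * norm y)\<^sup>2" by (simp only: power_mult_distrib)
  then show ?thesis by (rule power2_le_imp_le) (use assms(1) in simp)
qed

lemma block_expansion_ex:
  assumes z: "\<And>\<mu>. z \<mu> \<in> block_space \<mu>" and s: "(\<lambda>\<mu>. (norm (z \<mu>))\<^sup>2) summable_on UNIV"
  shows "\<exists>y. \<forall>\<mu>. block \<mu> y = z \<mu>"
proof -
  have dec: "z \<mu> = (fst (z \<mu>), fst (snd (z \<mu>)), fst (snd (snd (z \<mu>))), snd (snd (snd (z \<mu>))))" for \<mu> by simp
  have c: "(norm (fst (z \<mu>)))\<^sup>2 \<le> 1 * (norm (z \<mu>))\<^sup>2" "(norm (fst (snd (z \<mu>))))\<^sup>2 \<le> 1 * (norm (z \<mu>))\<^sup>2"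
    "(norm (fst (snd (snd (z \<mu>)))))\<^sup>2 \<le> 1 * (norm (z \<mu>))\<^sup>2" "(norm (snd (snd (snd (z \<mu>)))))\<^sup>2 \<le> 1 * (norm (z \<mu>))\<^sup>2" for \<mu>
    by (subst (2) dec, simp only: norm_quad, simp)+
  have i: "fst (z \<mu>) \<in> E \<mu>" "fst (snd (z \<mu>)) \<in> E \<mu>" "fst (snd (snd (z \<mu>))) \<in> E \<mu>" "snd (snd (snd (z \<mu>))) \<in> E \<mu>" for \<mu>
    using z[of \<mu>] by (cases "z \<mu>"; auto simp: block_space_def)+
  obtain a where a: "\<And>\<mu>. P \<mu> a = fst (z \<mu>)" using expansion_ex[OF i(1) summable_mono[OF s _ c(1)]] by auto
  obtain b where b: "\<And>\<mu>. P \<mu> b = fst (snd (z \<mu>))" using expansion_ex[OF i(2) summable_mono[OF s _ c(2)]] by auto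
  obtain c' where c': "\<And>\<mu>. P \<mu> c' = fst (snd (snd (z \<mu>)))" using expansion_ex[OF i(3) summable_mono[OF s _ c(3)]] by auto
  obtain d where d: "\<And>\<mu>. P \<mu> d = snd (snd (snd (z \<mu>)))" using expansion_ex[OF i(4) summable_mono[OF s _ c(4)]] by auto
  have "\<forall>\<mu>. block \<mu> (a, b, c', d) = z \<mu>" by (simp add: block_def a b c' d)
  then show ?thesis by blast
qed

text \<open>
  Eigenprojections act on the entries of a quadruple and a chain mixes the entries, so they commute.
\<close>

lemma block_chain: "block \<mu> (chain a b c d x) = chain a b c d (block \<mu> x)"
  by (cases x) (simp add: block_def chain_def P_scale P_diff P_minus)

lemma block_space_chain: "y \<in> block_space \<mu> \<Longrightarrow> chain a b c d y \<in> block_space \<mu>"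
  using block_chain[of \<mu> a b c d y] block_same[of y \<mu>] block_in[of \<mu> "chain a b c d y"] by simp

end

section \<open>The coefficients of the blocks\<close>

locale thermo = positive_operator A for A :: "'h::chilbert_space operator" +
  fixes m \<sigma> \<tau> \<alpha> \<beta> \<gamma> :: real
  assumes mst: "m > 0" "\<sigma> > 0" "\<tau> > 0" and region: "(\<alpha>, \<beta>, \<gamma>) \<in> param_region"
begin

lemma par: "0 \<le> \<alpha>" "\<alpha> \<le> 1" "0 \<le> \<beta>" "\<beta> \<le> 1" "0 < \<gamma>" "\<gamma> \<le> 1" "(\<beta> + 1) / 2 < \<alpha>"
  using region by (auto simp: param_region_def)

text \<open>
  \<open>mass\<close> is the value of \<open>1 + m A^\<gamma>\<close> on an eigenspace; \<open>om\<close>, \<open>ka\<close>, \<open>nu\<close>, \<open>de\<close> are the coefficients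
  \<open>\<omega>\<close>, \<open>\<kappa>\<close>, \<open>\<nu>\<close>, \<open>\<delta>\<close> of the chain that the system becomes there.
\<close>

definition "mass \<mu> = 1 + m * \<mu> powr \<gamma>"
definition "om \<mu> = sqrt (\<sigma> * \<mu>) / sqrt (mass \<mu>)"
definition "ka \<mu> = \<mu> powr \<alpha> / sqrt (mass \<mu>)"
definition "nu \<mu> = \<mu> powr (\<beta> / 2) / sqrt \<tau>"
definition "de = 1 / \<tau>"

abbreviation chain_at :: "real \<Rightarrow> 'h state \<Rightarrow> 'h state" where "chain_at \<mu> \<equiv> chain (om \<mu>) (ka \<mu>) (nu \<mu>) de"

lemma mass_pos: "mass \<mu> > 0" "mass \<mu> \<ge> 1"
  using mst by (simp_all add: mass_def add_pos_nonneg)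

definition "mass_const = mu_min powr (- \<gamma>) + m"

lemma mass_bounds: assumes "mu_min \<le> \<mu>" shows "m * \<mu> powr \<gamma> \<le> mass \<mu>" "mass \<mu> \<le> mass_const * \<mu> powr \<gamma>" "mass_const > 0"
proof -
  show "mass_const > 0" using mst by (simp add: mass_const_def add_nonneg_pos)
  show "m * \<mu> powr \<gamma> \<le> mass \<mu>" by (simp add: mass_def)
  have "1 = mu_min powr (- \<gamma>) * mu_min powr \<gamma>" using mu_min(1) by (simp add: powr_minus field_simps)
  also have "\<dots> \<le> mu_min powr (- \<gamma>) * \<mu> powr \<gamma>" using assms mu_min(1) par by (intro mult_left_mono powr_mono2) auto
  finally show "mass \<mu> \<le> mass_const * \<mu> powr \<gamma>" by (simp add: mass_def mass_const_def algebra_simps)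
qed

lemma sqrt_powr: "\<mu> > 0 \<Longrightarrow> sqrt (\<mu> powr a) = \<mu> powr (a / 2)" for \<mu> :: real
  by (simp add: powr_half_sqrt[symmetric] powr_powr)

lemma sqrt_mass_bounds: assumes "mu_min \<le> \<mu>"
  shows "sqrt m * \<mu> powr (\<gamma> / 2) \<le> sqrt (mass \<mu>)" "sqrt (mass \<mu>) \<le> sqrt mass_const * \<mu> powr (\<gamma> / 2)"
proof -
  have mu: "\<mu> > 0" using assms mu_min(1) by simp
  show "sqrt m * \<mu> powr (\<gamma> / 2) \<le> sqrt (mass \<mu>)" "sqrt (mass \<mu>) \<le> sqrt mass_const * \<mu> powr (\<gamma> / 2)"
    using mass_bounds[OF assms] by (auto simp: sqrt_powr[OF mu, symmetric] real_sqrt_mult[symmetric])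
qed

lemma coeff_bounds: assumes "mu_min \<le> \<mu>"
  shows "ka \<mu> \<le> 1 / sqrt m * \<mu> powr (\<alpha> - \<gamma> / 2)" "1 / sqrt mass_const * \<mu> powr (\<alpha> - \<gamma> / 2) \<le> ka \<mu>"
    "om \<mu> \<le> sqrt (\<sigma> / m) * \<mu> powr (1 / 2 - \<gamma> / 2)" "sqrt (\<sigma> / mass_const) * \<mu> powr (1 / 2 - \<gamma> / 2) \<le> om \<mu>"
    "om \<mu> / ka \<mu> = sqrt \<sigma> * \<mu> powr (1 / 2 - \<alpha>)" "om \<mu> > 0" "ka \<mu> > 0" "nu \<mu> > 0" "de > 0"
proof -
  have mu: "\<mu> > 0" using assms mu_min(1) by simp
  note sb = sqrt_mass_bounds[OF assms] mass_bounds(3)[OF assms] mass_pos[of \<mu>]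
  have sm: "sqrt (\<sigma> * \<mu>) = sqrt \<sigma> * \<mu> powr (1/2)" using mu by (simp add: real_sqrt_mult powr_half_sqrt)
  have pd: "\<mu> powr (a - \<gamma> / 2) = \<mu> powr a / \<mu> powr (\<gamma> / 2)" for a by (rule powr_diff)
  have p: "sqrt (mass \<mu>) > 0" "\<mu> powr (\<gamma> / 2) > 0" "sqrt m > 0" "sqrt mass_const > 0" using sb mu mst by auto
  have up: "x / sqrt (mass \<mu>) \<le> x / (sqrt m * \<mu> powr (\<gamma> / 2))" and lo: "x / (sqrt mass_const * \<mu> powr (\<gamma> / 2)) \<le> x / sqrt (mass \<mu>)" if "x \<ge> 0" for x
    using that sb p by (auto intro!: divide_left_mono)
  show "ka \<mu> \<le> 1 / sqrt m * \<mu> powr (\<alpha> - \<gamma> / 2)" "1 / sqrt mass_const * \<mu> powr (\<alpha> - \<gamma> / 2) \<le> ka \<mu>"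
    using up[of "\<mu> powr \<alpha>"] lo[of "\<mu> powr \<alpha>"] by (auto simp: ka_def pd mult.commute)
  show "om \<mu> \<le> sqrt (\<sigma> / m) * \<mu> powr (1 / 2 - \<gamma> / 2)" "sqrt (\<sigma> / mass_const) * \<mu> powr (1 / 2 - \<gamma> / 2) \<le> om \<mu>"
    using up[of "sqrt \<sigma> * \<mu> powr (1/2)"] lo[of "sqrt \<sigma> * \<mu> powr (1/2)"] mst mu by (auto simp: om_def pd sm real_sqrt_divide)
  show "om \<mu> / ka \<mu> = sqrt \<sigma> * \<mu> powr (1 / 2 - \<alpha>)" using p by (simp add: om_def ka_def sm powr_diff)
  show "om \<mu> > 0" "ka \<mu> > 0" "nu \<mu> > 0" "de > 0" using mu mst p by (auto simp: om_def ka_def nu_def de_def)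
qed

lemma powr_le_base: "mu_min \<le> \<mu> \<Longrightarrow> a \<le> 0 \<Longrightarrow> \<mu> powr a \<le> mu_min powr a"
  using mu_min(1) by (intro powr_mono2') auto

lemma powr_ge_base: "mu_min \<le> \<mu> \<Longrightarrow> 0 \<le> a \<Longrightarrow> mu_min powr a \<le> \<mu> powr a"
  using mu_min(1) by (intro powr_mono2) auto

lemma nu_ka: assumes "mu_min \<le> \<mu>"
  shows "nu \<mu> / ka \<mu> \<le> sqrt mass_const / sqrt \<tau> * \<mu> powr (\<beta> / 2 + \<gamma> / 2 - \<alpha>)" "sqrt m / sqrt \<tau> * \<mu> powr (\<beta> / 2 + \<gamma> / 2 - \<alpha>) \<le> nu \<mu> / ka \<mu>"
proof -
  have mu: "\<mu> > 0" using assms mu_min(1) by simp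
  have eq: "nu \<mu> / ka \<mu> = \<mu> powr (\<beta> / 2 - \<alpha>) / sqrt \<tau> * sqrt (mass \<mu>)"
    by (simp add: nu_def ka_def powr_diff)
  have e2: "\<mu> powr (\<beta> / 2 + \<gamma> / 2 - \<alpha>) = \<mu> powr (\<beta> / 2 - \<alpha>) * \<mu> powr (\<gamma> / 2)"
    by (simp add: powr_add[symmetric] algebra_simps)
  have "0 \<le> \<mu> powr (\<beta> / 2 - \<alpha>) / sqrt \<tau>" using mst by simp
  from mult_left_mono[OF sqrt_mass_bounds(1)[OF assms] this] mult_left_mono[OF sqrt_mass_bounds(2)[OF assms] this]
  show "nu \<mu> / ka \<mu> \<le> sqrt mass_const / sqrt \<tau> * \<mu> powr (\<beta> / 2 + \<gamma> / 2 - \<alpha>)" "sqrt m / sqrt \<tau> * \<mu> powr (\<beta> / 2 + \<gamma> / 2 - \<alpha>) \<le> nu \<mu> / ka \<mu>"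
    unfolding eq e2 by (simp_all add: mult_ac)
qed

text \<open>
  The exponents of \<open>\<omega>/\<kappa>\<close>, \<open>\<nu>/\<kappa>\<close> and \<open>\<omega> \<nu>/\<kappa>\<close> as powers of \<open>\<mu>\<close> are \<open>1/2 - \<alpha>\<close>, \<open>(\<beta> + \<gamma>)/2 - \<alpha>\<close> and
  \<open>(1 + \<beta>)/2 - \<alpha>\<close>. All are at most zero in the parameter region, so the quotients are largest, up to
  constants, at the bottom of the spectrum.
\<close>

lemma damped_chain_blocks: "\<exists>K. \<forall>\<mu>\<ge>mu_min. damped_chain (om \<mu>) (ka \<mu>) (nu \<mu>) de K"
proof -
  define k1 where "k1 = sqrt \<sigma> * mu_min powr (1 / 2 - \<alpha>)"
  define k2 where "k2 = sqrt mass_const / sqrt \<tau> * mu_min powr (\<beta> / 2 + \<gamma> / 2 - \<alpha>)"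
  define k3 where "k3 = sqrt \<sigma> / sqrt \<tau> * mu_min powr (1 / 2 - \<alpha> + \<beta> / 2)"
  define k4 where "k4 = sqrt mass_const / mu_min powr (\<alpha> - \<gamma> / 2)"
  define k5 where "k5 = 1 / (sqrt (\<sigma> / mass_const) * mu_min powr (1 / 2 - \<gamma> / 2))"
  define K' where "K' = 1 + k1 + k2 + k3 + k4 + k5 + de + \<tau>"
  have cp: "mass_const > 0" using mass_bounds(3) by blast
  have nn: "k1 \<ge> 0" "k2 \<ge> 0" "k3 \<ge> 0" "k4 \<ge> 0" "k5 \<ge> 0" "de > 0"
    using mst cp by (auto simp: k1_def k2_def k3_def k4_def k5_def de_def)
  have "damped_chain (om \<mu>) (ka \<mu>) (nu \<mu>) de K'" if mu: "mu_min \<le> \<mu>" for \<mu>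
  proof
    have mu0: "\<mu> > 0" using mu mu_min(1) by simp
    note cb = coeff_bounds[OF mu]
    show "0 < om \<mu>" "0 < ka \<mu>" "0 < nu \<mu>" "0 < de" using cb by auto
    show "1 \<le> K'" "de \<le> K'" using nn mst by (auto simp: K'_def)
    have "\<tau> \<le> K'" using nn mst by (simp add: K'_def)
    then show "1 \<le> K' * de" using mst by (simp add: de_def)
    have "om \<mu> / ka \<mu> \<le> k1" unfolding cb(5) k1_def using mu par mst by (intro mult_left_mono powr_le_base) auto
    also have "k1 \<le> K'" using nn mst by (simp add: K'_def)
    finally show "om \<mu> \<le> K' * ka \<mu>" unfolding pos_divide_le_eq[OF cb(7)] .
    have "nu \<mu> / ka \<mu> \<le> k2"
      unfolding k2_def by (rule order.trans[OF nu_ka(1)[OF mu]], intro mult_left_mono powr_le_base[OF mu]) (use par cp mst in auto)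
    also have "k2 \<le> K'" using nn mst by (simp add: K'_def)
    finally show "nu \<mu> \<le> K' * ka \<mu>" using cb by (simp add: pos_divide_le_eq)
    have "om \<mu> / ka \<mu> * nu \<mu> = sqrt \<sigma> / sqrt \<tau> * \<mu> powr (1 / 2 - \<alpha> + \<beta> / 2)"
      unfolding cb(5) nu_def by (simp add: powr_add)
    also have "\<dots> \<le> k3" using par mu mst unfolding k3_def by (intro mult_left_mono powr_le_base) auto
    also have "k3 \<le> K'" using nn mst by (simp add: K'_def)
    finally show "om \<mu> * nu \<mu> \<le> K' * ka \<mu>" unfolding times_divide_eq_left pos_divide_le_eq[OF cb(7)] .
    have "1 / k4 \<le> ka \<mu>"
    proof (rule order.trans[OF _ cb(2)])
      have "mu_min powr (\<alpha> - \<gamma> / 2) \<le> \<mu> powr (\<alpha> - \<gamma> / 2)" using par mu by (intro powr_ge_base) auto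
      then show "1 / k4 \<le> 1 / sqrt mass_const * \<mu> powr (\<alpha> - \<gamma> / 2)" using cp by (simp add: k4_def divide_right_mono)
    qed
    then have "1 \<le> k4 * ka \<mu>" using cp mu_min(1) nn by (simp add: k4_def pos_divide_le_eq mult.commute)
    also have "k4 * ka \<mu> \<le> K' * ka \<mu>" using nn mst cb by (intro mult_right_mono) (auto simp: K'_def)
    finally show "1 \<le> K' * ka \<mu>" .
    have "1 / k5 \<le> om \<mu>"
    proof (rule order.trans[OF _ cb(4)])
      have "mu_min powr (1 / 2 - \<gamma> / 2) \<le> \<mu> powr (1 / 2 - \<gamma> / 2)" using par mu by (intro powr_ge_base) auto
      then show "1 / k5 \<le> sqrt (\<sigma> / mass_const) * \<mu> powr (1 / 2 - \<gamma> / 2)" using cp mst by (simp add: k5_def mult_left_mono)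
    qed
    moreover have "k5 > 0" using cp mst mu_min(1) by (simp add: k5_def)
    ultimately have "1 \<le> k5 * om \<mu>" by (simp add: pos_divide_le_eq mult.commute)
    also have "k5 * om \<mu> \<le> K' * om \<mu>" using nn mst cb by (intro mult_right_mono) (auto simp: K'_def)
    finally show "1 \<le> K' * om \<mu>" .
  qed
  then show ?thesis by blast
qed

definition K_unif :: real where "K_unif = (SOME K. \<forall>\<mu>\<ge>mu_min. damped_chain (om \<mu>) (ka \<mu>) (nu \<mu>) de K)"

lemma blocks: "mu_min \<le> \<mu> \<Longrightarrow> damped_chain (om \<mu>) (ka \<mu>) (nu \<mu>) de K_unif"
  using someI_ex[OF damped_chain_blocks] unfolding K_unif_def by blast

section \<open>Normalised coordinates on the energy space\<close>

abbreviation "XX \<equiv> energy_space A \<gamma>"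
abbreviation "NN \<equiv> energy_norm A \<sigma> m \<tau> \<gamma>"
abbreviation "AA \<equiv> system_op A \<sigma> m \<tau> \<alpha> \<beta> \<gamma>"

text \<open>
  The map from normalised coordinates \<open>(w, p, \<theta>, r)\<close> to states \<open>(u, v, \<theta>, q)\<close>. Its two spectral weights
  are bounded, so it is defined on all quadruples, and the energy of a state is the squared Hilbert norm
  of its coordinates.
\<close>

abbreviation "from_w \<equiv> fun_calc (\<lambda>\<mu>. 1 / sqrt (\<sigma> * \<mu>))"
abbreviation "from_p \<equiv> fun_calc (\<lambda>\<mu>. 1 / sqrt (mass \<mu>))"

definition to_state :: "'h state \<Rightarrow> 'h state" where
  "to_state = (\<lambda>(w, p, \<theta>, r). (from_w w, from_p p, \<theta>, (1 / sqrt \<tau>) *\<^sub>R r))"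

lemma to_state_bounds: "mu_min \<le> \<mu> \<Longrightarrow> \<bar>1 / sqrt (\<sigma> * \<mu>)\<bar> \<le> 1 / sqrt (\<sigma> * mu_min)" "mu_min \<le> \<mu> \<Longrightarrow> \<bar>1 / sqrt (mass \<mu>)\<bar> \<le> 1"
  using mst mu_min(1) mass_pos[of \<mu>] by (auto intro!: divide_left_mono simp: divide_le_eq)

lemma to_state_linear: "bounded_linear to_state"
  unfolding to_state_def case_prod_unfold
  by (intro bounded_linear_Pair bounded_linear_compose[OF bounded_linear_fun_calc[OF to_state_bounds(1)]]
      bounded_linear_compose[OF bounded_linear_fun_calc[OF to_state_bounds(2)]] bounded_linear_compose[OF bounded_linear_scaleR_right]
      bounded_linear_fst bounded_linear_compose[OF bounded_linear_fst] bounded_linear_compose[OF bounded_linear_snd] bounded_linear_snd)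

lemma P_to_state: "P \<mu> (from_w w) = (1 / sqrt (\<sigma> * \<mu>)) *\<^sub>R P \<mu> w"
  "P \<mu> (from_p w) = (1 / sqrt (mass \<mu>)) *\<^sub>R P \<mu> w"
  by (rule P_fun_calc, rule fun_dom_bounded, erule to_state_bounds)+

lemma scale_eq: "(mu_min \<le> \<mu> \<Longrightarrow> a = b) \<Longrightarrow> e \<in> E \<mu> \<Longrightarrow> a *\<^sub>R e = b *\<^sub>R e"
  using off_spectrum[of \<mu> e] by (cases "mu_min \<le> \<mu>") auto

lemma pow_dom_eq: "pow_dom A s = fun_dom (\<lambda>\<mu>. \<mu> powr s)"
  by (simp add: pow_dom_def fun_dom_def ext_space_def embed_def P_in)

lemma frac_pow_eq: "frac_pow A s = fun_calc (\<lambda>\<mu>. \<mu> powr s)"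
  by (simp add: frac_pow_def fun_calc_def fun_eq_iff)

lemma to_state_weights:
  "(norm (\<mu> powr (1/2) *\<^sub>R P \<mu> (from_w w)))\<^sup>2 = (1 / \<sigma>) * (norm (P \<mu> w))\<^sup>2" (is ?A)
  "m * (norm (\<mu> powr (\<gamma>/2) *\<^sub>R P \<mu> (from_p p)))\<^sup>2 + (norm (P \<mu> (from_p p)))\<^sup>2
     = (norm (P \<mu> p))\<^sup>2" (is ?B)
proof -
  show ?A
  proof (cases "mu_min \<le> \<mu>")
    case True
    then have mu: "\<mu> > 0" using mu_min(1) by simp
    then have "\<mu> powr (1/2) * (1 / sqrt (\<sigma> * \<mu>)) = 1 / sqrt \<sigma>" using mst by (simp add: real_sqrt_mult powr_half_sqrt)
    then have "\<mu> powr (1/2) *\<^sub>R P \<mu> (from_w w) = (1 / sqrt \<sigma>) *\<^sub>R P \<mu> w" unfolding P_to_state by simp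
    then show ?thesis using mst by (simp add: power_mult_distrib power_divide)
  qed (use off_spectrum[OF _ P_in] in simp)
  show ?B
  proof (cases "mu_min \<le> \<mu>")
    case True
    then have mu: "\<mu> > 0" using mu_min(1) by simp
    have g: "(\<mu> powr (\<gamma>/2))\<^sup>2 = \<mu> powr \<gamma>" by (simp add: power2_eq_square powr_add[symmetric])
    have mm: "(sqrt (mass \<mu>))\<^sup>2 = mass \<mu>" using mass_pos[of \<mu>] by simp
    have "m * (\<mu> powr \<gamma> * ((1 / mass \<mu>) * N)) + (1 / mass \<mu>) * N = N" for N
      using mass_pos(1)[of \<mu>] by (simp add: field_simps) (simp add: mass_def algebra_simps)
    then show ?thesis unfolding P_to_state by (simp add: power_mult_distrib power_divide g mm)
  qed (use off_spectrum[OF _ P_in] in simp)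
qed

lemma to_state_fun_dom: "from_w w \<in> fun_dom (\<lambda>\<mu>. \<mu> powr (1/2))"
  "from_p p \<in> fun_dom (\<lambda>\<mu>. \<mu> powr (\<gamma>/2))"
proof -
  show "from_w w \<in> fun_dom (\<lambda>\<mu>. \<mu> powr (1/2))"
    unfolding fun_dom_def mem_Collect_eq to_state_weights by (rule summable_mono[OF P_summable[of w], of _ "1/\<sigma>"]) (use mst in auto)
  show "from_p p \<in> fun_dom (\<lambda>\<mu>. \<mu> powr (\<gamma>/2))"
    unfolding fun_dom_def mem_Collect_eq
  proof (rule summable_mono[OF P_summable[of p] zero_le_power2])
    fix \<mu>
    have "m * (norm (\<mu> powr (\<gamma>/2) *\<^sub>R P \<mu> (from_p p)))\<^sup>2 \<le> (norm (P \<mu> p))\<^sup>2"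
      using to_state_weights(2)[of \<mu> p] zero_le_power2[of "norm (P \<mu> (from_p p))"] by linarith
    then show "(norm (\<mu> powr (\<gamma>/2) *\<^sub>R P \<mu> (from_p p)))\<^sup>2 \<le> 1 / m * (norm (P \<mu> p))\<^sup>2"
      using mst by (simp add: field_simps)
  qed
qed

lemma to_state_in: "to_state x \<in> XX"
  by (cases x) (simp add: to_state_def energy_space_def pow_dom_eq to_state_fun_dom)

lemma norm_fun_calc_has_sum: "x \<in> fun_dom \<phi> \<Longrightarrow> ((\<lambda>\<mu>. (norm (\<phi> \<mu> *\<^sub>R P \<mu> x))\<^sup>2) has_sum (norm (fun_calc \<phi> x))\<^sup>2) UNIV"
  using parseval[of "fun_calc \<phi> x"] by (simp add: P_fun_calc)

lemma to_state_norm: "NN (to_state x) = norm x"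
proof -
  obtain w p \<theta> r where x: "x = (w, p, \<theta>, r)" by (cases x)
  define u v where "u = from_w w" "v = from_p p"
  have "((\<lambda>\<mu>. (1 / \<sigma>) * (norm (P \<mu> w))\<^sup>2) has_sum (norm (frac_pow A (1/2) u))\<^sup>2) UNIV"
    using norm_fun_calc_has_sum[OF to_state_fun_dom(1)[of w]] unfolding to_state_weights by (simp add: frac_pow_eq u_v_def)
  moreover have "((\<lambda>\<mu>. (1 / \<sigma>) * (norm (P \<mu> w))\<^sup>2) has_sum (1 / \<sigma>) * (norm w)\<^sup>2) UNIV"
    by (rule has_sum_cmult_right[OF parseval])
  ultimately have 1: "\<sigma> * (norm (frac_pow A (1/2) u))\<^sup>2 = (norm w)\<^sup>2" using has_sum_unique mst by fastforce
  have "((\<lambda>\<mu>. (norm (P \<mu> p))\<^sup>2) has_sum (m * (norm (frac_pow A (\<gamma>/2) v))\<^sup>2 + (norm v)\<^sup>2)) UNIV"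
    using has_sum_add[OF has_sum_cmult_right[OF norm_fun_calc_has_sum[OF to_state_fun_dom(2)[of p]], of m] parseval[of v]]
    unfolding u_v_def to_state_weights by (simp add: frac_pow_eq)
  then have 2: "m * (norm (frac_pow A (\<gamma>/2) v))\<^sup>2 + (norm v)\<^sup>2 = (norm p)\<^sup>2" by (rule has_sum_unique[OF _ parseval])
  have "Re (energy_inner A \<sigma> m \<tau> \<gamma> (to_state x) (to_state x)) = \<sigma> * (norm (frac_pow A (1/2) u))\<^sup>2 + m * (norm (frac_pow A (\<gamma>/2) v))\<^sup>2 + (norm v)\<^sup>2
     + (norm \<theta>)\<^sup>2 + \<tau> * (norm ((1 / sqrt \<tau>) *\<^sub>R r))\<^sup>2"
    unfolding x to_state_def split_conv u_v_def[symmetric] energy_inner.simps cinner_self by simp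
  also have "\<dots> = (norm w)\<^sup>2 + (norm p)\<^sup>2 + (norm \<theta>)\<^sup>2 + (norm r)\<^sup>2"
    using 1 2 mst by (simp add: power_divide)
  also have "\<dots> = (norm x)\<^sup>2" by (simp add: x norm_quad)
  finally show ?thesis by (simp add: energy_norm_def)
qed

text \<open>
  The coordinates \<open>w\<close> and \<open>p\<close> of a state are built from their expansions, which are square summable
  precisely because of the domains in the definition of the energy space.
\<close>

lemma to_state_surj: "U \<in> XX \<Longrightarrow> \<exists>x. to_state x = U"
proof -
  assume U: "U \<in> XX"
  obtain u v \<theta> q where u: "U = (u, v, \<theta>, q)" by (cases U)
  have d: "u \<in> fun_dom (\<lambda>\<mu>. \<mu> powr (1/2))" "v \<in> fun_dom (\<lambda>\<mu>. \<mu> powr (\<gamma>/2))"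
    using U by (auto simp: u energy_space_def pow_dom_eq)
  have "\<exists>w. \<forall>\<mu>. P \<mu> w = sqrt (\<sigma> * \<mu>) *\<^sub>R P \<mu> u"
  proof (rule expansion_ex)
    show "(\<lambda>\<mu>. (norm (sqrt (\<sigma> * \<mu>) *\<^sub>R P \<mu> u))\<^sup>2) summable_on UNIV"
    proof (rule summable_mono[OF _ zero_le_power2])
      show "(\<lambda>\<mu>. (norm (\<mu> powr (1/2) *\<^sub>R P \<mu> u))\<^sup>2) summable_on UNIV" using d(1) by (simp add: fun_dom_def)
      show "(norm (sqrt (\<sigma> * \<mu>) *\<^sub>R P \<mu> u))\<^sup>2 \<le> \<sigma> * (norm (\<mu> powr (1/2) *\<^sub>R P \<mu> u))\<^sup>2" for \<mu>
      proof (cases "mu_min \<le> \<mu>")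
        case True
        then have "\<mu> > 0" using mu_min(1) by simp
        then show ?thesis using mst by (simp add: power_mult_distrib powr_half_sqrt)
      qed (use off_spectrum[OF _ P_in] in simp)
    qed
  qed (rule E_closed_ops(4)[OF P_in])
  then obtain w where w: "\<And>\<mu>. P \<mu> w = sqrt (\<sigma> * \<mu>) *\<^sub>R P \<mu> u" by blast
  have "\<exists>p. \<forall>\<mu>. P \<mu> p = sqrt (mass \<mu>) *\<^sub>R P \<mu> v"
  proof (rule expansion_ex)
    show "(\<lambda>\<mu>. (norm (sqrt (mass \<mu>) *\<^sub>R P \<mu> v))\<^sup>2) summable_on UNIV"
    proof (rule summable_mono[OF _ zero_le_power2])
      show "(\<lambda>\<mu>. (norm (\<mu> powr (\<gamma>/2) *\<^sub>R P \<mu> v))\<^sup>2) summable_on UNIV" using d(2) by (simp add: fun_dom_def)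
      show "(norm (sqrt (mass \<mu>) *\<^sub>R P \<mu> v))\<^sup>2 \<le> mass_const * (norm (\<mu> powr (\<gamma>/2) *\<^sub>R P \<mu> v))\<^sup>2" for \<mu>
      proof (cases "mu_min \<le> \<mu>")
        case True
        have "(\<mu> powr (\<gamma>/2))\<^sup>2 = \<mu> powr \<gamma>" by (simp add: power2_eq_square powr_add[symmetric])
        moreover have "mass \<mu> * (norm (P \<mu> v))\<^sup>2 \<le> mass_const * \<mu> powr \<gamma> * (norm (P \<mu> v))\<^sup>2"
          using mass_bounds[OF True] by (intro mult_right_mono) auto
        ultimately show ?thesis using mass_pos[of \<mu>] by (simp add: power_mult_distrib)
      qed (use off_spectrum[OF _ P_in] in simp)
    qed
  qed (rule E_closed_ops(4)[OF P_in])
  then obtain p where p: "\<And>\<mu>. P \<mu> p = sqrt (mass \<mu>) *\<^sub>R P \<mu> v" by blast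
  have "from_w w = u"
  proof (rule P_ext)
    fix \<mu>
    have "(1 / sqrt (\<sigma> * \<mu>) * sqrt (\<sigma> * \<mu>)) *\<^sub>R P \<mu> u = 1 *\<^sub>R P \<mu> u"
      by (rule scale_eq[OF _ P_in]) (use mst mu_min(1) in auto)
    then show "P \<mu> (from_w w) = P \<mu> u" by (simp add: P_to_state w)
  qed
  moreover have "from_p p = v"
    by (rule P_ext) (use mass_pos(1) in \<open>simp add: P_to_state p less_imp_neq[symmetric]\<close>)
  ultimately have "to_state (w, p, \<theta>, sqrt \<tau> *\<^sub>R q) = U" using mst by (simp add: to_state_def u)
  then show ?thesis by blast
qed

lemma to_state_inj: "inj to_state"
proof (rule injI)
  fix x y assume eq: "to_state x = to_state y"
  interpret L: bounded_linear to_state by (rule to_state_linear)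
  have "norm (x - y) = NN (to_state (x - y))" by (simp add: to_state_norm)
  also have "to_state (x - y) = to_state 0" using eq by (simp add: L.diff L.zero)
  also have "NN (to_state 0) = 0" by (simp only: to_state_norm norm_zero)
  finally show "x = y" by simp
qed

definition "of_state = inv to_state"

lemma of_state: "of_state (to_state x) = x" "U \<in> XX \<Longrightarrow> to_state (of_state U) = U"
proof -
  show "of_state (to_state x) = x" unfolding of_state_def by (rule inv_f_f[OF to_state_inj])
  assume "U \<in> XX"
  then have "U \<in> range to_state" using to_state_surj by blast
  then show "to_state (of_state U) = U" unfolding of_state_def by (rule f_inv_into_f)
qed

section \<open>The system operator in normalised coordinates\<close>

lemma range_embed: "Z \<in> range (embed A) \<longleftrightarrow> (\<forall>\<mu>. Z \<mu> \<in> E \<mu>) \<and> (\<lambda>\<mu>. (norm (Z \<mu>))\<^sup>2) summable_on UNIV"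
proof
  assume "(\<forall>\<mu>. Z \<mu> \<in> E \<mu>) \<and> (\<lambda>\<mu>. (norm (Z \<mu>))\<^sup>2) summable_on UNIV"
  then obtain y where "\<forall>\<mu>. P \<mu> y = Z \<mu>" using expansion_ex[of Z] by blast
  then have "embed A y = Z" by (simp add: embed_def fun_eq_iff)
  then show "Z \<in> range (embed A)" by blast
qed (auto simp: embed_def P_in P_summable)

lemma inv_embed: "(\<And>\<mu>. P \<mu> y = Z \<mu>) \<Longrightarrow> inv (embed A) Z = y"
proof -
  assume "\<And>\<mu>. P \<mu> y = Z \<mu>"
  then have Z: "Z = embed A y" by (simp add: embed_def fun_eq_iff)
  have "inj (embed A)" by (rule injI) (metis P_ext embed_def)
  then show ?thesis unfolding Z by (rule inv_f_f)
qed

text \<open>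
  The maximal block-diagonal operator with the blocks \<open>chain_at \<mu>\<close>.
\<close>

definition gen_dom :: "'h state set" where
  "gen_dom = {x. (\<lambda>\<mu>. (norm (chain_at \<mu> (block \<mu> x)))\<^sup>2) summable_on UNIV}"

definition gen :: "'h state \<Rightarrow> 'h state" where "gen x = (SOME y. \<forall>\<mu>. block \<mu> y = chain_at \<mu> (block \<mu> x))"

lemma block_gen: "x \<in> gen_dom \<Longrightarrow> block \<mu> (gen x) = chain_at \<mu> (block \<mu> x)"
proof -
  assume "x \<in> gen_dom"
  then have "\<exists>y. \<forall>\<mu>. block \<mu> y = chain_at \<mu> (block \<mu> x)"
    using block_expansion_ex[of "\<lambda>\<mu>. chain_at \<mu> (block \<mu> x)"] block_space_chain[OF block_in] by (simp add: gen_dom_def)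
  from someI_ex[OF this] show ?thesis by (simp add: gen_def)
qed

text \<open>
  The four expressions in the definition of the system operator, on one eigenspace and in normalised
  coordinates: each is a multiple of one entry of the chain.
\<close>

lemma block_equations:
  fixes w p \<theta> r :: 'h
  defines "u \<equiv> from_w w" and "v \<equiv> from_p p" and "q \<equiv> (1 / sqrt \<tau>) *\<^sub>R r"
  shows "om \<mu> *\<^sub>R P \<mu> p = sqrt \<sigma> *\<^sub>R (\<mu> powr (1/2) *\<^sub>R P \<mu> v)"
    "\<sigma> *\<^sub>R ext_pow A 1 u \<mu> - ext_pow A \<alpha> \<theta> \<mu> = - (sqrt (mass \<mu>) *\<^sub>R (ka \<mu> *\<^sub>R P \<mu> \<theta> - om \<mu> *\<^sub>R P \<mu> w))"
    "- ext_pow A \<alpha> v \<mu> + ext_pow A (\<beta>/2) q \<mu> = nu \<mu> *\<^sub>R P \<mu> r - ka \<mu> *\<^sub>R P \<mu> p"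
    "embed A q \<mu> + ext_pow A (\<beta>/2) \<theta> \<mu> = - (sqrt \<tau> *\<^sub>R (- de *\<^sub>R P \<mu> r - nu \<mu> *\<^sub>R P \<mu> \<theta>))"
proof -
  have sm: "sqrt (mass \<mu>) > 0" using mass_pos by simp
  have st: "sqrt \<tau> > 0" "sqrt \<tau> * de = 1 / sqrt \<tau>" "sqrt \<tau> * nu \<mu> = \<mu> powr (\<beta>/2)" using mst by (auto simp: de_def nu_def real_div_sqrt field_simps)
  have "om \<mu> *\<^sub>R P \<mu> p = (sqrt \<sigma> * (\<mu> powr (1/2) * (1 / sqrt (mass \<mu>)))) *\<^sub>R P \<mu> p"
    by (rule scale_eq[OF _ P_in]) (use mst mu_min(1) in \<open>simp add: om_def real_sqrt_mult powr_half_sqrt\<close>)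
  then show "om \<mu> *\<^sub>R P \<mu> p = sqrt \<sigma> *\<^sub>R (\<mu> powr (1/2) *\<^sub>R P \<mu> v)" by (simp add: v_def P_to_state)
  have "(\<sigma> * (\<mu> powr 1 * (1 / sqrt (\<sigma> * \<mu>)))) *\<^sub>R P \<mu> w = (sqrt (mass \<mu>) * om \<mu>) *\<^sub>R P \<mu> w"
  proof (rule scale_eq[OF _ P_in])
    assume "mu_min \<le> \<mu>"
    then have "\<mu> > 0" using mu_min(1) by simp
    then have "\<sigma> * \<mu> = sqrt (\<sigma> * \<mu>) * sqrt (\<sigma> * \<mu>)" "sqrt (\<sigma> * \<mu>) > 0" using mst by auto
    then show "\<sigma> * (\<mu> powr 1 * (1 / sqrt (\<sigma> * \<mu>))) = sqrt (mass \<mu>) * om \<mu>"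
      using sm \<open>\<mu> > 0\<close> by (simp add: om_def real_div_sqrt)
  qed
  then show "\<sigma> *\<^sub>R ext_pow A 1 u \<mu> - ext_pow A \<alpha> \<theta> \<mu> = - (sqrt (mass \<mu>) *\<^sub>R (ka \<mu> *\<^sub>R P \<mu> \<theta> - om \<mu> *\<^sub>R P \<mu> w))"
    using sm by (simp add: u_def ext_pow_def embed_def P_to_state ka_def scaleR_right_diff_distrib)
  show "- ext_pow A \<alpha> v \<mu> + ext_pow A (\<beta>/2) q \<mu> = nu \<mu> *\<^sub>R P \<mu> r - ka \<mu> *\<^sub>R P \<mu> p"
    by (simp add: v_def q_def ext_pow_def embed_def P_to_state P_scale ka_def nu_def)
  show "embed A q \<mu> + ext_pow A (\<beta>/2) \<theta> \<mu> = - (sqrt \<tau> *\<^sub>R (- de *\<^sub>R P \<mu> r - nu \<mu> *\<^sub>R P \<mu> \<theta>))"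
    by (simp add: q_def ext_pow_def embed_def P_scale scaleR_right_diff_distrib st)
qed

text \<open>
  The four conditions that define the domain say that the four entries of the chain are square summable.
  For the second one the factor \<open>\<mu>^(-\<gamma>/2) sqrt (mass \<mu>)\<close> lies between positive constants.
\<close>

lemma opdom_iff: "to_state x \<in> opdom AA \<longleftrightarrow> x \<in> gen_dom"
proof -
  obtain w p \<theta> r where x: "x = (w, p, \<theta>, r)" by (cases x)
  define u v q where "u = from_w w" "v = from_p p" "q = (1 / sqrt \<tau>) *\<^sub>R r"
  define d1 d2 d3 d4 where d: "d1 = (\<lambda>\<mu>. om \<mu> *\<^sub>R P \<mu> p)" "d2 = (\<lambda>\<mu>. ka \<mu> *\<^sub>R P \<mu> \<theta> - om \<mu> *\<^sub>R P \<mu> w)"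
    "d3 = (\<lambda>\<mu>. nu \<mu> *\<^sub>R P \<mu> r - ka \<mu> *\<^sub>R P \<mu> p)" "d4 = (\<lambda>\<mu>. - de *\<^sub>R P \<mu> r - nu \<mu> *\<^sub>R P \<mu> \<theta>)"
  note eqs = block_equations(1)[where p=p] block_equations(2)[where w=w and \<theta>=\<theta>]
    block_equations(3)[where p=p and r=r] block_equations(4)[where r=r and \<theta>=\<theta>]
  note eqs = eqs[folded u_v_q_def, folded d[THEN fun_cong]]
  define ss where "ss = (\<lambda>g :: real \<Rightarrow> 'h. (\<lambda>\<mu>. (norm (g \<mu>))\<^sup>2) summable_on UNIV)"
  have ssm: "ss b \<Longrightarrow> (\<And>\<mu>. norm (a \<mu>) \<le> c * norm (b \<mu>)) \<Longrightarrow> c \<ge> 0 \<Longrightarrow> ss a" for a b c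
    unfolding ss_def by (rule summable_mono[OF _ zero_le_power2], assumption) (rule norm_sq_le, auto)
  have dE: "d1 \<mu> \<in> E \<mu>" "d2 \<mu> \<in> E \<mu>" "d3 \<mu> \<in> E \<mu>" "d4 \<mu> \<in> E \<mu>" for \<mu>
    unfolding d by (intro E_closed_ops P_in)+
  have MMx: "chain_at \<mu> (block \<mu> x) = (d1 \<mu>, d2 \<mu>, d3 \<mu>, d4 \<mu>)" for \<mu> by (simp add: x block_def chain_def d)
  have "x \<in> gen_dom \<longleftrightarrow> ss d1 \<and> ss d2 \<and> ss d3 \<and> ss d4"
  proof
    assume "x \<in> gen_dom"
    then have S: "(\<lambda>\<mu>. (norm (d1 \<mu>))\<^sup>2 + (norm (d2 \<mu>))\<^sup>2 + (norm (d3 \<mu>))\<^sup>2 + (norm (d4 \<mu>))\<^sup>2) summable_on UNIV"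
      by (simp add: gen_dom_def MMx norm_quad)
    show "ss d1 \<and> ss d2 \<and> ss d3 \<and> ss d4" unfolding ss_def
      by (intro conjI; rule summable_mono[OF S zero_le_power2, of _ 1]; simp add: add_increasing add_increasing2)
  next
    assume "ss d1 \<and> ss d2 \<and> ss d3 \<and> ss d4"
    then show "x \<in> gen_dom" unfolding ss_def gen_dom_def mem_Collect_eq MMx norm_quad by (intro summable_on_add) auto
  qed
  moreover have "v \<in> pow_dom A (1/2) \<longleftrightarrow> ss d1"
  proof -
    have "v \<in> pow_dom A (1/2) \<longleftrightarrow> ss (\<lambda>\<mu>. \<mu> powr (1/2) *\<^sub>R P \<mu> v)" by (simp add: pow_dom_eq fun_dom_def ss_def)
    also have "\<dots> \<longleftrightarrow> ss d1"
    proof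
      assume "ss d1" then show "ss (\<lambda>\<mu>. \<mu> powr (1/2) *\<^sub>R P \<mu> v)"
        by (rule ssm[of _ _ "1 / sqrt \<sigma>"]) (use mst in \<open>auto simp: eqs(1)\<close>)
    next
      assume "ss (\<lambda>\<mu>. \<mu> powr (1/2) *\<^sub>R P \<mu> v)" then show "ss d1"
        by (rule ssm[of _ _ "sqrt \<sigma>"]) (use mst in \<open>auto simp: eqs(1)\<close>)
    qed
    finally show ?thesis .
  qed
  moreover have "(\<lambda>\<mu>. \<sigma> *\<^sub>R ext_pow A 1 u \<mu> - ext_pow A \<alpha> \<theta> \<mu>) \<in> ext_space A (- \<gamma>/2) \<longleftrightarrow> ss d2"
  proof -
    have "(\<lambda>\<mu>. \<sigma> *\<^sub>R ext_pow A 1 u \<mu> - ext_pow A \<alpha> \<theta> \<mu>) \<in> ext_space A (- \<gamma>/2) \<longleftrightarrow>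
        ss (\<lambda>\<mu>. \<mu> powr (- \<gamma>/2) *\<^sub>R (- (sqrt (mass \<mu>) *\<^sub>R d2 \<mu>)))"
      unfolding ext_space_def mem_Collect_eq eqs(2) ss_def using dE(2) E_closed_ops(4,6) by blast
    also have "\<dots> \<longleftrightarrow> ss d2"
    proof -
      have b: "sqrt m * norm (d2 \<mu>) \<le> norm (\<mu> powr (- \<gamma>/2) *\<^sub>R (- (sqrt (mass \<mu>) *\<^sub>R d2 \<mu>))) \<and>
          norm (\<mu> powr (- \<gamma>/2) *\<^sub>R (- (sqrt (mass \<mu>) *\<^sub>R d2 \<mu>))) \<le> sqrt mass_const * norm (d2 \<mu>)" for \<mu>
      proof (cases "mu_min \<le> \<mu>")
        case True
        then have mu: "\<mu> > 0" using mu_min(1) by simp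
        then have "\<mu> powr (- \<gamma>/2) * \<mu> powr (\<gamma>/2) = 1" by (simp add: powr_add[symmetric])
        then have "sqrt m \<le> \<mu> powr (- \<gamma>/2) * sqrt (mass \<mu>)" "\<mu> powr (- \<gamma>/2) * sqrt (mass \<mu>) \<le> sqrt mass_const"
          using mult_left_mono[OF sqrt_mass_bounds(1)[OF True], of "\<mu> powr (- \<gamma>/2)"] mult_left_mono[OF sqrt_mass_bounds(2)[OF True], of "\<mu> powr (- \<gamma>/2)"]
          by (simp_all add: mult.left_commute)
        then have "sqrt m * norm (d2 \<mu>) \<le> (\<mu> powr (- \<gamma>/2) * sqrt (mass \<mu>)) * norm (d2 \<mu>)"
            "(\<mu> powr (- \<gamma>/2) * sqrt (mass \<mu>)) * norm (d2 \<mu>) \<le> sqrt mass_const * norm (d2 \<mu>)" by (intro mult_right_mono; simp)+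
        then show ?thesis using mass_pos(1)[of \<mu>] by (simp add: mult.assoc)
      qed (use off_spectrum[OF _ dE(2)] in simp)
      show ?thesis
      proof
        assume "ss (\<lambda>\<mu>. \<mu> powr (- \<gamma>/2) *\<^sub>R (- (sqrt (mass \<mu>) *\<^sub>R d2 \<mu>)))"
        then show "ss d2"
        proof (rule ssm[of _ _ "1 / sqrt m"])
          show "norm (d2 \<mu>) \<le> 1 / sqrt m * norm (\<mu> powr (- \<gamma>/2) *\<^sub>R (- (sqrt (mass \<mu>) *\<^sub>R d2 \<mu>)))" for \<mu>
            using mult_left_mono[OF b[of \<mu>, THEN conjunct1], of "1 / sqrt m"] mst by simp
        qed (use mst in simp)
      next
        assume "ss d2"
        then show "ss (\<lambda>\<mu>. \<mu> powr (- \<gamma>/2) *\<^sub>R (- (sqrt (mass \<mu>) *\<^sub>R d2 \<mu>)))"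
          by (rule ssm[OF _ b[THEN conjunct2]]) (use mass_bounds(3)[OF order_refl] in simp)
      qed
    qed
    finally show ?thesis .
  qed
  moreover have "(\<lambda>\<mu>. - ext_pow A \<alpha> v \<mu> + ext_pow A (\<beta>/2) q \<mu>) \<in> range (embed A) \<longleftrightarrow> ss d3"
    unfolding range_embed eqs(3) ss_def using dE by simp
  moreover have "(\<lambda>\<mu>. embed A q \<mu> + ext_pow A (\<beta>/2) \<theta> \<mu>) \<in> range (embed A) \<longleftrightarrow> ss d4"
  proof -
    have "(\<lambda>\<mu>. embed A q \<mu> + ext_pow A (\<beta>/2) \<theta> \<mu>) \<in> range (embed A) \<longleftrightarrow> ss (\<lambda>\<mu>. - (sqrt \<tau> *\<^sub>R d4 \<mu>))"
      unfolding range_embed eqs(4) ss_def using dE E_closed_ops(4,6) by blast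
    also have "\<dots> \<longleftrightarrow> ss d4"
    proof
      assume "ss (\<lambda>\<mu>. - (sqrt \<tau> *\<^sub>R d4 \<mu>))" then show "ss d4"
        by (rule ssm[of _ _ "1 / sqrt \<tau>"]) (use mst in auto)
    next
      assume "ss d4" then show "ss (\<lambda>\<mu>. - (sqrt \<tau> *\<^sub>R d4 \<mu>))"
        by (rule ssm[of _ _ "sqrt \<tau>"]) (use mst in auto)
    qed
    finally show ?thesis .
  qed
  moreover have "to_state x = (u, v, q') \<longleftrightarrow> q' = (\<theta>, q)" for q' by (auto simp: x to_state_def u_v_q_def)
  moreover have "to_state x = (u, v, \<theta>, q)" by (simp add: x to_state_def u_v_q_def)
  ultimately show ?thesis using to_state_in[of x] by (simp add: system_op_def)
qed

lemma opfun_eq: assumes "x \<in> gen_dom" shows "opfun AA (to_state x) = to_state (gen x)"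
proof -
  obtain w p \<theta> r where x: "x = (w, p, \<theta>, r)" by (cases x)
  obtain a b c d where y: "gen x = (a, b, c, d)" by (cases "gen x")
  define u v q where "u = from_w w" "v = from_p p" "q = (1 / sqrt \<tau>) *\<^sub>R r"
  note eqs = block_equations(1)[where p=p] block_equations(2)[where w=w and \<theta>=\<theta>]
    block_equations(3)[where p=p and r=r] block_equations(4)[where r=r and \<theta>=\<theta>]
  note eqs = eqs[folded u_v_q_def]
  have g: "P \<mu> a = om \<mu> *\<^sub>R P \<mu> p" "P \<mu> b = ka \<mu> *\<^sub>R P \<mu> \<theta> - om \<mu> *\<^sub>R P \<mu> w" "P \<mu> c = nu \<mu> *\<^sub>R P \<mu> r - ka \<mu> *\<^sub>R P \<mu> p"
    "P \<mu> d = - de *\<^sub>R P \<mu> r - nu \<mu> *\<^sub>R P \<mu> \<theta>" for \<mu>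
    using block_gen[OF assms, of \<mu>] unfolding y by (auto simp: x block_def chain_def)
  have "v = from_w a"
  proof (rule P_ext)
    fix \<mu>
    have "(1 / sqrt (\<sigma> * \<mu>) * (sqrt \<sigma> * \<mu> powr (1/2))) *\<^sub>R P \<mu> v = 1 *\<^sub>R P \<mu> v"
      by (rule scale_eq[OF _ P_in]) (use mst mu_min(1) in \<open>simp add: real_sqrt_mult powr_half_sqrt\<close>)
    then show "P \<mu> v = P \<mu> (from_w a)" by (simp add: P_to_state g eqs(1))
  qed
  moreover have "inv_I_plus_pow A m \<gamma> (\<lambda>\<mu>. \<sigma> *\<^sub>R ext_pow A 1 u \<mu> - ext_pow A \<alpha> \<theta> \<mu>) = - from_p b"
  proof -
    define J where "J = (\<lambda>w \<mu>. embed A w \<mu> + m *\<^sub>R ext_pow A \<gamma> w \<mu>)"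
    have J: "J w \<mu> = mass \<mu> *\<^sub>R P \<mu> w" for w \<mu> by (simp add: J_def mass_def embed_def ext_pow_def scaleR_left_distrib)
    have inj: "inj_on J (pow_dom A (\<gamma>/2))"
    proof (rule inj_onI)
      fix w w' assume eq: "J w = J w'"
      show "w = w'"
      proof (rule P_ext)
        fix \<mu>
        have "J w \<mu> = J w' \<mu>" using eq by simp
        then show "P \<mu> w = P \<mu> w'" unfolding J using mass_pos(1)[of \<mu>] by simp
      qed
    qed
    define z where "z = - from_p b"
    have "z \<in> pow_dom A (\<gamma>/2)"
      using to_state_fun_dom(2)[of b] by (simp add: z_def pow_dom_eq fun_dom_def P_minus)
    moreover have "(\<lambda>\<mu>. \<sigma> *\<^sub>R ext_pow A 1 u \<mu> - ext_pow A \<alpha> \<theta> \<mu>) = J z"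
    proof
      fix \<mu>
      have "J z \<mu> = - (mass \<mu> * (1 / sqrt (mass \<mu>))) *\<^sub>R P \<mu> b" by (simp add: J z_def P_minus P_to_state)
      also have "mass \<mu> * (1 / sqrt (mass \<mu>)) = sqrt (mass \<mu>)" using mass_pos(1)[of \<mu>] by (simp add: real_div_sqrt)
      finally show "\<sigma> *\<^sub>R ext_pow A 1 u \<mu> - ext_pow A \<alpha> \<theta> \<mu> = J z \<mu>" unfolding eqs(2) g by simp
    qed
    ultimately show ?thesis unfolding inv_I_plus_pow_def J_def[symmetric] using inv_into_f_f[OF inj] by (simp add: z_def)
  qed
  moreover have "inv (embed A) (\<lambda>\<mu>. - ext_pow A \<alpha> v \<mu> + ext_pow A (\<beta>/2) q \<mu>) = c"
    by (rule inv_embed) (simp only: eqs(3) g)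
  moreover have "inv (embed A) (\<lambda>\<mu>. - embed A q \<mu> - ext_pow A (\<beta>/2) \<theta> \<mu>) = sqrt \<tau> *\<^sub>R d"
  proof (rule inv_embed)
    fix \<mu>
    have "- embed A q \<mu> - ext_pow A (\<beta>/2) \<theta> \<mu> = - (embed A q \<mu> + ext_pow A (\<beta>/2) \<theta> \<mu>)" by simp
    then show "P \<mu> (sqrt \<tau> *\<^sub>R d) = - embed A q \<mu> - ext_pow A (\<beta>/2) \<theta> \<mu>" unfolding eqs(4) P_scale g by simp
  qed
  moreover have "1 / \<tau> * sqrt \<tau> = 1 / sqrt \<tau>" using mst by (simp add: real_div_sqrt field_simps)
  moreover have "to_state x = (u, v, \<theta>, q)" by (simp add: x to_state_def u_v_q_def)
  ultimately show ?thesis by (simp add: system_op_def y to_state_def)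
qed

end

section \<open>The semigroup in normalised coordinates\<close>

text \<open>
  The generator gives one-sided derivatives at time zero only. The derivative from the left at \<open>t\<close> comes
  from the quotient at \<open>0\<close> transported by \<open>S u\<close> with \<open>u < t\<close>; strong continuity at \<open>y\<close> allows replacing \<open>S u y\<close>
  by \<open>S t y\<close>.
\<close>

lemma semigroup_orbit:
  fixes S :: "real \<Rightarrow> 'b::real_normed_vector \<Rightarrow> 'b"
  assumes lin: "\<And>t. 0 \<le> t \<Longrightarrow> linear (S t)" and contr: "\<And>t z. 0 \<le> t \<Longrightarrow> norm (S t z) \<le> norm z"
    and semi: "\<And>s t z. 0 \<le> s \<Longrightarrow> 0 \<le> t \<Longrightarrow> S (s + t) z = S s (S t z)"
    and cont: "((\<lambda>h. S h y) \<longlongrightarrow> y) (at_right 0)"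
    and gen: "((\<lambda>h. (1 / h) *\<^sub>R (S h x - x)) \<longlongrightarrow> y) (at_right 0)" and t: "0 \<le> t"
  shows "((\<lambda>h. (1 / h) *\<^sub>R (S h (S t x) - S t x)) \<longlongrightarrow> S t y) (at_right 0)"
    and "((\<lambda>t. S t x) has_vector_derivative S t y) (at t within {0..})"
proof -
  have diff: "S u (a - b) = S u a - S u b" and scale: "S u (c *\<^sub>R a) = c *\<^sub>R S u a" and add: "S u (a + b) = S u a + S u b"
    if "0 \<le> u" for u a b c
    using lin[OF that] by (auto simp: linear_diff linear_scale linear_add)
  have comm: "S h (S t x) = S t (S h x)" if "0 \<le> h" for h using semi[OF that t, of x] semi[OF t that, of x] by (simp add: add.commute)
  show "((\<lambda>h. (1 / h) *\<^sub>R (S h (S t x) - S t x)) \<longlongrightarrow> S t y) (at_right 0)"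
  proof (rule LIM_zero_cancel, rule Lim_null_comparison)
    show "\<forall>\<^sub>F h in at_right 0. norm ((1 / h) *\<^sub>R (S h (S t x) - S t x) - S t y) \<le> norm ((1 / h) *\<^sub>R (S h x - x) - y)"
    proof (rule eventually_at_rightI[of 0 1])
      fix h :: real assume "h \<in> {0<..<1}"
      then have h: "0 \<le> h" by simp
      have "(1 / h) *\<^sub>R (S h (S t x) - S t x) - S t y = S t ((1 / h) *\<^sub>R (S h x - x) - y)"
        using t by (simp add: comm[OF h] diff scale)
      then show "norm ((1 / h) *\<^sub>R (S h (S t x) - S t x) - S t y) \<le> norm ((1 / h) *\<^sub>R (S h x - x) - y)"
        using contr[OF t] by simp
    qed simp
    show "((\<lambda>h. norm ((1 / h) *\<^sub>R (S h x - x) - y)) \<longlongrightarrow> 0) (at_right 0)"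
      using gen by (intro tendsto_norm_zero LIM_zero)
  qed
  have "\<forall>e>0. \<exists>d>0. \<forall>u\<in>{0..}. norm (u - t) < d \<longrightarrow> norm (S u x - S t x - (u - t) *\<^sub>R S t y) \<le> e * norm (u - t)"
  proof (intro allI impI)
    fix e :: real assume e: "e > 0"
    have "\<forall>\<^sub>F h in at_right 0. dist ((1 / h) *\<^sub>R (S h x - x)) y < e / 2 \<and> dist (S h y) y < e / 2"
      using e tendstoD[OF gen, of "e/2"] tendstoD[OF cont, of "e/2"] by (intro eventually_conj) auto
    then obtain d where d: "d > 0" "\<And>h. 0 < h \<Longrightarrow> h < d \<Longrightarrow> dist ((1 / h) *\<^sub>R (S h x - x)) y < e / 2 \<and> dist (S h y) y < e / 2"
      unfolding eventually_at_right_field by auto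
    have step: "norm (S h x - x - h *\<^sub>R y) \<le> e / 2 * h" "norm (S h y - y) \<le> e / 2" if h: "0 < h" "h < d" for h
    proof -
      have "S h x - x - h *\<^sub>R y = h *\<^sub>R ((1 / h) *\<^sub>R (S h x - x) - y)" using h by (simp add: scaleR_right_diff_distrib)
      then have "norm (S h x - x - h *\<^sub>R y) = h * dist ((1 / h) *\<^sub>R (S h x - x)) y" using h by (simp add: dist_norm)
      also have "\<dots> \<le> h * (e / 2)" using d(2)[OF h] h by (intro mult_left_mono) auto
      finally show "norm (S h x - x - h *\<^sub>R y) \<le> e / 2 * h" by (simp add: mult.commute)
      show "norm (S h y - y) \<le> e / 2" using d(2)[OF h] by (simp add: dist_norm)
    qed
    have "norm (S u x - S t x - (u - t) *\<^sub>R S t y) \<le> e * norm (u - t)" if u: "u \<in> {0..}" "norm (u - t) < d" for u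
    proof (cases u t rule: linorder_cases)
      case less
      define h where "h = t - u"
      have h: "0 < h" "h < d" "0 \<le> u" "t = u + h" using less u by (auto simp: h_def)
      have "S u x - S t x - (u - t) *\<^sub>R S t y = S u (h *\<^sub>R (S h y - y) - (S h x - x - h *\<^sub>R y))"
        using h semi[OF h(3), of h x] semi[OF h(3), of h y] by (simp add: diff scale add scaleR_right_diff_distrib)
      then have "norm (S u x - S t x - (u - t) *\<^sub>R S t y) \<le> norm (h *\<^sub>R (S h y - y)) + norm (S h x - x - h *\<^sub>R y)"
        using contr[OF h(3)] norm_triangle_ineq4 order_trans by metis
      also have "\<dots> \<le> h * (e / 2) + e / 2 * h" using step[OF h(1,2)] h by (intro add_mono) auto
      finally show ?thesis using h by simp
    next
      case greater
      define h where "h = u - t"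
      have h: "0 < h" "h < d" "u = t + h" using greater u by (auto simp: h_def)
      have "S u x - S t x - (u - t) *\<^sub>R S t y = S t (S h x - x - h *\<^sub>R y)"
        using h t semi[OF t, of h x] by (simp add: diff scale)
      then have "norm (S u x - S t x - (u - t) *\<^sub>R S t y) \<le> e / 2 * h" using contr[OF t] step(1)[OF h(1,2)] order_trans by metis
      also have "\<dots> \<le> e * h" using h e by simp
      finally show ?thesis using h by simp
    qed simp
    then show "\<exists>d>0. \<forall>u\<in>{0..}. norm (u - t) < d \<longrightarrow> norm (S u x - S t x - (u - t) *\<^sub>R S t y) \<le> e * norm (u - t)"
      using d(1) by blast
  qed
  then show "((\<lambda>t. S t x) has_vector_derivative S t y) (at t within {0..})"
    unfolding has_vector_derivative_def has_derivative_within_alt by (auto intro: bounded_linear_scaleR_left)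
qed

lemma (in thermo) to_state_ops: "to_state (x + y) = to_state x + to_state y" "to_state (x - y) = to_state x - to_state y" "to_state (c *\<^sub>R x) = c *\<^sub>R to_state x" "to_state 0 = 0"
  using to_state_linear by (auto simp: bounded_linear.linear linear_add linear_diff linear_scale linear_0)

locale thermo_semigroup = thermo A m \<sigma> \<tau> \<alpha> \<beta> \<gamma> for A :: "'h::chilbert_space operator" and m \<sigma> \<tau> \<alpha> \<beta> \<gamma> +
  fixes T :: "real \<Rightarrow> 'h state \<Rightarrow> 'h state"
  assumes semigroup: "contraction_semigroup XX NN T" and generator: "is_generator XX NN T AA"
begin

text \<open>
  The given semigroup, carried over to normalised coordinates.
\<close>

definition S :: "real \<Rightarrow> 'h state \<Rightarrow> 'h state" where "S t x = of_state (T t (to_state x))"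

lemma T_in: "0 \<le> t \<Longrightarrow> T t (to_state x) \<in> XX"
  using semigroup to_state_in unfolding contraction_semigroup_def by blast

lemma to_state_S: "0 \<le> t \<Longrightarrow> to_state (S t x) = T t (to_state x)"
  by (simp add: S_def of_state T_in)

lemma S_linear: "0 \<le> t \<Longrightarrow> linear (S t)"
proof -
  assume t: "0 \<le> t"
  then have cl: "clinear_on XX (T t)" using semigroup unfolding contraction_semigroup_def by blast
  show ?thesis
  proof (rule linearI)
    fix x y c
    have "to_state (S t (x + y)) = to_state (S t x + S t y)"
      using cl to_state_in unfolding clinear_on_def by (simp add: to_state_S[OF t] to_state_ops)
    then show "S t (x + y) = S t x + S t y" using to_state_inj by (simp add: inj_eq)
    have "to_state (S t (c *\<^sub>R x)) = to_state (c *\<^sub>R S t x)"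
    proof -
      have "T t (complex_of_real c *\<^sub>C to_state x) = complex_of_real c *\<^sub>C T t (to_state x)"
        using cl to_state_in unfolding clinear_on_def by blast
      then show ?thesis by (simp only: to_state_S[OF t] to_state_ops scaleR_scaleC[symmetric])
    qed
    then show "S t (c *\<^sub>R x) = c *\<^sub>R S t x" using to_state_inj by (simp add: inj_eq)
  qed
qed

lemma S_norm: "0 \<le> t \<Longrightarrow> norm (S t x) \<le> norm x"
  using semigroup to_state_in[of x] unfolding contraction_semigroup_def to_state_norm[symmetric] by (simp add: to_state_S)

lemma S_semigroup: "0 \<le> s \<Longrightarrow> 0 \<le> t \<Longrightarrow> S (s + t) x = S s (S t x)"
proof -
  assume st: "0 \<le> s" "0 \<le> t"
  have "T (s + t) (to_state x) = T s (T t (to_state x))" using semigroup to_state_in st unfolding contraction_semigroup_def by blast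
  then have "to_state (S (s + t) x) = to_state (S s (S t x))" using st by (simp add: to_state_S)
  then show ?thesis using to_state_inj by (simp add: inj_eq)
qed

lemma S_0: "S 0 x = x"
proof -
  have "T 0 (to_state x) = to_state x" using semigroup to_state_in unfolding contraction_semigroup_def by blast
  then show ?thesis by (simp add: S_def of_state)
qed

lemma S_continuous: "((\<lambda>h. S h x) \<longlongrightarrow> x) (at_right 0)"
proof (rule LIM_zero_cancel, rule tendsto_norm_zero_cancel)
  have "((\<lambda>t. NN (T t (to_state x) - to_state x)) \<longlongrightarrow> 0) (at_right 0)"
    using semigroup to_state_in unfolding contraction_semigroup_def by blast
  moreover have "\<forall>\<^sub>F t in at_right 0. NN (T t (to_state x) - to_state x) = norm (S t x - x)"
    by (rule eventually_at_rightI[of 0 1]) (auto simp: to_state_S[symmetric] to_state_ops[symmetric] to_state_norm)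
  ultimately show "((\<lambda>h. norm (S h x - x)) \<longlongrightarrow> 0) (at_right 0)" using tendsto_cong by fastforce
qed

lemma deriv_transfer:
  "((\<lambda>t. NN ((1/t) *\<^sub>R (T t (to_state x) - to_state x) - to_state y)) \<longlongrightarrow> 0) (at_right 0) \<longleftrightarrow>
   ((\<lambda>h. (1 / h) *\<^sub>R (S h x - x)) \<longlongrightarrow> y) (at_right 0)"
proof -
  have "\<forall>\<^sub>F t in at_right 0. NN ((1/t) *\<^sub>R (T t (to_state x) - to_state x) - to_state y) = norm ((1/t) *\<^sub>R (S t x - x) - y)"
    by (rule eventually_at_rightI[of 0 1]) (auto simp: to_state_S[symmetric] to_state_ops[symmetric] to_state_norm)
  then have "((\<lambda>t. NN ((1/t) *\<^sub>R (T t (to_state x) - to_state x) - to_state y)) \<longlongrightarrow> 0) (at_right 0) \<longleftrightarrow>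
     ((\<lambda>t. norm ((1/t) *\<^sub>R (S t x - x) - y)) \<longlongrightarrow> 0) (at_right 0)" by (rule tendsto_cong)
  then show ?thesis by (simp add: tendsto_norm_zero_iff LIM_zero_iff)
qed

lemma generator_limit:
  "U \<in> opdom AA \<Longrightarrow> ((\<lambda>t. NN ((1/t) *\<^sub>R (T t U - U) - opfun AA U)) \<longlongrightarrow> 0) (at_right 0)"
  "U \<in> XX \<Longrightarrow> V \<in> XX \<Longrightarrow> ((\<lambda>t. NN ((1/t) *\<^sub>R (T t U - U) - V)) \<longlongrightarrow> 0) (at_right 0) \<Longrightarrow> U \<in> opdom AA"
proof -
  note g = generator[unfolded is_generator_def Let_def]
  show "U \<in> opdom AA \<Longrightarrow> ((\<lambda>t. NN ((1/t) *\<^sub>R (T t U - U) - opfun AA U)) \<longlongrightarrow> 0) (at_right 0)"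
    using g[THEN conjunct2] by blast
  assume "U \<in> XX" "V \<in> XX" "((\<lambda>t. NN ((1/t) *\<^sub>R (T t U - U) - V)) \<longlongrightarrow> 0) (at_right 0)"
  then show "U \<in> opdom AA" unfolding g[THEN conjunct1] mem_Collect_eq by (intro conjI bexI)
qed

lemma S_gen: "x \<in> gen_dom \<Longrightarrow> ((\<lambda>h. (1 / h) *\<^sub>R (S h x - x)) \<longlongrightarrow> gen x) (at_right 0)"
  using generator_limit(1)[of "to_state x"] unfolding opdom_iff deriv_transfer[symmetric] by (simp only: opfun_eq)

lemma S_gen_dom: assumes x: "x \<in> gen_dom" and t: "0 \<le> t" shows "S t x \<in> gen_dom" "gen (S t x) = S t (gen x)"
proof -
  note orb = semigroup_orbit(1)[of S, OF S_linear S_norm S_semigroup S_continuous S_gen[OF x] t]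
  have "to_state (S t x) \<in> opdom AA"
    by (rule generator_limit(2)[OF to_state_in to_state_in]) (rule deriv_transfer[THEN iffD2, OF orb])
  then show D: "S t x \<in> gen_dom" by (simp add: opdom_iff)
  show "gen (S t x) = S t (gen x)" by (rule tendsto_unique[OF _ S_gen[OF D] orb]) simp
qed

lemma S_deriv: "x \<in> gen_dom \<Longrightarrow> 0 \<le> t \<Longrightarrow> ((\<lambda>t. S t x) has_vector_derivative S t (gen x)) (at t within {0..})"
  by (rule semigroup_orbit(2)[of S, OF S_linear S_norm S_semigroup S_continuous S_gen])

lemma S_flow: assumes x: "x \<in> gen_dom" shows "is_flow (chain_at \<mu>) (\<lambda>t. block \<mu> (S t x))"
  unfolding is_flow_def
proof (intro allI impI)
  fix t :: real assume t: "t \<ge> 0"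
  have "block \<mu> (S t (gen x)) = chain_at \<mu> (block \<mu> (S t x))" using S_gen_dom[OF x t] block_gen by metis
  then show "((\<lambda>t. block \<mu> (S t x)) has_vector_derivative chain_at \<mu> (block \<mu> (S t x))) (at t within {0..})"
    using bounded_linear.has_vector_derivative[OF block_linear S_deriv[OF x t], of \<mu>] by simp
qed

text \<open>
  Vectors in a single block belong to the domain of the generator; they provide the test solutions.
\<close>

lemma block_vector_ex: assumes "y \<in> block_space \<mu>" shows "\<exists>x\<in>gen_dom. \<forall>\<nu>. block \<nu> x = (if \<nu> = \<mu> then y else 0)"
proof -
  have z: "(if \<nu> = \<mu> then y else 0) \<in> block_space \<nu>" for \<nu> using assms E_closed_ops(1) by (auto simp: block_space_def zero_prod_def)
  have fin: "(\<lambda>\<nu>. if \<nu> = \<mu> then c else 0) summable_on UNIV" for c :: real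
  proof -
    have "(\<lambda>\<nu>. if \<nu> = \<mu> then c else 0) summable_on {\<mu>}" by simp
    then show ?thesis by (rule summable_on_cong_neutral[THEN iffD1, rotated -1]) auto
  qed
  have "(\<lambda>\<nu>. (norm (if \<nu> = \<mu> then y else 0))\<^sup>2) = (\<lambda>\<nu>. if \<nu> = \<mu> then (norm y)\<^sup>2 else 0)" by auto
  then obtain x where x: "\<And>\<nu>. block \<nu> x = (if \<nu> = \<mu> then y else 0)"
    using block_expansion_ex[of "\<lambda>\<nu>. if \<nu> = \<mu> then y else 0"] z fin by auto
  have "(\<lambda>\<nu>. (norm (chain_at \<nu> (block \<nu> x)))\<^sup>2) = (\<lambda>\<nu>. if \<nu> = \<mu> then (norm (chain_at \<mu> y))\<^sup>2 else 0)"
    by (auto simp: x linear_0[OF linear_chain])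
  then have "x \<in> gen_dom" using fin by (simp add: gen_dom_def)
  then show ?thesis using x by blast
qed

text \<open>
  The given semigroup also solves the initial value problem in each block, with any initial value.
\<close>

lemma flow_ex: assumes "y \<in> block_space \<mu>" shows "\<exists>g. is_flow (chain_at \<mu>) g \<and> g 0 = y"
proof -
  obtain x where "x \<in> gen_dom" "block \<mu> x = y" using block_vector_ex[OF assms] by auto
  then show ?thesis using S_flow[of x \<mu>] S_0 by (intro exI[of _ "\<lambda>t. block \<mu> (S t x)"]) simp
qed

lemma T_gen: assumes "x \<in> gen_dom" "0 \<le> t"
  shows "NN (T t (opfun AA (to_state x))) = norm (gen (S t x))"
  using assms by (simp add: opfun_eq to_state_S[symmetric] to_state_norm S_gen_dom)

end

context thermo begin

section \<open>The resolvent of the system\<close>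

definition resolv :: "real \<Rightarrow> 'h state \<Rightarrow> 'h state" where
  "resolv l x = (SOME y. \<forall>\<mu>. l *\<^sub>R block \<mu> y - chain_at \<mu> (block \<mu> y) = block \<mu> x)"

lemma resolv: assumes l: "l > 0" shows "l *\<^sub>R block \<mu> (resolv l x) - chain_at \<mu> (block \<mu> (resolv l x)) = block \<mu> x"
proof -
  have "\<exists>y. y \<in> block_space \<mu> \<and> l *\<^sub>R y - chain_at \<mu> y = block \<mu> x \<and> norm y \<le> norm (block \<mu> x) / l" for \<mu>
  proof (cases "mu_min \<le> \<mu>")
    case True
    then interpret damped_chain "om \<mu>" "ka \<mu>" "nu \<mu>" de K_unif by (rule blocks)
    obtain y0 where y0: "l *\<^sub>R y0 - M y0 = block \<mu> x" using resolvent_ex[OF l] by blast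
    have "block \<mu> (l *\<^sub>R y0 - M y0) = block \<mu> x" unfolding y0 by (rule block_same[OF block_in])
    then have "l *\<^sub>R block \<mu> y0 - M (block \<mu> y0) = block \<mu> x"
      by (simp add: linear_diff[OF bounded_linear.linear[OF block_linear]] linear_scale[OF bounded_linear.linear[OF block_linear]] block_chain)
    then show ?thesis using resolvent_norm(1)[OF l] block_in by blast
  next
    case False
    then have "block \<mu> x = 0" by (rule block_off_spectrum)
    then show ?thesis using block_in[of \<mu> x] linear_0[OF linear_chain] by (intro exI[of _ 0]) simp
  qed
  then have "\<exists>z. \<forall>\<mu>. z \<mu> \<in> block_space \<mu> \<and> l *\<^sub>R z \<mu> - chain_at \<mu> (z \<mu>) = block \<mu> x \<and> norm (z \<mu>) \<le> norm (block \<mu> x) / l"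
    by (intro choice allI)
  then obtain z where z: "\<And>\<mu>. z \<mu> \<in> block_space \<mu>" "\<And>\<mu>. l *\<^sub>R z \<mu> - chain_at \<mu> (z \<mu>) = block \<mu> x" "\<And>\<mu>. norm (z \<mu>) \<le> norm (block \<mu> x) / l" by blast
  have "(\<lambda>\<mu>. (norm (z \<mu>))\<^sup>2) summable_on UNIV"
  proof (rule summable_mono[OF has_sum_imp_summable[OF block_parseval[of x]] zero_le_power2])
    show "(norm (z \<mu>))\<^sup>2 \<le> (1 / l)\<^sup>2 * (norm (block \<mu> x))\<^sup>2" for \<mu>
      using z(3)[of \<mu>] l by (intro norm_sq_le) auto
  qed
  then obtain y where "\<And>\<mu>. block \<mu> y = z \<mu>" using block_expansion_ex[of z] z(1) by blast
  then have "\<exists>y. \<forall>\<mu>. l *\<^sub>R block \<mu> y - chain_at \<mu> (block \<mu> y) = block \<mu> x" using z(2) by (intro exI[of _ y]) simp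
  from someI_ex[OF this] show ?thesis by (simp add: resolv_def)
qed

lemma resolv_block_norms: assumes l: "l > 0"
  shows "norm (block \<mu> (resolv l x)) \<le> norm (block \<mu> x) / l" "norm (chain_at \<mu> (block \<mu> (resolv l x))) \<le> 2 * norm (block \<mu> x)"
proof -
  have "norm (block \<mu> (resolv l x)) \<le> norm (block \<mu> x) / l \<and> norm (chain_at \<mu> (block \<mu> (resolv l x))) \<le> 2 * norm (block \<mu> x)"
  proof (cases "mu_min \<le> \<mu>")
    case True
    then interpret damped_chain "om \<mu>" "ka \<mu>" "nu \<mu>" de K_unif by (rule blocks)
    show ?thesis using resolvent_norm[OF l resolv[OF l]] by blast
  qed (simp add: block_off_spectrum linear_0[OF linear_chain])
  then show "norm (block \<mu> (resolv l x)) \<le> norm (block \<mu> x) / l" "norm (chain_at \<mu> (block \<mu> (resolv l x))) \<le> 2 * norm (block \<mu> x)" by auto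
qed

lemma resolv_unique: assumes l: "l > 0" and y: "\<And>\<mu>. l *\<^sub>R block \<mu> y - chain_at \<mu> (block \<mu> y) = block \<mu> x" shows "resolv l x = y"
proof (rule block_ext)
  fix \<mu>
  show "block \<mu> (resolv l x) = block \<mu> y"
  proof (cases "mu_min \<le> \<mu>")
    case True
    then interpret damped_chain "om \<mu>" "ka \<mu>" "nu \<mu>" de K_unif by (rule blocks)
    have "l *\<^sub>R (block \<mu> (resolv l x) - block \<mu> y) - M (block \<mu> (resolv l x) - block \<mu> y) = (l *\<^sub>R block \<mu> (resolv l x) - M (block \<mu> (resolv l x))) - (l *\<^sub>R block \<mu> y - M (block \<mu> y))"
      by (simp add: linear_diff[OF linear_chain] scaleR_right_diff_distrib)
    also have "\<dots> = 0" using resolv[OF l, of \<mu> x] y by simp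
    finally have "norm (block \<mu> (resolv l x) - block \<mu> y) \<le> norm (0 :: 'h state) / l" by (rule resolvent_norm(1)[OF l])
    then show ?thesis by simp
  qed (simp add: block_off_spectrum)
qed

lemma block_ops: "block \<mu> (x + y) = block \<mu> x + block \<mu> y" "block \<mu> (x - y) = block \<mu> x - block \<mu> y" "block \<mu> (c *\<^sub>R x) = c *\<^sub>R block \<mu> x"
  using bounded_linear.linear[OF block_linear] by (auto simp: linear_add linear_diff linear_scale)

lemma chain_at_ops: "chain_at \<mu> (x + y) = chain_at \<mu> x + chain_at \<mu> y" "chain_at \<mu> (x - y) = chain_at \<mu> x - chain_at \<mu> y" "chain_at \<mu> (c *\<^sub>R x) = c *\<^sub>R chain_at \<mu> x"
  by (rule linear_add[OF linear_chain] linear_diff[OF linear_chain] linear_scale[OF linear_chain])+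

lemma resolv_norm: "l > 0 \<Longrightarrow> norm (resolv l x) \<le> norm x / l"
  using block_norm_le_blockwise[of "1 / l" "resolv l x" x] resolv_block_norms(1)[of l] by simp

lemma resolv_linear: assumes l: "l > 0" shows "bounded_linear (resolv l)"
proof (rule bounded_linear_intro)
  show "resolv l (x + y) = resolv l x + resolv l y" for x y
  proof (rule resolv_unique[OF l])
    fix \<mu>
    have "l *\<^sub>R block \<mu> (resolv l x + resolv l y) - chain_at \<mu> (block \<mu> (resolv l x + resolv l y)) =
      (l *\<^sub>R block \<mu> (resolv l x) - chain_at \<mu> (block \<mu> (resolv l x))) + (l *\<^sub>R block \<mu> (resolv l y) - chain_at \<mu> (block \<mu> (resolv l y)))"
      by (simp add: block_ops chain_at_ops algebra_simps)
    then show "l *\<^sub>R block \<mu> (resolv l x + resolv l y) - chain_at \<mu> (block \<mu> (resolv l x + resolv l y)) = block \<mu> (x + y)"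
      unfolding resolv[OF l] block_ops .
  qed
  show "resolv l (c *\<^sub>R x) = c *\<^sub>R resolv l x" for c x
  proof (rule resolv_unique[OF l])
    fix \<mu>
    have "l *\<^sub>R block \<mu> (c *\<^sub>R resolv l x) - chain_at \<mu> (block \<mu> (c *\<^sub>R resolv l x)) = c *\<^sub>R (l *\<^sub>R block \<mu> (resolv l x) - chain_at \<mu> (block \<mu> (resolv l x)))"
      by (simp add: block_ops chain_at_ops algebra_simps)
    then show "l *\<^sub>R block \<mu> (c *\<^sub>R resolv l x) - chain_at \<mu> (block \<mu> (c *\<^sub>R resolv l x)) = block \<mu> (c *\<^sub>R x)"
      unfolding resolv[OF l] block_ops .
  qed
  show "norm (resolv l x) \<le> norm x * (1 / l)" for x using resolv_norm[OF l] by simp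
qed

lemma resolv_ops: "l > 0 \<Longrightarrow> resolv l (x + y) = resolv l x + resolv l y" "l > 0 \<Longrightarrow> resolv l (x - y) = resolv l x - resolv l y" "l > 0 \<Longrightarrow> resolv l (c *\<^sub>R x) = c *\<^sub>R resolv l x"
  using bounded_linear.linear[OF resolv_linear] by (auto simp: linear_add linear_diff linear_scale)

lemma resolv_gen_dom: assumes l: "l > 0" shows "resolv l x \<in> gen_dom" "gen (resolv l x) = l *\<^sub>R resolv l x - x"
proof -
  show D: "resolv l x \<in> gen_dom" unfolding gen_dom_def mem_Collect_eq
    by (rule summable_mono[OF has_sum_imp_summable[OF block_parseval[of x]] zero_le_power2, of _ "2\<^sup>2"])
       (rule norm_sq_le[OF _ resolv_block_norms(2)[OF l]], simp)
  show "gen (resolv l x) = l *\<^sub>R resolv l x - x"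
  proof (rule block_ext)
    fix \<mu>
    have "block \<mu> x = l *\<^sub>R block \<mu> (resolv l x) - chain_at \<mu> (block \<mu> (resolv l x))" by (rule resolv[OF l, symmetric])
    then show "block \<mu> (gen (resolv l x)) = block \<mu> (l *\<^sub>R resolv l x - x)" by (simp add: block_gen[OF D] block_ops)
  qed
qed

lemma resolv_identity: assumes "l > 0" "k > 0" shows "resolv k x - resolv l x = (l - k) *\<^sub>R resolv k (resolv l x)"
proof -
  have "resolv k x = resolv l x + (l - k) *\<^sub>R resolv k (resolv l x)"
  proof (rule resolv_unique[OF assms(2)])
    fix \<mu>
    have "k *\<^sub>R block \<mu> (resolv l x + (l - k) *\<^sub>R resolv k (resolv l x)) - chain_at \<mu> (block \<mu> (resolv l x + (l - k) *\<^sub>R resolv k (resolv l x)))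
       = k *\<^sub>R block \<mu> (resolv l x) - chain_at \<mu> (block \<mu> (resolv l x)) + (l - k) *\<^sub>R (k *\<^sub>R block \<mu> (resolv k (resolv l x)) - chain_at \<mu> (block \<mu> (resolv k (resolv l x))))"
      by (simp add: block_ops chain_at_ops algebra_simps)
    also have "\<dots> = l *\<^sub>R block \<mu> (resolv l x) - chain_at \<mu> (block \<mu> (resolv l x))" unfolding resolv[OF assms(2)] by (simp add: algebra_simps)
    also have "\<dots> = block \<mu> x" by (rule resolv[OF assms(1)])
    finally show "k *\<^sub>R block \<mu> (resolv l x + (l - k) *\<^sub>R resolv k (resolv l x)) - chain_at \<mu> (block \<mu> (resolv l x + (l - k) *\<^sub>R resolv k (resolv l x))) = block \<mu> x" .
  qed
  then show ?thesis by simp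
qed

text \<open>
  The resolvent identity, used twice, gives the second-order remainder
  \<open>(k - l)\<^sup>2 R(k) R(l)\<^sup>2\<close>. The derivative is taken in the operator norm so that the product rule
  applies to powers.
\<close>

lemma resolv_deriv: assumes l: "l > 0"
  shows "((\<lambda>l. Blinfun (resolv l)) has_vector_derivative - (Blinfun (resolv l) o\<^sub>L Blinfun (resolv l))) (at l)"
  unfolding has_vector_derivative_def has_derivative_at_alt
proof (intro conjI allI impI bounded_linear_scaleR_left)
  fix e :: real assume e: "e > 0"
  have ap: "blinfun_apply (Blinfun (resolv k)) = resolv k" if "k > 0" for k by (rule bounded_linear_Blinfun_apply[OF resolv_linear[OF that]])
  define d where "d = min (l / 2) (e * l ^ 3 / 2)"
  have "norm (Blinfun (resolv k) - Blinfun (resolv l) - (k - l) *\<^sub>R - (Blinfun (resolv l) o\<^sub>L Blinfun (resolv l))) \<le> e * norm (k - l)"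
    if k: "norm (k - l) < d" for k
  proof -
    have "\<bar>k - l\<bar> < l / 2" using k by (simp add: d_def)
    then have k0: "k \<ge> l / 2" "k > 0" using l by arith+
    have "norm (Blinfun (resolv k) - Blinfun (resolv l) - (k - l) *\<^sub>R - (Blinfun (resolv l) o\<^sub>L Blinfun (resolv l))) \<le> \<bar>k - l\<bar> * \<bar>k - l\<bar> * (2 / l ^ 3)"
    proof (rule norm_blinfun_bound)
      fix x
      have "blinfun_apply (Blinfun (resolv k) - Blinfun (resolv l) - (k - l) *\<^sub>R - (Blinfun (resolv l) o\<^sub>L Blinfun (resolv l))) x
         = (resolv k x - resolv l x) + (k - l) *\<^sub>R resolv l (resolv l x)"
        using ap[OF l] ap[OF k0(2)] by (simp add: blinfun.bilinear_simps)
      also have "\<dots> = (l - k) *\<^sub>R (resolv k (resolv l x) - resolv l (resolv l x))"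
        unfolding resolv_identity[OF l k0(2), of x] by (simp add: algebra_simps)
      also have "\<dots> = ((l - k) * (l - k)) *\<^sub>R resolv k (resolv l (resolv l x))" unfolding resolv_identity[OF l k0(2), of "resolv l x"] by simp
      finally have eq: "blinfun_apply (Blinfun (resolv k) - Blinfun (resolv l) - (k - l) *\<^sub>R - (Blinfun (resolv l) o\<^sub>L Blinfun (resolv l))) x
         = ((l - k) * (l - k)) *\<^sub>R resolv k (resolv l (resolv l x))" .
      have "norm (resolv k (resolv l (resolv l x))) \<le> norm (resolv l (resolv l x)) / k" by (rule resolv_norm[OF k0(2)])
      also have "\<dots> \<le> norm (resolv l (resolv l x)) / (l / 2)" using k0 l by (intro divide_left_mono) auto
      also have "\<dots> \<le> ((norm x / l) / l) / (l / 2)"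
      proof (rule divide_right_mono)
        have "norm (resolv l (resolv l x)) \<le> norm (resolv l x) / l" by (rule resolv_norm[OF l])
        also have "\<dots> \<le> (norm x / l) / l" using l by (intro divide_right_mono resolv_norm) auto
        finally show "norm (resolv l (resolv l x)) \<le> (norm x / l) / l" .
      qed (use l in simp)
      also have "\<dots> = 2 / l ^ 3 * norm x" by (simp add: power3_eq_cube)
      finally have "norm (resolv k (resolv l (resolv l x))) \<le> 2 / l ^ 3 * norm x" .
      then show "norm (blinfun_apply (Blinfun (resolv k) - Blinfun (resolv l) - (k - l) *\<^sub>R - (Blinfun (resolv l) o\<^sub>L Blinfun (resolv l))) x)
         \<le> \<bar>k - l\<bar> * \<bar>k - l\<bar> * (2 / l ^ 3) * norm x"
      proof -
        have "norm (((l - k) * (l - k)) *\<^sub>R resolv k (resolv l (resolv l x))) = \<bar>k - l\<bar> * \<bar>k - l\<bar> * norm (resolv k (resolv l (resolv l x)))"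
          by (simp only: norm_scaleR abs_mult abs_minus_commute)
        also have "\<dots> \<le> \<bar>k - l\<bar> * \<bar>k - l\<bar> * (2 / l ^ 3 * norm x)"
          using \<open>norm (resolv k (resolv l (resolv l x))) \<le> 2 / l ^ 3 * norm x\<close> by (intro mult_left_mono) auto
        finally show ?thesis unfolding eq by (simp only: mult.assoc)
      qed
    qed (use l in simp)
    also have "\<dots> \<le> \<bar>k - l\<bar> * (e * l ^ 3 / 2) * (2 / l ^ 3)"
      using k l by (intro mult_right_mono mult_left_mono) (auto simp: d_def)
    also have "\<dots> = e * norm (k - l)" using l by simp
    finally show ?thesis .
  qed
  moreover have "d > 0" using e l by (simp add: d_def)
  ultimately show "\<exists>d>0. \<forall>k. norm (k - l) < d \<longrightarrow>
      norm (Blinfun (resolv k) - Blinfun (resolv l) - (k - l) *\<^sub>R - (Blinfun (resolv l) o\<^sub>L Blinfun (resolv l))) \<le> e * norm (k - l)" by blast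
qed

lemma resolv_pow_deriv: "l > 0 \<Longrightarrow> ((\<lambda>l. (resolv l ^^ n) x) has_vector_derivative - real n *\<^sub>R (resolv l ^^ Suc n) x) (at l)"
proof (induction n)
  case (Suc n)
  have ap: "blinfun_apply (Blinfun (resolv k)) = resolv k" if "k > 0" for k by (rule bounded_linear_Blinfun_apply[OF resolv_linear[OF that]])
  have "((\<lambda>k. blinfun_apply (Blinfun (resolv k)) ((resolv k ^^ n) x)) has_vector_derivative
     blinfun_apply (Blinfun (resolv l)) (- real n *\<^sub>R (resolv l ^^ Suc n) x) + blinfun_apply (- (Blinfun (resolv l) o\<^sub>L Blinfun (resolv l))) ((resolv l ^^ n) x)) (at l)"
    by (rule bounded_bilinear.has_vector_derivative[OF bounded_bilinear_blinfun_apply resolv_deriv[OF Suc(2)] Suc(1)[OF Suc(2)]])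
  also have "blinfun_apply (Blinfun (resolv l)) (- real n *\<^sub>R (resolv l ^^ Suc n) x) + blinfun_apply (- (Blinfun (resolv l) o\<^sub>L Blinfun (resolv l))) ((resolv l ^^ n) x)
     = - real (Suc n) *\<^sub>R (resolv l ^^ Suc (Suc n)) x"
  proof -
    have m: "resolv l (- y) = - resolv l y" for y using resolv_ops(3)[OF Suc(2), of "-1" y] by simp
    show ?thesis using Suc(2) by (simp add: ap blinfun.bilinear_simps resolv_ops m algebra_simps)
  qed
  finally have "((\<lambda>k. blinfun_apply (Blinfun (resolv k)) ((resolv k ^^ n) x)) has_vector_derivative - real (Suc n) *\<^sub>R (resolv l ^^ Suc (Suc n)) x) (at l)" .
  then show ?case
    by (rule has_vector_derivative_transform_within_open[of _ _ _ "{0<..}"]) (use Suc(2) in \<open>auto simp: ap\<close>)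
qed simp

lemma resolv_pow_block_norm: "l > 0 \<Longrightarrow> norm (block \<mu> ((resolv l ^^ n) x)) \<le> norm (block \<mu> x) / l ^ n"
proof (induction n)
  case (Suc n)
  have "norm (block \<mu> ((resolv l ^^ Suc n) x)) \<le> norm (block \<mu> ((resolv l ^^ n) x)) / l" using resolv_block_norms(1)[OF Suc(2)] by simp
  also have "\<dots> \<le> norm (block \<mu> x) / l ^ n / l" using Suc by (intro divide_right_mono) auto
  finally show ?case by (simp add: mult.commute)
qed simp

lemma resolv_pow_norm: "l > 0 \<Longrightarrow> norm ((resolv l ^^ n) x) \<le> norm x / l ^ n"
  using block_norm_le_blockwise[of "1 / l ^ n" "(resolv l ^^ n) x" x] resolv_pow_block_norm[of l] by simp

text \<open>
  \<open>l + (I - \<A>)\<close> is \<open>(l + 1) - \<A>\<close>, which explains the shift by one in everything below.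
\<close>

lemma Res_eq: assumes l: "l \<ge> 0"
  shows "inv_into (opdom (I_minus AA)) (\<lambda>V. l *\<^sub>R V + opfun (I_minus AA) V) (to_state x) = to_state (resolv (l + 1) x)"
proof -
  define G where "G = (\<lambda>V. l *\<^sub>R V + opfun (I_minus AA) V)"
  have G: "G (to_state y) = to_state ((l + 1) *\<^sub>R y - gen y)" if "y \<in> gen_dom" for y
    using that by (simp add: G_def I_minus_def opfun_eq to_state_ops algebra_simps)
  have l1: "l + 1 > 0" using l by simp
  have inj: "inj_on G (opdom (I_minus AA))"
  proof (rule inj_onI)
    fix U V assume UV: "U \<in> opdom (I_minus AA)" "V \<in> opdom (I_minus AA)" "G U = G V"
    then have UX: "U \<in> XX" "V \<in> XX" by (auto simp: I_minus_def system_op_def)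
    obtain y z where yz: "U = to_state y" "V = to_state z" using to_state_surj[OF UX(1)] to_state_surj[OF UX(2)] by blast
    then have D: "y \<in> gen_dom" "z \<in> gen_dom" using UV by (auto simp: I_minus_def opdom_iff)
    have "(l + 1) *\<^sub>R y - gen y = (l + 1) *\<^sub>R z - gen z" using UV(3) to_state_inj unfolding yz G[OF D(1)] G[OF D(2)] by (simp add: inj_eq)
    then have e: "block \<mu> ((l + 1) *\<^sub>R y - gen y) = block \<mu> ((l + 1) *\<^sub>R z - gen z)" for \<mu> by simp
    have "resolv (l + 1) ((l + 1) *\<^sub>R y - gen y) = y" by (rule resolv_unique[OF l1]) (simp add: block_ops block_gen[OF D(1)])
    moreover have "resolv (l + 1) ((l + 1) *\<^sub>R y - gen y) = z" by (rule resolv_unique[OF l1]) (simp add: e, simp add: block_ops block_gen[OF D(2)])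
    ultimately show "U = V" by (simp add: yz)
  qed
  have "to_state (resolv (l + 1) x) \<in> opdom (I_minus AA)" using resolv_gen_dom(1)[OF l1] by (simp add: I_minus_def opdom_iff)
  moreover have "G (to_state (resolv (l + 1) x)) = to_state x" using G[OF resolv_gen_dom(1)[OF l1]] resolv_gen_dom(2)[OF l1] by simp
  ultimately show ?thesis unfolding G_def[symmetric] using inv_into_f_f[OF inj] by metis
qed

lemma Res_pow_eq: assumes l: "l \<ge> 0"
  shows "(inv_into (opdom (I_minus AA)) (\<lambda>V. l *\<^sub>R V + opfun (I_minus AA) V) ^^ n) (to_state x) = to_state ((resolv (l + 1) ^^ n) x)"
  by (induction n) (simp_all add: Res_eq[OF l])

end

section \<open>Balakrishnan integrals\<close>

lemma integral_powr_bound: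
  fixes f :: "real \<Rightarrow> 'b::banach"
  assumes "0 < a" "a \<le> b" "f integrable_on {a..b}" "\<And>l. l \<in> {a..b} \<Longrightarrow> norm (f l) \<le> C * l powr p" "p \<noteq> -1"
  shows "norm (integral {a..b} f) \<le> C * ((b powr (p + 1) - a powr (p + 1)) / (p + 1))"
proof -
  have hi: "((\<lambda>l. C * l powr p) has_integral (C * (b powr (p + 1) / (p + 1)) - C * (a powr (p + 1) / (p + 1)))) {a..b}"
  proof (rule fundamental_theorem_of_calculus[OF assms(2)])
    fix l assume l: "l \<in> {a..b}"
    have "((\<lambda>l. C * (l powr (p + 1) / (p + 1))) has_real_derivative C * l powr p) (at l within {a..b})"
      using l assms(1,5) by (auto intro!: derivative_eq_intros)
    then show "((\<lambda>l. C * (l powr (p + 1) / (p + 1))) has_vector_derivative C * l powr p) (at l within {a..b})"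
      by (simp add: has_real_derivative_iff_has_vector_derivative)
  qed
  have "norm (integral {a..b} f) \<le> integral {a..b} (\<lambda>l. C * l powr p)"
    by (rule integral_norm_bound_integral[OF assms(3) has_integral_integrable[OF hi] assms(4)])
  also have "\<dots> = C * (b powr (p + 1) / (p + 1)) - C * (a powr (p + 1) / (p + 1))" by (rule integral_unique[OF hi])
  also have "\<dots> = C * ((b powr (p + 1) - a powr (p + 1)) / (p + 1))" by (simp only: right_diff_distrib diff_divide_distrib)
  finally show ?thesis .
qed

lemma integral_powr_bound_low:
  fixes f :: "real \<Rightarrow> 'b::banach"
  assumes "0 < a" "a \<le> b" "f integrable_on {a..b}" "\<And>l. l \<in> {a..b} \<Longrightarrow> norm (f l) \<le> C * l powr p" "p > -1" "C \<ge> 0"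
  shows "norm (integral {a..b} f) \<le> C * (b powr (p + 1) / (p + 1))"
proof -
  have "C * ((b powr (p + 1) - a powr (p + 1)) / (p + 1)) \<le> C * (b powr (p + 1) / (p + 1))"
    using assms by (intro mult_left_mono divide_right_mono) auto
  then show ?thesis using integral_powr_bound[OF assms(1-4)] assms(5) by simp
qed

lemma integral_powr_bound_high:
  fixes f :: "real \<Rightarrow> 'b::banach"
  assumes "0 < a" "a \<le> b" "f integrable_on {a..b}" "\<And>l. l \<in> {a..b} \<Longrightarrow> norm (f l) \<le> C * l powr p" "p < -1" "C \<ge> 0"
  shows "norm (integral {a..b} f) \<le> C * (a powr (p + 1) / (- (p + 1)))"
proof -
  have "(b powr (p + 1) - a powr (p + 1)) / (p + 1) = (a powr (p + 1) - b powr (p + 1)) / (- (p + 1))"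
    by (metis minus_diff_eq minus_divide_divide)
  also have "\<dots> \<le> a powr (p + 1) / (- (p + 1))" using assms by (intro divide_right_mono) auto
  finally have "C * ((b powr (p + 1) - a powr (p + 1)) / (p + 1)) \<le> C * (a powr (p + 1) / (- (p + 1)))"
    using assms by (intro mult_left_mono) auto
  then show ?thesis using integral_powr_bound[OF assms(1-4)] assms(5) by simp
qed

text \<open>
  The bound \<open>C l^p\<close> is integrable at \<open>0\<close> and \<open>C' l^p'\<close> at infinity; the splitting point \<open>k\<close> is free.
\<close>

lemma integral_powr_two_scale:
  fixes f :: "real \<Rightarrow> 'b::banach"
  assumes "0 < a" "a \<le> k" "k \<le> b" "f integrable_on {a..b}"
    and "\<And>l. l \<in> {a..k} \<Longrightarrow> norm (f l) \<le> C * l powr p" "p > -1" "C \<ge> 0"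
    and "\<And>l. l \<in> {k..b} \<Longrightarrow> norm (f l) \<le> C' * l powr p'" "p' < -1" "C' \<ge> 0"
  shows "norm (integral {a..b} f) \<le> C * (k powr (p + 1) / (p + 1)) + C' * (k powr (p' + 1) / (- (p' + 1)))"
proof -
  have i: "f integrable_on {a..k}" "f integrable_on {k..b}"
    using assms(2,3) by (auto intro: integrable_subinterval_real[OF assms(4)])
  have "integral {a..b} f = integral {a..k} f + integral {k..b} f"
    using Henstock_Kurzweil_Integration.integral_combine[OF assms(2-4)] by simp
  then have "norm (integral {a..b} f) \<le> norm (integral {a..k} f) + norm (integral {k..b} f)"
    by (simp add: norm_triangle_ineq)
  also have "\<dots> \<le> C * (k powr (p + 1) / (p + 1)) + C' * (k powr (p' + 1) / (- (p' + 1)))"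
    using assms i by (intro add_mono integral_powr_bound_low integral_powr_bound_high) auto
  finally show ?thesis .
qed

context thermo begin

definition integrand :: "real \<Rightarrow> nat \<Rightarrow> 'h state \<Rightarrow> real \<Rightarrow> 'h state" where
  "integrand s n x l = l powr (real n - s - 1) *\<^sub>R (resolv (l + 1) ^^ n) x"

lemma resolv_pow_continuous: "continuous_on {0<..} (\<lambda>l. (resolv l ^^ n) x)"
  by (auto simp: continuous_on_eq_continuous_at intro!: has_vector_derivative_continuous[OF resolv_pow_deriv])

lemma integrand_integrable: "0 < a \<Longrightarrow> integrand s n x integrable_on {a..b}"
proof (rule integrable_continuous_real)
  assume a: "0 < a"
  have "continuous_on {a..b} (\<lambda>l. (resolv (l + 1) ^^ n) x)"
    by (rule continuous_on_compose2[OF resolv_pow_continuous]) (use a in \<open>auto intro!: continuous_intros\<close>)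
  then show "continuous_on {a..b} (integrand s n x)" unfolding integrand_def using a by (auto intro!: continuous_intros)
qed

text \<open>
  The integer \<open>n > s\<close> in Balakrishnan's formula for the exponent \<open>- s\<close>.
\<close>

definition bal_order :: "real \<Rightarrow> nat" where "bal_order s = nat \<lfloor>s\<rfloor> + 1"

lemma bal_order_bounds: "s > 0 \<Longrightarrow> s < real (bal_order s)" "s > 0 \<Longrightarrow> real (bal_order s) \<le> s + 1" "s \<ge> 1 \<Longrightarrow> bal_order s \<ge> 2"
proof -
  show "s > 0 \<Longrightarrow> s < real (bal_order s)" "s > 0 \<Longrightarrow> real (bal_order s) \<le> s + 1" unfolding bal_order_def by (simp_all add: of_nat_nat) linarith+
  show "s \<ge> 1 \<Longrightarrow> bal_order s \<ge> 2" unfolding bal_order_def by (simp add: le_floor_iff le_nat_iff)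
qed

lemma integrand_bound:
  fixes Phi :: "'h state \<Rightarrow> 'h state"
  assumes l: "l > 0" and B: "norm (Phi ((resolv (l + 1) ^^ n) x)) \<le> B" and lin: "bounded_linear Phi"
  shows "norm (Phi (integrand s n x l)) \<le> B * l powr (real n - s - 1)"
proof -
  have "Phi (integrand s n x l) = l powr (real n - s - 1) *\<^sub>R Phi ((resolv (l + 1) ^^ n) x)"
    by (simp add: integrand_def linear_scale[OF bounded_linear.linear[OF lin]])
  then have "norm (Phi (integrand s n x l)) = norm (Phi ((resolv (l + 1) ^^ n) x)) * l powr (real n - s - 1)" by simp
  also have "\<dots> \<le> B * l powr (real n - s - 1)" by (rule mult_right_mono[OF B]) simp
  finally show ?thesis .
qed

lemma powr_times_power: "0 < l \<Longrightarrow> l powr (real n - s - 1) / l ^ j = l powr (real n - s - 1 - real j)"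
  by (simp add: powr_diff powr_realpow)

text \<open>
  The filter of the two end points of an improper integral over \<open>(0, \<infinity>)\<close>.
\<close>

abbreviation "improper \<equiv> at_right (0::real) \<times>\<^sub>F (at_top :: real filter)"

lemma improper_nontrivial: "improper \<noteq> bot"
  by (simp add: prod_filter_eq_bot)

lemma eventually_improper: "\<forall>\<^sub>F p in improper. (0 < fst p \<and> fst p \<le> a) \<and> b \<le> snd p" if "a > 0"
proof (rule eventually_prodI)
  show "\<forall>\<^sub>F x in at_right 0. 0 < x \<and> x \<le> a" unfolding eventually_at_right_field by (rule exI[of _ a]) (use that in auto)
qed (rule eventually_ge_at_top)

text \<open>
  The integrand is at most a constant times \<open>l^(n - s - 1)\<close> near \<open>0\<close> and \<open>l^(- s - 1)\<close> near infinity, since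
  the \<open>n\<close>-th power of the resolvent is bounded by both \<open>1\<close> and \<open>l^(-n)\<close>.
\<close>

lemma integrand_limit:
  assumes s: "s > 0"
  shows "\<exists>L. ((\<lambda>(\<epsilon>, R). integral {\<epsilon>..R} (integrand s (bal_order s) x)) \<longlongrightarrow> L) improper"
proof (rule tendsto_of_cauchy_net[OF improper_nontrivial])
  fix e :: real assume e: "e > 0"
  define n p where "n = bal_order s" "p = real n - s - 1"
  have n: "s < real n" "p > -1" using bal_order_bounds(1)[OF s] by (auto simp: n_p_def)
  have "((\<lambda>d. norm x * (d powr (p + 1) / (p + 1))) \<longlongrightarrow> norm x * (0 / (p + 1))) (at_right 0)"
  proof (intro tendsto_intros tendsto_zero_powrI[where b="p+1"])
    show "\<forall>\<^sub>F d :: real in at_right 0. 0 \<le> d" unfolding eventually_at_right_field by (rule exI[of _ 1]) auto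
  qed (use n in \<open>auto intro: tendsto_eq_intros\<close>)
  then have "\<forall>\<^sub>F d in at_right 0. norm x * (d powr (p + 1) / (p + 1)) < e / 4" using e by (intro order_tendstoD(2)) auto
  then obtain d0 where d0: "d0 > 0" "\<And>d. 0 < d \<Longrightarrow> d < d0 \<Longrightarrow> norm x * (d powr (p + 1) / (p + 1)) < e / 4"
    unfolding eventually_at_right_field by auto
  define d where "d = min 1 (d0 / 2)"
  have d: "0 < d" "d \<le> 1" "norm x * (d powr (p + 1) / (p + 1)) < e / 4" using d0(1) d0(2)[of d] by (auto simp: d_def)
  have "((\<lambda>r. norm x * (r powr (- s) / s)) \<longlongrightarrow> norm x * (0 / s)) at_top"
    using s by (intro tendsto_intros tendsto_neg_powr filterlim_ident) auto
  then have "\<forall>\<^sub>F r in at_top. norm x * (r powr (- s) / s) < e / 4" using e by (intro order_tendstoD(2)) auto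
  then obtain r0 where r0: "\<And>r. r \<ge> r0 \<Longrightarrow> norm x * (r powr (- s) / s) < e / 4" by (auto simp: eventually_at_top_linorder)
  define r where "r = max 1 r0"
  have r: "r \<ge> 1" "norm x * (r powr (- s) / s) < e / 4" using r0 by (auto simp: r_def)
  have bound: "norm (integrand s n x l) \<le> norm x * l powr p" "norm (integrand s n x l) \<le> norm x * l powr (- s - 1)" if l: "l > 0" for l
  proof -
    have f: "norm (integrand s n x l) \<le> norm x / (l + 1) ^ n * l powr p"
      unfolding n_p_def by (rule integrand_bound[where Phi="\<lambda>z. z", OF l resolv_pow_norm bounded_linear_ident]) (use l in simp)
    also have "\<dots> \<le> norm x / 1 * l powr p" using l by (intro mult_right_mono divide_left_mono) auto
    finally show "norm (integrand s n x l) \<le> norm x * l powr p" by simp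
    have "norm x / (l + 1) ^ n * l powr p \<le> norm x / l ^ n * l powr p" using l by (intro mult_right_mono divide_left_mono power_mono) auto
    also have "\<dots> = norm x * (l powr (real n - s - 1) / l ^ n)" by (simp add: n_p_def)
    also have "\<dots> = norm x * l powr (- s - 1)" unfolding powr_times_power[OF l] by simp
    finally show "norm (integrand s n x l) \<le> norm x * l powr (- s - 1)" using f by simp
  qed
  define I where "I = (\<lambda>a b. integral {a..b} (integrand s n x))"
  have near: "norm (I \<epsilon> R - I d r) < e / 2" if "0 < \<epsilon>" "\<epsilon> \<le> d" "r \<le> R" for \<epsilon> R
  proof -
    have int: "integrand s n x integrable_on {a..b}" if "0 < a" for a b by (rule integrand_integrable[OF that])
    have "I \<epsilon> d + I d R = I \<epsilon> R" unfolding I_def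
      by (rule Henstock_Kurzweil_Integration.integral_combine) (use that d r int in auto)
    moreover have "I d r + I r R = I d R" unfolding I_def
      by (rule Henstock_Kurzweil_Integration.integral_combine) (use that d r int in auto)
    ultimately have "I \<epsilon> R - I d r = I \<epsilon> d + I r R" by (simp add: algebra_simps)
    then have "norm (I \<epsilon> R - I d r) \<le> norm (I \<epsilon> d) + norm (I r R)" by (simp add: norm_triangle_ineq)
    also have "norm (I \<epsilon> d) \<le> norm x * (d powr (p + 1) / (p + 1))" unfolding I_def
      by (rule integral_powr_bound_low[OF that(1,2) int]) (use that bound n in auto)
    also have "norm (I r R) \<le> norm x * (r powr (- s - 1 + 1) / (- (- s - 1 + 1)))" unfolding I_def
      by (rule integral_powr_bound_high) (use that bound(2) s r int in auto)
    also have "\<dots> = norm x * (r powr (- s) / s)" by simp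
    finally show ?thesis using d(3) r(2) by linarith
  qed
  define PP where "PP = (\<lambda>(\<epsilon>, R). (0 < \<epsilon> \<and> \<epsilon> \<le> d) \<and> r \<le> (R::real))"
  have "eventually PP improper" unfolding PP_def
    by (rule eventually_mono[OF eventually_improper[OF d(1), of r]]) auto
  moreover have "dist (case y of (\<epsilon>, R) \<Rightarrow> integral {\<epsilon>..R} (integrand s n x)) (case z of (\<epsilon>, R) \<Rightarrow> integral {\<epsilon>..R} (integrand s n x)) < e"
    if "PP y" "PP z" for y z
  proof -
    obtain \<epsilon>1 R1 \<epsilon>2 R2 where yz: "y = (\<epsilon>1, R1)" "z = (\<epsilon>2, R2)" by (cases y; cases z) auto
    have "norm (I \<epsilon>1 R1 - I d r) < e / 2" "norm (I \<epsilon>2 R2 - I d r) < e / 2" using that near by (auto simp: PP_def yz)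
    moreover have "I \<epsilon>1 R1 - I \<epsilon>2 R2 = (I \<epsilon>1 R1 - I d r) - (I \<epsilon>2 R2 - I d r)" by simp
    then have "norm (I \<epsilon>1 R1 - I \<epsilon>2 R2) \<le> norm (I \<epsilon>1 R1 - I d r) + norm (I \<epsilon>2 R2 - I d r)" using norm_triangle_ineq4 by metis
    ultimately show ?thesis by (simp add: yz I_def dist_norm)
  qed
  ultimately show "\<exists>P. eventually P improper \<and> (\<forall>y z. P y \<and> P z \<longrightarrow>
      dist (case y of (\<epsilon>, R) \<Rightarrow> integral {\<epsilon>..R} (integrand s (bal_order s) x)) (case z of (\<epsilon>, R) \<Rightarrow> integral {\<epsilon>..R} (integrand s (bal_order s) x)) < e)"
    unfolding n_p_def by blast
qed

definition bal_limit :: "real \<Rightarrow> 'h state \<Rightarrow> 'h state" where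
  "bal_limit s x = (SOME L. ((\<lambda>(\<epsilon>, R). integral {\<epsilon>..R} (integrand s (bal_order s) x)) \<longlongrightarrow> L) improper)"

lemma bal_limit: "s > 0 \<Longrightarrow> ((\<lambda>(\<epsilon>, R). integral {\<epsilon>..R} (integrand s (bal_order s) x)) \<longlongrightarrow> bal_limit s x) improper"
  unfolding bal_limit_def by (rule someI_ex[OF integrand_limit])

definition "bal_const s = Gamma (real (bal_order s)) / (Gamma s * Gamma (real (bal_order s) - s))"

text \<open>
  \<open>(I - \<A>)^(-s)\<close> in normalised coordinates.
\<close>

definition neg_pow :: "real \<Rightarrow> 'h state \<Rightarrow> 'h state" where "neg_pow s x = bal_const s *\<^sub>R bal_limit s x"

lemma neg_power_eq:
  assumes s: "s > 0"
  shows "neg_power XX NN (I_minus AA) s (to_state x) = to_state (neg_pow s x)"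
proof -
  define Res where "Res = (\<lambda>l. inv_into (opdom (I_minus AA)) (\<lambda>V. l *\<^sub>R V + opfun (I_minus AA) V))"
  define I where "I = (\<lambda>\<epsilon> R. integral {\<epsilon>..R} (integrand s (bal_order s) x))"
  define J where "J = (\<lambda>\<epsilon> R. bal_const s *\<^sub>R integral {\<epsilon>..R} (\<lambda>l. l powr (real (bal_order s) - s - 1) *\<^sub>R (Res l ^^ bal_order s) (to_state x)))"
  have J: "J \<epsilon> R = to_state (bal_const s *\<^sub>R I \<epsilon> R)" if "0 < \<epsilon>" for \<epsilon> R
  proof -
    have "integral {\<epsilon>..R} (\<lambda>l. l powr (real (bal_order s) - s - 1) *\<^sub>R (Res l ^^ bal_order s) (to_state x)) = integral {\<epsilon>..R} (to_state \<circ> integrand s (bal_order s) x)"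
    proof (rule integral_cong)
      fix l assume "l \<in> {\<epsilon>..R}"
      then have "0 \<le> l" using that by simp
      then show "l powr (real (bal_order s) - s - 1) *\<^sub>R (Res l ^^ bal_order s) (to_state x) = (to_state \<circ> integrand s (bal_order s) x) l"
        by (simp add: Res_def Res_pow_eq integrand_def to_state_ops)
    qed
    also have "\<dots> = to_state (I \<epsilon> R)" unfolding I_def by (rule integral_linear[OF integrand_integrable[OF that] to_state_linear])
    finally show ?thesis by (simp add: J_def to_state_ops)
  qed
  have L: "((\<lambda>p. bal_const s *\<^sub>R I (fst p) (snd p)) \<longlongrightarrow> neg_pow s x) improper"
    using tendsto_scaleR[OF tendsto_const bal_limit[OF s, of x], of "bal_const s"] by (simp add: neg_pow_def I_def case_prod_unfold)
  have tr: "((\<lambda>(\<epsilon>, R). NN (J \<epsilon> R - to_state w)) \<longlongrightarrow> 0) improper \<longleftrightarrow> ((\<lambda>p. bal_const s *\<^sub>R I (fst p) (snd p)) \<longlongrightarrow> w) improper" for w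
  proof -
    have "\<forall>\<^sub>F p in improper. (case p of (\<epsilon>, R) \<Rightarrow> NN (J \<epsilon> R - to_state w)) = norm (bal_const s *\<^sub>R I (fst p) (snd p) - w)"
      by (rule eventually_mono[OF eventually_improper[of 1]]) (auto simp: J to_state_ops(2)[symmetric] to_state_norm)
    then have "((\<lambda>(\<epsilon>, R). NN (J \<epsilon> R - to_state w)) \<longlongrightarrow> 0) improper \<longleftrightarrow> ((\<lambda>p. norm (bal_const s *\<^sub>R I (fst p) (snd p) - w)) \<longlongrightarrow> 0) improper"
      by (rule tendsto_cong)
    then show ?thesis by (simp add: tendsto_norm_zero_iff LIM_zero_iff)
  qed
  have "neg_power XX NN (I_minus AA) s (to_state x) = (THE W. W \<in> XX \<and> ((\<lambda>(\<epsilon>, R). NN (J \<epsilon> R - W)) \<longlongrightarrow> 0) improper)"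
    unfolding neg_power_def Let_def J_def Res_def bal_order_def bal_const_def ..
  also have "\<dots> = to_state (neg_pow s x)"
  proof (rule the_equality)
    show "to_state (neg_pow s x) \<in> XX \<and> ((\<lambda>(\<epsilon>, R). NN (J \<epsilon> R - to_state (neg_pow s x))) \<longlongrightarrow> 0) improper"
      using to_state_in tr[of "neg_pow s x"] L by blast
    fix W assume W: "W \<in> XX \<and> ((\<lambda>(\<epsilon>, R). NN (J \<epsilon> R - W)) \<longlongrightarrow> 0) improper"
    then obtain w where w: "W = to_state w" using to_state_surj by blast
    then have "((\<lambda>p. bal_const s *\<^sub>R I (fst p) (snd p)) \<longlongrightarrow> w) improper" using W tr by blast
    then have "w = neg_pow s x" using tendsto_unique[OF improper_nontrivial _ L] by blast
    then show "W = to_state (neg_pow s x)" by (simp add: w)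
  qed
  finally show ?thesis .
qed

lemma bal_limit_bound:
  fixes Phi :: "'h state \<Rightarrow> 'h state"
  assumes s: "s > 0" and lin: "bounded_linear Phi" and k: "k > 0"
    and B: "\<And>\<epsilon> R. 0 < \<epsilon> \<Longrightarrow> \<epsilon> \<le> k \<Longrightarrow> k \<le> R \<Longrightarrow> norm (Phi (integral {\<epsilon>..R} (integrand s (bal_order s) x))) \<le> B"
  shows "norm (Phi (bal_limit s x)) \<le> B"
proof (rule tendsto_upperbound[OF _ _ improper_nontrivial])
  show "((\<lambda>p. norm (Phi (case p of (\<epsilon>, R) \<Rightarrow> integral {\<epsilon>..R} (integrand s (bal_order s) x)))) \<longlongrightarrow> norm (Phi (bal_limit s x))) improper"
    by (intro tendsto_norm bounded_linear.tendsto[OF lin] bal_limit[OF s])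
  show "\<forall>\<^sub>F p in improper. norm (Phi (case p of (\<epsilon>, R) \<Rightarrow> integral {\<epsilon>..R} (integrand s (bal_order s) x))) \<le> B"
    by (rule eventually_mono[OF eventually_improper[OF k, of k]]) (use B in auto)
qed

text \<open>
  A map \<open>Phi\<close> such as \<open>M^3\<close> of a block applied to the fractional power is estimated from two bounds for
  the powers of the resolvent: one for small \<open>l\<close> and one with decay \<open>l^(-j)\<close> for large \<open>l\<close>. Taking for the
  splitting point \<open>k\<close> the size of the block gives the expected power of \<open>k\<close>.
\<close>

lemma bal_limit_two_scale:
  fixes Phi :: "'h state \<Rightarrow> 'h state"
  assumes s: "s > 0" and lin: "bounded_linear Phi" and k: "k > 0"
    and C: "\<And>l. l > 0 \<Longrightarrow> norm (Phi ((resolv (l + 1) ^^ bal_order s) x)) \<le> C" "C \<ge> 0"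
    and C': "\<And>l. l > 0 \<Longrightarrow> norm (Phi ((resolv (l + 1) ^^ bal_order s) x)) \<le> C' / l ^ j" "C' \<ge> 0" and j: "real (bal_order s) < s + real j"
  shows "norm (Phi (bal_limit s x)) \<le> C * (k powr (real (bal_order s) - s) / (real (bal_order s) - s)) + C' * (k powr (real (bal_order s) - s - real j) / (s + real j - real (bal_order s)))"
proof (rule bal_limit_bound[OF s lin k])
  fix \<epsilon> R assume e: "0 < \<epsilon>" "\<epsilon> \<le> k" "k \<le> R"
  define p where "p = real (bal_order s) - s - 1"
  have "Phi (integral {\<epsilon>..R} (integrand s (bal_order s) x)) = integral {\<epsilon>..R} (Phi \<circ> integrand s (bal_order s) x)"
    by (rule integral_linear[OF integrand_integrable[OF e(1)] lin, symmetric])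
  also have "norm \<dots> \<le> C * (k powr (p + 1) / (p + 1)) + C' * (k powr (p - real j + 1) / (- (p - real j + 1)))"
  proof (rule integral_powr_two_scale[OF e])
    show "(Phi \<circ> integrand s (bal_order s) x) integrable_on {\<epsilon>..R}" by (rule integrable_linear[OF integrand_integrable[OF e(1)] lin])
    show "norm ((Phi \<circ> integrand s (bal_order s) x) l) \<le> C * l powr p" if "l \<in> {\<epsilon>..k}" for l
      using integrand_bound[OF _ C(1) lin, of l s] that e by (simp add: p_def)
    show "norm ((Phi \<circ> integrand s (bal_order s) x) l) \<le> C' * l powr (p - real j)" if "l \<in> {k..R}" for l
    proof -
      have l: "l > 0" using that k by simp
      have "norm ((Phi \<circ> integrand s (bal_order s) x) l) \<le> C' / l ^ j * l powr p"
        using integrand_bound[OF l C'(1)[OF l] lin, of s] by (simp add: p_def)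
      also have "\<dots> = C' * (l powr p / l ^ j)" by simp
      also have "\<dots> = C' * l powr (p - real j)" using powr_times_power[OF l, of "bal_order s" s j] by (simp add: p_def)
      finally show ?thesis .
    qed
  qed (use bal_order_bounds(1)[OF s] j C C' in \<open>auto simp: p_def\<close>)
  finally show "norm (Phi (integral {\<epsilon>..R} (integrand s (bal_order s) x))) \<le> C * (k powr (real (bal_order s) - s) / (real (bal_order s) - s)) + C' * (k powr (real (bal_order s) - s - real j) / (s + real j - real (bal_order s)))"
    by (simp add: p_def algebra_simps)
qed

text \<open>
  Up to the factor \<open>- 1/k\<close> the \<open>k\<close>-th power of the resolvent is an antiderivative of the \<open>(k + 1)\<close>-st, so
  the integral can be evaluated. Bounds for the norm of the integrand do not suffice here: for \<open>s = 3\<close> they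
  would lose a logarithm in \<open>neg_pow_bounds_high\<close>.
\<close>

lemma neg_pow_integer:
  assumes k: "k \<ge> 1"
  shows "neg_pow (real k) x = (resolv 1 ^^ k) x"
proof -
  have nk: "bal_order (real k) = Suc k" by (simp add: bal_order_def)
  have c: "bal_const (real k) = real k"
  proof -
    have "Gamma (real k + 1) = real k * Gamma (real k)" using k by (intro Gamma_plus1) (auto simp: nonpos_Ints_def)
    moreover have "Gamma (real k) > 0" by (rule Gamma_real_pos) (use k in simp)
    ultimately show ?thesis by (simp add: bal_const_def nk add.commute)
  qed
  have int: "integral {\<epsilon>..R} (integrand (real k) (bal_order (real k)) x) = (1 / real k) *\<^sub>R ((resolv (\<epsilon> + 1) ^^ k) x - (resolv (R + 1) ^^ k) x)"
    if e: "0 < \<epsilon>" "\<epsilon> \<le> R" for \<epsilon> R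
  proof -
    have "((\<lambda>l. (resolv (l + 1) ^^ Suc k) x) has_integral (- (1 / real k)) *\<^sub>R (resolv (R + 1) ^^ k) x - (- (1 / real k)) *\<^sub>R (resolv (\<epsilon> + 1) ^^ k) x) {\<epsilon>..R}"
    proof (rule fundamental_theorem_of_calculus[OF e(2)])
      fix l assume l: "l \<in> {\<epsilon>..R}"
      have d1: "((\<lambda>l. l + 1) has_vector_derivative 1) (at l)" by (auto intro!: derivative_eq_intros)
      have d2: "((\<lambda>l. (resolv l ^^ k) x) has_vector_derivative - real k *\<^sub>R (resolv (l + 1) ^^ Suc k) x) (at (l + 1))"
        by (rule resolv_pow_deriv) (use l e in auto)
      have "((\<lambda>l. (resolv l ^^ k) x) \<circ> (\<lambda>l. l + 1) has_vector_derivative 1 *\<^sub>R (- real k *\<^sub>R (resolv (l + 1) ^^ Suc k) x)) (at l)"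
        by (rule vector_diff_chain_at[OF d1 d2])
      then have "((\<lambda>l. (- (1 / real k)) *\<^sub>R (resolv (l + 1) ^^ k) x) has_vector_derivative (- (1 / real k)) *\<^sub>R (- real k *\<^sub>R (resolv (l + 1) ^^ Suc k) x)) (at l)"
        by (intro bounded_linear.has_vector_derivative[OF bounded_linear_scaleR_right]) (simp add: comp_def)
      then show "((\<lambda>l. (- (1 / real k)) *\<^sub>R (resolv (l + 1) ^^ k) x) has_vector_derivative (resolv (l + 1) ^^ Suc k) x) (at l within {\<epsilon>..R})"
        using k by (simp add: has_vector_derivative_at_within)
    qed
    then have "integral {\<epsilon>..R} (\<lambda>l. (resolv (l + 1) ^^ Suc k) x) = (1 / real k) *\<^sub>R ((resolv (\<epsilon> + 1) ^^ k) x - (resolv (R + 1) ^^ k) x)"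
      by (simp add: integral_unique algebra_simps)
    moreover have "integral {\<epsilon>..R} (integrand (real k) (bal_order (real k)) x) = integral {\<epsilon>..R} (\<lambda>l. (resolv (l + 1) ^^ Suc k) x)"
      by (rule integral_cong) (use e in \<open>auto simp: integrand_def nk\<close>)
    ultimately show ?thesis by simp
  qed
  have "((\<lambda>p. (1 / real k) *\<^sub>R ((resolv (fst p + 1) ^^ k) x - (resolv (snd p + 1) ^^ k) x)) \<longlongrightarrow> (1 / real k) *\<^sub>R ((resolv 1 ^^ k) x - 0)) improper"
  proof (intro tendsto_intros)
    have "isCont (\<lambda>l. (resolv l ^^ k) x) 1" using has_vector_derivative_continuous[OF resolv_pow_deriv[of 1 k x]] by simp
    moreover have "((\<lambda>p. fst p + 1) \<longlongrightarrow> 1) improper"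
    proof -
      have "((\<lambda>\<epsilon>. \<epsilon> + 1) \<longlongrightarrow> (0::real) + 1) (at_right 0)" by (intro tendsto_intros)
      then show ?thesis using filterlim_compose[OF _ filterlim_fst] by fastforce
    qed
    ultimately show "((\<lambda>p. (resolv (fst p + 1) ^^ k) x) \<longlongrightarrow> (resolv 1 ^^ k) x) improper"
      using isCont_tendsto_compose by blast
    have "((\<lambda>R. norm x * (1 / R)) \<longlongrightarrow> norm x * 0) at_top"
      by (intro tendsto_intros tendsto_divide_0[OF tendsto_const] filterlim_at_top_imp_at_infinity filterlim_ident)
    then have z: "((\<lambda>p. norm x * (1 / snd p)) \<longlongrightarrow> 0) improper"
      using filterlim_compose[OF _ filterlim_snd, of "\<lambda>R. norm x * (1 / R)"] by simp
    show "((\<lambda>p. (resolv (snd p + 1) ^^ k) x) \<longlongrightarrow> 0) improper"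
    proof (rule Lim_null_comparison[OF _ z], rule eventually_mono[OF eventually_improper[of 1 1]])
      fix p :: "real \<times> real" assume p: "(0 < fst p \<and> fst p \<le> 1) \<and> 1 \<le> snd p"
      have "norm ((resolv (snd p + 1) ^^ k) x) \<le> norm x / (snd p + 1) ^ k" using p by (intro resolv_pow_norm) auto
      also have "\<dots> \<le> norm x / snd p"
      proof (intro divide_left_mono)
        have "snd p \<le> (snd p + 1) ^ 1" by simp
        also have "\<dots> \<le> (snd p + 1) ^ k" using p k by (intro power_increasing) auto
        finally show "snd p \<le> (snd p + 1) ^ k" .
      qed (use p in auto)
      finally show "norm ((resolv (snd p + 1) ^^ k) x) \<le> norm x * (1 / snd p)" by simp
    qed simp
  qed
  moreover have "\<forall>\<^sub>F p in improper. (1 / real k) *\<^sub>R ((resolv (fst p + 1) ^^ k) x - (resolv (snd p + 1) ^^ k) x) = (case p of (\<epsilon>, R) \<Rightarrow> integral {\<epsilon>..R} (integrand (real k) (bal_order (real k)) x))"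
    by (rule eventually_mono[OF eventually_improper[of 1 1]]) (auto simp: int)
  ultimately have "((\<lambda>(\<epsilon>, R). integral {\<epsilon>..R} (integrand (real k) (bal_order (real k)) x)) \<longlongrightarrow> (1 / real k) *\<^sub>R ((resolv 1 ^^ k) x - 0)) improper"
    using tendsto_cong by fastforce
  then have "bal_limit (real k) x = (1 / real k) *\<^sub>R (resolv 1 ^^ k) x"
    using tendsto_unique[OF improper_nontrivial bal_limit[of "real k" x]] k by simp
  then show ?thesis using k by (simp add: neg_pow_def c)
qed

section \<open>Bounds for the fractional powers on a block\<close>

lemma chain_at_norm: "\<exists>C\<ge>1. \<forall>\<mu>\<ge>mu_min. \<forall>y. norm (chain_at \<mu> y) \<le> C * ka \<mu> * norm y"
proof -
  have KK: "K_unif \<ge> 1" using blocks[OF order_refl] by (simp add: damped_chain_def)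
  have "norm (chain_at \<mu> y) \<le> (7 * K_unif\<^sup>2) * ka \<mu> * norm y" if "mu_min \<le> \<mu>" for \<mu> y
    using damped_chain.norm_chain_le[OF blocks[OF that]] .
  moreover have "1 \<le> 7 * K_unif\<^sup>2" using one_le_power[OF KK, of 2] by linarith
  ultimately show ?thesis by blast
qed

text \<open>
  \<open>M R(l) = l R(l) - 1\<close> has norm at most \<open>2\<close>, so each resolvent absorbs one factor \<open>M\<close>.
\<close>

lemma chain_at_resolv:
  assumes l: "l > 0"
  shows "norm (chain_at \<mu> (block \<mu> (resolv l x))) \<le> 2 * norm (block \<mu> x)"
    "norm (chain_at \<mu> (chain_at \<mu> (block \<mu> (resolv l (resolv l x))))) \<le> 4 * norm (block \<mu> x)"
    "norm (chain_at \<mu> (chain_at \<mu> (chain_at \<mu> (block \<mu> (resolv l (resolv l (resolv l x))))))) \<le> 8 * norm (block \<mu> x)"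
proof -
  define G where "G = (\<lambda>z. l *\<^sub>R resolv l z - z)"
  have MG: "chain_at \<mu> (block \<mu> (resolv l z)) = block \<mu> (G z)" for z
    using resolv[OF l, of \<mu> z] by (simp add: G_def block_ops algebra_simps)
  have GR: "G (resolv l z) = resolv l (G z)" for z using l by (simp add: G_def resolv_ops)
  have G2: "norm (block \<mu> (G z)) \<le> 2 * norm (block \<mu> z)" for z using resolv_block_norms(2)[OF l, of \<mu> z] unfolding MG .
  show "norm (chain_at \<mu> (block \<mu> (resolv l x))) \<le> 2 * norm (block \<mu> x)" unfolding MG by (rule G2)
  show "norm (chain_at \<mu> (chain_at \<mu> (block \<mu> (resolv l (resolv l x))))) \<le> 4 * norm (block \<mu> x)"
    unfolding MG GR using G2[of "G x"] G2[of x] by simp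
  show "norm (chain_at \<mu> (chain_at \<mu> (chain_at \<mu> (block \<mu> (resolv l (resolv l (resolv l x))))))) \<le> 8 * norm (block \<mu> x)"
    unfolding MG GR using G2[of "G (G x)"] G2[of "G x"] G2[of x] by simp
qed

end

text \<open>
  Exchanges the exponential decay of a block for a power of time, at the price of a power of the decay
  rate.
\<close>

lemma exp_decay_powr:
  fixes c p y :: real
  assumes "c > 0" "p > 0" "y > 0"
  shows "exp (- c * y) \<le> (p / c) powr p * y powr (- p)"
proof -
  have "c * y / p \<le> exp (c * y / p)" using exp_ge_add_one_self[of "c * y / p"] by linarith
  then have "(c * y / p) powr p \<le> exp (c * y / p) powr p" using assms by (intro powr_mono2) auto
  also have "\<dots> = exp (c * y)" using assms by (simp add: exp_powr_real)
  finally have 1: "(c * y / p) powr p \<le> exp (c * y)" .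
  have 2: "(c * y / p) powr p * ((p / c) powr p * y powr (- p)) = 1"
    using assms by (simp add: powr_mult powr_divide powr_minus field_simps)
  have "exp (- c * y) = exp (- c * y) * ((c * y / p) powr p * ((p / c) powr p * y powr (- p)))" unfolding 2 by simp
  also have "\<dots> = exp (- c * y) * (c * y / p) powr p * ((p / c) powr p * y powr (- p))" by simp
  also have "\<dots> \<le> exp (- c * y) * exp (c * y) * ((p / c) powr p * y powr (- p))"
    using 1 by (intro mult_right_mono mult_left_mono) auto
  also have "exp (- c * y) * exp (c * y) = 1" by (simp add: exp_minus)
  finally show ?thesis by simp
qed

context thermo begin

lemma chain_at_bounded: "bounded_linear (chain_at \<mu>)"
  unfolding chain_def case_prod_unfold by (intro bounded_linear_intros)

lemma neg_pow_bounds_low: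
  assumes s: "s > 1"
  shows "\<exists>C\<ge>0. \<forall>\<mu> x. norm (block \<mu> (neg_pow s x)) \<le> C * norm (block \<mu> x) \<and> norm (chain_at \<mu> (block \<mu> (neg_pow s x))) \<le> C * norm (block \<mu> x)"
proof -
  define n where "n = bal_order s"
  have n: "s < real n" "n \<ge> 2" using bal_order_bounds[of s] s by (auto simp: n_def)
  define C1 where "C1 = \<bar>bal_const s\<bar> * (1 / (real n - s) + 1 / s)"
  define C2 where "C2 = \<bar>bal_const s\<bar> * (2 / (real n - s) + 2 / (s - 1))"
  have p: "0 \<le> C1" "0 \<le> C2" using n s by (auto simp: C1_def C2_def)
  have "norm (block \<mu> (neg_pow s x)) \<le> C1 * norm (block \<mu> x)" for \<mu> x
  proof -
    define N where "N = norm (block \<mu> x)"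
    have "norm (block \<mu> (bal_limit s x)) \<le> N * (1 powr (real (bal_order s) - s) / (real (bal_order s) - s)) + N * (1 powr (real (bal_order s) - s - real n) / (s + real n - real (bal_order s)))"
    proof (rule bal_limit_two_scale[OF _ block_linear])
      fix l :: real assume l: "l > 0"
      have b: "norm (block \<mu> ((resolv (l + 1) ^^ bal_order s) x)) \<le> N / (l + 1) ^ n" using resolv_pow_block_norm[of "l + 1"] l by (simp add: N_def n_def)
      also have "\<dots> \<le> N / 1" using l by (intro divide_left_mono) (auto simp: N_def)
      finally show "norm (block \<mu> ((resolv (l + 1) ^^ bal_order s) x)) \<le> N" by simp
      have "N / (l + 1) ^ n \<le> N / l ^ n" using l by (intro divide_left_mono power_mono) (auto simp: N_def)
      with b show "norm (block \<mu> ((resolv (l + 1) ^^ bal_order s) x)) \<le> N / l ^ n" by linarith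
    qed (use s n in \<open>auto simp: N_def n_def\<close>)
    also have "\<dots> = (1 / (real n - s) + 1 / s) * N" by (simp add: n_def algebra_simps)
    finally have "\<bar>bal_const s\<bar> * norm (block \<mu> (bal_limit s x)) \<le> \<bar>bal_const s\<bar> * ((1 / (real n - s) + 1 / s) * N)" by (intro mult_left_mono) auto
    then show ?thesis by (simp add: neg_pow_def block_ops C1_def N_def mult.assoc)
  qed
  moreover have "norm (chain_at \<mu> (block \<mu> (neg_pow s x))) \<le> C2 * norm (block \<mu> x)" for \<mu> x
  proof -
    define N where "N = 2 * norm (block \<mu> x)"
    obtain n' where n': "n = Suc n'" using n by (cases n) auto
    have "norm (chain_at \<mu> (block \<mu> (bal_limit s x))) \<le> N * (1 powr (real (bal_order s) - s) / (real (bal_order s) - s)) + N * (1 powr (real (bal_order s) - s - real n') / (s + real n' - real (bal_order s)))"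
    proof (rule bal_limit_two_scale[OF _ bounded_linear_compose[OF chain_at_bounded block_linear]])
      fix l :: real assume l: "l > 0"
      have "norm (chain_at \<mu> (block \<mu> ((resolv (l + 1) ^^ bal_order s) x))) \<le> 2 * norm (block \<mu> ((resolv (l + 1) ^^ n') x))"
        using chain_at_resolv(1)[of "l + 1"] l by (simp add: n_def[symmetric] n')
      also have "\<dots> \<le> 2 * (norm (block \<mu> x) / (l + 1) ^ n')" using l by (intro mult_left_mono resolv_pow_block_norm) auto
      finally have b: "norm (chain_at \<mu> (block \<mu> ((resolv (l + 1) ^^ bal_order s) x))) \<le> N / (l + 1) ^ n'" by (simp add: N_def)
      also have "\<dots> \<le> N / 1" using l by (intro divide_left_mono) (auto simp: N_def)
      finally show "norm (chain_at \<mu> (block \<mu> ((resolv (l + 1) ^^ bal_order s) x))) \<le> N" by simp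
      have "N / (l + 1) ^ n' \<le> N / l ^ n'" using l by (intro divide_left_mono power_mono) (auto simp: N_def)
      with b show "norm (chain_at \<mu> (block \<mu> ((resolv (l + 1) ^^ bal_order s) x))) \<le> N / l ^ n'" by linarith
    qed (use s n n' in \<open>auto simp: N_def n_def\<close>)
    also have "\<dots> = (2 / (real n - s) + 2 / (s - 1)) * norm (block \<mu> x)" by (simp add: n_def[symmetric] n' N_def algebra_simps)
    finally have "\<bar>bal_const s\<bar> * norm (chain_at \<mu> (block \<mu> (bal_limit s x))) \<le> \<bar>bal_const s\<bar> * ((2 / (real n - s) + 2 / (s - 1)) * norm (block \<mu> x))" by (intro mult_left_mono) auto
    then show ?thesis by (simp add: neg_pow_def block_ops chain_at_ops C2_def mult.assoc)
  qed
  moreover have "a \<le> (C1 + C2) * norm z" if "a \<le> C1 * norm z" for a and z :: "'h state"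
    using that mult_nonneg_nonneg[OF p(2) norm_ge_zero[of z]] unfolding distrib_right by linarith
  moreover have "a \<le> (C1 + C2) * norm z" if "a \<le> C2 * norm z" for a and z :: "'h state"
    using that mult_nonneg_nonneg[OF p(1) norm_ge_zero[of z]] unfolding distrib_right by linarith
  ultimately show ?thesis using p by (intro exI[of _ "C1 + C2"]) auto
qed

text \<open>
  For \<open>s\<close> not an integer the integer \<open>n\<close> in Balakrishnan's formula is \<open>2\<close> or \<open>3\<close>. For small \<open>l\<close> all \<open>n\<close>
  resolvents absorb a factor of \<open>M\<close>, which leaves \<open>\<kappa>^(3 - n)\<close>; for large \<open>l\<close> the factors of \<open>M\<close> cost
  \<open>\<kappa>^3\<close> and the resolvents give \<open>l^(-n)\<close>. Both parts have order \<open>\<kappa>^(3 - s)\<close> if the integral is split at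
  \<open>\<kappa>\<close>.
\<close>

lemma neg_pow_bounds_high:
  assumes s: "s > 1" "s \<le> 3"
  shows "\<exists>C\<ge>0. \<forall>\<mu>\<ge>mu_min. \<forall>x. norm (chain_at \<mu> (chain_at \<mu> (chain_at \<mu> (block \<mu> (neg_pow s x))))) \<le> C * ka \<mu> powr (3 - s) * norm (block \<mu> x)"
proof -
  obtain c where c: "c \<ge> 1" "\<And>\<mu> y. mu_min \<le> \<mu> \<Longrightarrow> norm (chain_at \<mu> y) \<le> c * ka \<mu> * norm y" using chain_at_norm by blast
  have "s = 2 \<or> s = 3" if "s \<in> \<int>"
  proof -
    from that obtain i where i: "s = of_int i" by (rule Ints_cases)
    then have "1 < i" "i \<le> 3" using s by linarith+
    then have "i = 2 \<or> i = 3" by presburger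
    then show ?thesis using i by auto
  qed
  then consider "s = 2" | "s = 3" | "s \<notin> \<int>" by blast
  then show ?thesis
  proof cases
    case 1
    have "norm (chain_at \<mu> (chain_at \<mu> (chain_at \<mu> (block \<mu> (neg_pow s x))))) \<le> (4 * c) * ka \<mu> powr (3 - s) * norm (block \<mu> x)" if mu: "mu_min \<le> \<mu>" for \<mu> x
    proof -
      have Y2: "neg_pow s x = resolv 1 (resolv 1 x)" using neg_pow_integer[of 2 x] by (simp add: 1 numeral_2_eq_2)
      have k: "ka \<mu> > 0" by (rule coeff_bounds(7)[OF mu])
      have "norm (chain_at \<mu> (chain_at \<mu> (chain_at \<mu> (block \<mu> (neg_pow s x))))) \<le> c * ka \<mu> * norm (chain_at \<mu> (chain_at \<mu> (block \<mu> (neg_pow s x))))" by (rule c(2)[OF mu])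
      also have "\<dots> \<le> c * ka \<mu> * (4 * norm (block \<mu> x))" using k c(1) unfolding Y2 by (intro mult_left_mono chain_at_resolv) auto
      finally show ?thesis using k by (simp add: 1 mult_ac)
    qed
    then show ?thesis using c(1) by (intro exI[of _ "4 * c"]) auto
  next
    case 2
    have "norm (chain_at \<mu> (chain_at \<mu> (chain_at \<mu> (block \<mu> (neg_pow s x))))) \<le> 8 * ka \<mu> powr (3 - s) * norm (block \<mu> x)" if mu: "mu_min \<le> \<mu>" for \<mu> x
    proof -
      have Y3: "neg_pow s x = resolv 1 (resolv 1 (resolv 1 x))" using neg_pow_integer[of 3 x] by (simp add: 2 numeral_3_eq_3)
      have k: "ka \<mu> > 0" by (rule coeff_bounds(7)[OF mu])
      show ?thesis unfolding Y3 using chain_at_resolv(3)[of 1 \<mu> x] k by (simp add: 2)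
    qed
    then show ?thesis by (intro exI[of _ 8]) auto
  next
    case 3
    define n where "n = bal_order s"
    have s3: "s \<noteq> 2" "s < 3" using 3 s(2) by (auto simp: order_less_le)
    have n: "s < real n" "n \<ge> 2" using bal_order_bounds[of s] s by (auto simp: n_def)
    have n23: "n = 2 \<or> n = 3" using n s3 bal_order_bounds(2)[of s] s by (simp add: n_def[symmetric]) linarith
    define C where "C = \<bar>bal_const s\<bar> * (8 * c / (real n - s) + c ^ 3 / s)"
    have "norm (chain_at \<mu> (chain_at \<mu> (chain_at \<mu> (block \<mu> (neg_pow s x))))) \<le> C * ka \<mu> powr (3 - s) * norm (block \<mu> x)" if mu: "mu_min \<le> \<mu>" for \<mu> x
    proof -
      define k where "k = ka \<mu>"
      have k: "k > 0" unfolding k_def by (rule coeff_bounds(7)[OF mu])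
      have c2: "norm (chain_at \<mu> y) \<le> c * k * norm y" for y unfolding k_def by (rule c(2)[OF mu])
      define N where "N = norm (block \<mu> x)"
      have N: "N \<ge> 0" by (simp add: N_def)
      define D where "D = 8 * c * k ^ (3 - n) * N"
      define D' where "D' = (c * k) ^ 3 * N"
      have "norm (chain_at \<mu> (chain_at \<mu> (chain_at \<mu> (block \<mu> (bal_limit s x))))) \<le> D * (k powr (real (bal_order s) - s) / (real (bal_order s) - s)) + D' * (k powr (real (bal_order s) - s - real n) / (s + real n - real (bal_order s)))"
      proof (rule bal_limit_two_scale[OF _ bounded_linear_compose[OF chain_at_bounded bounded_linear_compose[OF chain_at_bounded bounded_linear_compose[OF chain_at_bounded block_linear]]] k])
        fix l :: real assume l: "l > 0"
        have l1: "l + 1 > 0" using l by simp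
        show "norm (chain_at \<mu> (chain_at \<mu> (chain_at \<mu> (block \<mu> ((resolv (l + 1) ^^ bal_order s) x))))) \<le> D"
          using n23
        proof
          assume n2: "n = 2"
          have R: "(resolv (l + 1) ^^ bal_order s) x = resolv (l + 1) (resolv (l + 1) x)" using n2 by (simp add: n_def[symmetric] numeral_2_eq_2)
          have "norm (chain_at \<mu> (chain_at \<mu> (chain_at \<mu> (block \<mu> ((resolv (l + 1) ^^ bal_order s) x))))) \<le> c * k * norm (chain_at \<mu> (chain_at \<mu> (block \<mu> ((resolv (l + 1) ^^ bal_order s) x))))" by (rule c2)
          also have "\<dots> \<le> c * k * (4 * N)" using k c(1) unfolding R N_def by (intro mult_left_mono chain_at_resolv l1) auto
          also have "\<dots> \<le> c * k * (8 * N)" using k c(1) N by (intro mult_left_mono) auto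
          also have "\<dots> = D" by (simp add: D_def n2)
          finally show ?thesis .
        next
          assume n3: "n = 3"
          have R: "(resolv (l + 1) ^^ bal_order s) x = resolv (l + 1) (resolv (l + 1) (resolv (l + 1) x))" using n3 by (simp add: n_def[symmetric] numeral_3_eq_3)
          have "norm (chain_at \<mu> (chain_at \<mu> (chain_at \<mu> (block \<mu> ((resolv (l + 1) ^^ bal_order s) x))))) \<le> 1 * (8 * N)" unfolding R N_def using chain_at_resolv(3)[OF l1] by simp
          also have "\<dots> \<le> c * (8 * N)" using c(1) N by (intro mult_right_mono) auto
          also have "\<dots> = D" by (simp add: D_def n3)
          finally show ?thesis .
        qed
        have "norm (chain_at \<mu> (chain_at \<mu> (chain_at \<mu> (block \<mu> ((resolv (l + 1) ^^ bal_order s) x))))) \<le> c * k * (c * k * (c * k * norm (block \<mu> ((resolv (l + 1) ^^ bal_order s) x))))"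
          by (rule order.trans[OF c2 mult_left_mono[OF order.trans[OF c2 mult_left_mono[OF c2]]]]) (use k c(1) in auto)
        also have "\<dots> = (c * k) ^ 3 * norm (block \<mu> ((resolv (l + 1) ^^ bal_order s) x))" by (simp add: power3_eq_cube)
        also have "\<dots> \<le> (c * k) ^ 3 * (N / (l + 1) ^ n)"
          using resolv_pow_block_norm[OF l1] k c(1) by (intro mult_left_mono) (auto simp: N_def n_def)
        also have "\<dots> \<le> (c * k) ^ 3 * (N / l ^ n)" using l k c(1) N by (intro mult_left_mono divide_left_mono power_mono) auto
        finally show "norm (chain_at \<mu> (chain_at \<mu> (chain_at \<mu> (block \<mu> ((resolv (l + 1) ^^ bal_order s) x))))) \<le> D' / l ^ n" by (simp add: D'_def)
      qed (use s n k c(1) N in \<open>auto simp: n_def D_def D'_def\<close>)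
      also have "\<dots> = (8 * c / (real n - s)) * (k ^ (3 - n) * k powr (real n - s)) * N + (c ^ 3 / s) * (k ^ 3 * k powr (- s)) * N"
        by (simp add: n_def[symmetric] D_def D'_def power_mult_distrib mult_ac)
      also have "k ^ (3 - n) * k powr (real n - s) = k powr (3 - s)"
        using n23 k by (subst powr_realpow[symmetric]) (auto simp: powr_add[symmetric])
      also have "k ^ 3 * k powr (- s) = k powr (3 - s)"
      proof -
        have "k ^ 3 = k powr 3" using k by simp
        then show ?thesis by (simp only: powr_add[symmetric]) simp
      qed
      also have "(8 * c / (real n - s)) * k powr (3 - s) * N + (c ^ 3 / s) * k powr (3 - s) * N = (8 * c / (real n - s) + c ^ 3 / s) * k powr (3 - s) * N"
        by (simp add: distrib_right)
      finally have "\<bar>bal_const s\<bar> * norm (chain_at \<mu> (chain_at \<mu> (chain_at \<mu> (block \<mu> (bal_limit s x))))) \<le> \<bar>bal_const s\<bar> * ((8 * c / (real n - s) + c ^ 3 / s) * k powr (3 - s) * N)" by (intro mult_left_mono) auto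
      then show ?thesis by (simp add: neg_pow_def block_ops chain_at_ops C_def N_def k_def mult.assoc)
    qed
    moreover have "C \<ge> 0" using n s c(1) by (auto simp: C_def)
    ultimately show ?thesis by blast
  qed
qed

lemma neg_pow_gen_dom: assumes "s > 1" shows "neg_pow s x \<in> gen_dom"
proof -
  obtain C where C: "C \<ge> 0" "\<And>\<mu> x. norm (chain_at \<mu> (block \<mu> (neg_pow s x))) \<le> C * norm (block \<mu> x)" using neg_pow_bounds_low[OF assms] by blast
  show ?thesis unfolding gen_dom_def mem_Collect_eq
    by (rule summable_mono[OF has_sum_imp_summable[OF block_parseval[of x]] zero_le_power2]) (rule norm_sq_le[OF C])
qed

definition "rate_exp = 2 * (2 * \<alpha> - \<beta> - \<gamma>) / (2 * \<alpha> - \<gamma>)"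

lemma rate_exp: "rate_exp > 0" "rate_exp \<le> 2" "(\<alpha> - \<gamma> / 2) * rate_exp = 2 * \<alpha> - \<beta> - \<gamma>" "\<alpha> - \<gamma> / 2 > 0" "2 * \<alpha> - \<beta> - \<gamma> > 0"
proof -
  show p: "\<alpha> - \<gamma> / 2 > 0" "2 * \<alpha> - \<beta> - \<gamma> > 0" using par by auto
  then have q: "2 * \<alpha> - \<gamma> > 0" by simp
  show "rate_exp > 0" using p q by (simp add: rate_exp_def)
  show "rate_exp \<le> 2" using q par by (simp add: rate_exp_def pos_divide_le_eq)
  show "(\<alpha> - \<gamma> / 2) * rate_exp = 2 * \<alpha> - \<beta> - \<gamma>" using q by (simp add: rate_exp_def field_simps)
qed

text \<open>
  The damping rate of the fast pair in terms of its frequency. This is where the exponent \<open>b\<close> of the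
  theorem comes from: \<open>\<kappa>\<close> behaves like \<open>\<mu>^(\<alpha> - \<gamma>/2)\<close> and \<open>(\<nu>/\<kappa>)\<^sup>2\<close> like \<open>\<mu>^(-(2\<alpha> - \<beta> - \<gamma>))\<close>.
\<close>

lemma rate_lower: "\<exists>c>0. \<forall>\<mu>\<ge>mu_min. c * ka \<mu> powr (- rate_exp) \<le> (nu \<mu> / ka \<mu>)\<^sup>2"
proof -
  have cp: "mass_const > 0" using mass_bounds(3) by blast
  define a where "a = (sqrt m / sqrt \<tau>)\<^sup>2"
  define d where "d = (1 / sqrt mass_const) powr (- rate_exp)"
  have ad: "a > 0" "d > 0" using mst cp by (auto simp: a_def d_def)
  have "a / d * ka \<mu> powr (- rate_exp) \<le> (nu \<mu> / ka \<mu>)\<^sup>2" if mu: "mu_min \<le> \<mu>" for \<mu>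
  proof -
    have mu0: "\<mu> > 0" using mu mu_min(1) by simp
    have "ka \<mu> powr (- rate_exp) \<le> (1 / sqrt mass_const * \<mu> powr (\<alpha> - \<gamma> / 2)) powr (- rate_exp)"
      using coeff_bounds(2)[OF mu] rate_exp mu0 cp by (intro powr_mono2') auto
    also have "\<dots> = d * \<mu> powr (- (2 * \<alpha> - \<beta> - \<gamma>))"
    proof -
      have "(\<mu> powr (\<alpha> - \<gamma> / 2)) powr (- rate_exp) = \<mu> powr (- (2 * \<alpha> - \<beta> - \<gamma>))"
        unfolding rate_exp(3)[symmetric] by (simp add: powr_powr)
      then show ?thesis unfolding d_def using cp by (subst powr_mult) auto
    qed
    finally have "a / d * ka \<mu> powr (- rate_exp) \<le> a / d * (d * \<mu> powr (- (2 * \<alpha> - \<beta> - \<gamma>)))" using ad by (intro mult_left_mono) auto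
    also have "\<dots> = (sqrt m / sqrt \<tau> * \<mu> powr (\<beta> / 2 + \<gamma> / 2 - \<alpha>))\<^sup>2"
    proof -
      have "(\<mu> powr (\<beta> / 2 + \<gamma> / 2 - \<alpha>))\<^sup>2 = \<mu> powr (- (2 * \<alpha> - \<beta> - \<gamma>))"
        by (simp add: power2_eq_square powr_add[symmetric] algebra_simps)
      then show ?thesis using ad(2) unfolding a_def power_mult_distrib by simp
    qed
    also have "\<dots> \<le> (nu \<mu> / ka \<mu>)\<^sup>2" using nu_ka(2)[OF mu] mst by (intro power_mono) auto
    finally show ?thesis .
  qed
  then show ?thesis using ad by (intro exI[of _ "a / d"]) auto
qed

lemma rate_upper: "\<exists>C>0. \<forall>\<mu>\<ge>mu_min. (nu \<mu> / ka \<mu>)\<^sup>2 \<le> C * \<mu> powr (- (2 * \<alpha> - \<beta> - \<gamma>))"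
proof -
  have cp: "mass_const > 0" using mass_bounds(3) by blast
  define a where "a = (sqrt mass_const / sqrt \<tau>)\<^sup>2"
  have "(nu \<mu> / ka \<mu>)\<^sup>2 \<le> a * \<mu> powr (- (2 * \<alpha> - \<beta> - \<gamma>))" if mu: "mu_min \<le> \<mu>" for \<mu>
  proof -
    have "(nu \<mu> / ka \<mu>)\<^sup>2 \<le> (sqrt mass_const / sqrt \<tau> * \<mu> powr (\<beta> / 2 + \<gamma> / 2 - \<alpha>))\<^sup>2"
      using nu_ka(1)[OF mu] coeff_bounds[OF mu] by (intro power_mono) (auto intro: less_imp_le)
    also have "\<dots> = a * \<mu> powr (- (2 * \<alpha> - \<beta> - \<gamma>))"
    proof -
      have "(\<mu> powr (\<beta> / 2 + \<gamma> / 2 - \<alpha>))\<^sup>2 = \<mu> powr (- (2 * \<alpha> - \<beta> - \<gamma>))"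
        by (simp add: power2_eq_square powr_add[symmetric] algebra_simps)
      then show ?thesis unfolding a_def power_mult_distrib by simp
    qed
    finally show ?thesis .
  qed
  moreover have "a > 0" using cp mst by (simp add: a_def)
  ultimately show ?thesis by blast
qed

end

context thermo_semigroup begin

section \<open>Upper bounds for the decay\<close>

lemma block_space_ops: "x \<in> block_space \<mu> \<Longrightarrow> y \<in> block_space \<mu> \<Longrightarrow> x + y \<in> block_space \<mu>" "x \<in> block_space \<mu> \<Longrightarrow> c *\<^sub>R x \<in> block_space \<mu>" "x \<in> block_space \<mu> \<Longrightarrow> y \<in> block_space \<mu> \<Longrightarrow> x - y \<in> block_space \<mu>"
  by (cases x; cases y; auto simp: block_space_def E_closed_ops)+

lemma chain_at_commute_flow: "is_flow (chain_at \<mu>) v \<Longrightarrow> is_flow (chain_at \<mu>) (\<lambda>t. chain_at \<mu> (v t))"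
  by (rule is_flow_image[OF _ chain_at_bounded]) auto

text \<open>
  On a block \<open>freq_sq M = slow - M^3\<close> is applied to the solution with initial value
  \<open>(I - M)^(-s) x\<close>. The slow term is at most \<open>C \<kappa>\<^sup>2 / t\<close> by duality, and the cubic one at most
  \<open>C \<kappa>^(3 - s) exp (- c \<kappa>^(-b) t)\<close>, hence at most \<open>C \<kappa>\<^sup>2 t^(-(s - 1)/b)\<close>. Division by
  \<open>freq_sq \<ge> \<kappa>\<^sup>2\<close> removes \<open>\<kappa>\<close>.
\<close>

lemma block_decay:
  assumes s: "s > 1" "s \<le> 3"
  shows "\<exists>C\<ge>0. \<forall>\<mu> x. \<forall>t>0. norm (chain_at \<mu> (block \<mu> (S t (neg_pow s x)))) \<le> C * (1 / t + t powr (- ((s - 1) / rate_exp))) * norm (block \<mu> x)"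
proof -
  obtain C1 where C1: "C1 \<ge> 0" "\<And>\<mu> x. norm (block \<mu> (neg_pow s x)) \<le> C1 * norm (block \<mu> x)" using neg_pow_bounds_low[OF s(1)] by blast
  obtain C2 where C2: "C2 \<ge> 0" "\<And>\<mu> x. mu_min \<le> \<mu> \<Longrightarrow> norm (chain_at \<mu> (chain_at \<mu> (chain_at \<mu> (block \<mu> (neg_pow s x))))) \<le> C2 * ka \<mu> powr (3 - s) * norm (block \<mu> x)"
    using neg_pow_bounds_high[OF s] by blast
  obtain c where c: "c > 0" "\<And>\<mu>. mu_min \<le> \<mu> \<Longrightarrow> c * ka \<mu> powr (- rate_exp) \<le> (nu \<mu> / ka \<mu>)\<^sup>2" using rate_lower by blast
  define p where "p = (s - 1) / rate_exp"
  have p: "p > 0" using s rate_exp by (simp add: p_def)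
  interpret B: damped_chain "om mu_min" "ka mu_min" "nu mu_min" de K_unif by (rule blocks) simp
  define cN where "cN = B.cN"
  have cNe: "damped_chain.cN K_unif = cN" by (simp add: cN_def)
  have cN1: "cN \<ge> 1" using B.cA_pos by (simp add: cN_def)
  define c' where "c' = c / (8 * K_unif\<^sup>2 * cN) / 2"
  have c': "c' > 0" using c(1) cN1 B.K1 by (simp add: c'_def)
  define D1 where "D1 = 80 * K_unif^5 * cN * C1"
  define D2 where "D2 = sqrt (2 * cN) * C2 * (p / c') powr p"
  have D: "D1 \<ge> 0" "D2 \<ge> 0" using C1 C2 cN1 B.K1 by (auto simp: D1_def D2_def)
  have main: "norm (chain_at \<mu> (block \<mu> (S t (neg_pow s x)))) \<le> (D1 / t + D2 * t powr (- p)) * norm (block \<mu> x)" if t: "t > 0" for \<mu> x t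
  proof (cases "mu_min \<le> \<mu>")
    case mu: True
    interpret damped_chain "om \<mu>" "ka \<mu>" "nu \<mu>" de K_unif by (rule blocks[OF mu])
    define k where "k = ka \<mu>"
    have k: "k > 0" using pos by (simp add: k_def)
    define N where "N = norm (block \<mu> x)"
    define v where "v = (\<lambda>t. block \<mu> (S t (neg_pow s x)))"
    have vE: "v t \<in> block_space \<mu>" for t unfolding v_def by (rule block_in)
    have fl: "is_flow M v" unfolding v_def by (rule S_flow[OF neg_pow_gen_dom[OF s(1)]])
    have v0: "v 0 = block \<mu> (neg_pow s x)" by (simp add: v_def S_0)
    \<comment> \<open>The dual solution has to exist in the same block, so its initial value must be
      a quadruple of eigenvectors.\<close>
    have "slow (v t) \<in> block_space \<mu>" unfolding slow_def by (intro block_space_ops block_space_chain vE)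
    then have "flip (slow (v t)) \<in> block_space \<mu>" by (cases "slow (v t)") (auto simp: flip_def block_space_def E_closed_ops)
    then obtain y where y: "is_flow M y" "y 0 = flip (slow (v t))" using flow_ex by blast
    have "t * norm (slow (v t)) \<le> (80 * K_unif^5 * cN) * k\<^sup>2 * norm (v 0)"
      using slow_flow_decay[OF fl y] t by (simp add: cNe k_def)
    also have "\<dots> \<le> (80 * K_unif^5 * cN) * k\<^sup>2 * (C1 * N)"
      unfolding v0 N_def using C1(2) B.K1 cN1 by (intro mult_left_mono) auto
    finally have "t * norm (slow (v t)) \<le> k\<^sup>2 * (D1 * N)" by (simp add: D1_def mult_ac)
    then have sl: "norm (slow (v t)) \<le> k\<^sup>2 * (D1 / t * N)" using t by (simp add: field_simps)
    have "is_flow M (\<lambda>t. M (M (M (v t))))" by (intro chain_at_commute_flow fl)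
    then have "(norm (M (M (M (v t)))))\<^sup>2 \<le> 2 * cN * exp (- ((nu \<mu> / ka \<mu>)\<^sup>2 / (8 * K_unif\<^sup>2 * cN)) * t) * (norm (M (M (M (v 0)))))\<^sup>2"
      using flow_decay[of "\<lambda>t. M (M (M (v t)))" t] t by (simp add: cNe s_def)
    also have "\<dots> \<le> 2 * cN * exp (- (2 * c') * (k powr (- rate_exp) * t)) * (C2 * k powr (3 - s) * N)\<^sup>2"
    proof (intro mult_mono power_mono mult_left_mono)
      have "c * k powr (- rate_exp) / (8 * K_unif\<^sup>2 * cN) * t \<le> (nu \<mu> / ka \<mu>)\<^sup>2 / (8 * K_unif\<^sup>2 * cN) * t"
        using c(2)[OF mu] cN1 t by (intro mult_right_mono divide_right_mono) (auto simp: k_def)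
      then show "exp (- ((nu \<mu> / ka \<mu>)\<^sup>2 / (8 * K_unif\<^sup>2 * cN)) * t) \<le> exp (- (2 * c') * (k powr (- rate_exp) * t))"
      proof -
        have "(2 * c') * (k powr (- rate_exp) * t) = c * k powr (- rate_exp) / (8 * K_unif\<^sup>2 * cN) * t" by (simp add: c'_def mult_ac)
        then have "(2 * c') * (k powr (- rate_exp) * t) \<le> (nu \<mu> / ka \<mu>)\<^sup>2 / (8 * K_unif\<^sup>2 * cN) * t"
          using \<open>c * k powr (- rate_exp) / (8 * K_unif\<^sup>2 * cN) * t \<le> (nu \<mu> / ka \<mu>)\<^sup>2 / (8 * K_unif\<^sup>2 * cN) * t\<close> by linarith
        then show ?thesis unfolding exp_le_cancel_iff mult_minus_left neg_le_iff_le .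
      qed
      show "norm (M (M (M (v 0)))) \<le> C2 * k powr (3 - s) * N" unfolding v0 k_def N_def by (rule C2(2)[OF mu])
    qed (use cN1 in auto)
    also have "exp (- (2 * c') * (k powr (- rate_exp) * t)) = (exp (- c' * (k powr (- rate_exp) * t)))\<^sup>2"
      by (simp add: power2_eq_square exp_add[symmetric])
    also have "2 * cN * (exp (- c' * (k powr (- rate_exp) * t)))\<^sup>2 * (C2 * k powr (3 - s) * N)\<^sup>2 =
      (sqrt (2 * cN) * exp (- c' * (k powr (- rate_exp) * t)) * (C2 * k powr (3 - s) * N))\<^sup>2"
      using cN1 by (simp add: power_mult_distrib)
    finally have "norm (M (M (M (v t)))) \<le> sqrt (2 * cN) * exp (- c' * (k powr (- rate_exp) * t)) * (C2 * k powr (3 - s) * N)"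
      by (rule power2_le_imp_le) (use C2(1) cN1 in \<open>auto simp: N_def\<close>)
    also have "\<dots> \<le> sqrt (2 * cN) * ((p / c') powr p * (k powr (- rate_exp) * t) powr (- p)) * (C2 * k powr (3 - s) * N)"
      using exp_decay_powr[OF c' p, of "k powr (- rate_exp) * t"] k t C2(1) cN1 by (intro mult_right_mono mult_left_mono) (auto simp: N_def)
    also have "(k powr (- rate_exp) * t) powr (- p) = k powr (s - 1) * t powr (- p)"
      using k t rate_exp(1) by (simp add: powr_mult powr_powr p_def)
    also have "sqrt (2 * cN) * ((p / c') powr p * (k powr (s - 1) * t powr (- p))) * (C2 * k powr (3 - s) * N)
      = (k powr (s - 1) * k powr (3 - s)) * (D2 * t powr (- p) * N)" by (simp add: D2_def)
    also have "k powr (s - 1) * k powr (3 - s) = k\<^sup>2" using k by (simp add: powr_add[symmetric])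
    finally have fa: "norm (M (M (M (v t)))) \<le> k\<^sup>2 * (D2 * t powr (- p) * N)" .
    have "freq_sq *\<^sub>R M (v t) = slow (v t) - M (M (M (v t)))" by (simp add: slow_def)
    then have "norm (freq_sq *\<^sub>R M (v t)) \<le> norm (slow (v t)) + norm (M (M (M (v t))))"
      by (simp only: norm_triangle_ineq4)
    moreover have "freq_sq \<ge> 0" by (rule order.trans[OF zero_le_power2 freq_sq_ge])
    ultimately have "freq_sq * norm (M (v t)) \<le> norm (slow (v t)) + norm (M (M (M (v t))))" by simp
    moreover have "k\<^sup>2 * norm (M (v t)) \<le> freq_sq * norm (M (v t))" using freq_sq_ge by (intro mult_right_mono) (auto simp: k_def)
    ultimately have "k\<^sup>2 * norm (M (v t)) \<le> k\<^sup>2 * ((D1 / t + D2 * t powr (- p)) * N)"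
      using sl fa by (simp add: distrib_right distrib_left)
    then show ?thesis using k by (simp add: v_def N_def)
  qed (simp add: block_off_spectrum linear_0[OF linear_chain])
  have combine: "(D1 / t + D2 * t powr (- p)) * n \<le> (D1 + D2) * (1 / t + t powr (- p)) * n" if "t > 0" "n \<ge> 0" for t n :: real
  proof (rule mult_right_mono[OF _ that(2)])
    have "(D1 + D2) * (1 / t + t powr - p) = (D1 / t + D2 * t powr - p) + (D2 / t + D1 * t powr - p)"
      by (simp add: distrib_left distrib_right add_divide_distrib)
    moreover have "0 \<le> D2 / t + D1 * t powr - p" using D that by simp
    ultimately show "D1 / t + D2 * t powr - p \<le> (D1 + D2) * (1 / t + t powr - p)" by linarith
  qed
  have "norm (chain_at \<mu> (block \<mu> (S t (neg_pow s x)))) \<le> (D1 + D2) * (1 / t + t powr (- p)) * norm (block \<mu> x)" if "t > 0" for \<mu> x t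
    by (rule order.trans[OF main[OF that] combine[OF that norm_ge_zero]])
  then show ?thesis using D unfolding p_def by (intro exI[of _ "D1 + D2"]) auto
qed

abbreviation "decay s t \<equiv> op_norm XX NN (\<lambda>U. T t (opfun AA (neg_power XX NN (I_minus AA) s U)))"

lemma decay_value:
  assumes "s > 1" "t \<ge> 0"
  shows "NN (T t (opfun AA (neg_power XX NN (I_minus AA) s (to_state x)))) = norm (gen (S t (neg_pow s x)))"
  using assms by (simp add: neg_power_eq T_gen[OF neg_pow_gen_dom])

lemma decay_le:
  assumes s: "s > 1" "s \<le> 3"
  shows "\<exists>C\<ge>0. \<forall>t>0. decay s t \<le> ereal (C * (1 / t + t powr (- ((s - 1) / rate_exp))))"
proof -
  obtain C where C: "C \<ge> 0" "\<And>\<mu> x t. t > 0 \<Longrightarrow> norm (chain_at \<mu> (block \<mu> (S t (neg_pow s x)))) \<le> C * (1 / t + t powr (- ((s - 1) / rate_exp))) * norm (block \<mu> x)"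
    using block_decay[OF s] by blast
  have "decay s t \<le> ereal (C * (1 / t + t powr (- ((s - 1) / rate_exp))))" if t: "t > 0" for t
    unfolding op_norm_def
  proof (rule SUP_least)
    fix U assume "U \<in> {U \<in> XX. NN U \<le> 1}"
    then have U: "U \<in> XX" "NN U \<le> 1" by auto
    obtain x where "to_state x = U" using to_state_surj[OF U(1)] by blast
    then have x: "U = to_state x" "norm x \<le> 1" using U(2) to_state_norm[of x] by auto
    define r where "r = C * (1 / t + t powr (- ((s - 1) / rate_exp)))"
    have r: "r \<ge> 0" using C(1) t by (simp add: r_def)
    have SD: "S t (neg_pow s x) \<in> gen_dom" using S_gen_dom(1)[OF neg_pow_gen_dom[OF s(1)]] t by simp
    have "norm (gen (S t (neg_pow s x))) \<le> r * norm x"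
      by (rule block_norm_le_blockwise[OF r]) (use C(2)[OF t] in \<open>simp add: block_gen[OF SD] r_def\<close>)
    also have "\<dots> \<le> r * 1" using x(2) r by (intro mult_left_mono)
    finally show "ereal (NN (T t (opfun AA (neg_power XX NN (I_minus AA) s U)))) \<le> ereal r"
      using decay_value[OF s(1), of t x] t by (simp add: x(1))
  qed
  then show ?thesis using C(1) by blast
qed

lemma decay_ge:
  assumes t: "t \<ge> 0" and s: "s > 1" and x: "norm x > 0"
  shows "ereal (norm (gen (S t (neg_pow s x))) / norm x) \<le> decay s t"
proof -
  define y where "y = (1 / norm x) *\<^sub>R x"
  have Yl: "neg_pow s y = (1 / norm x) *\<^sub>R neg_pow s x"
  proof -
    have "((\<lambda>(\<epsilon>, R). integral {\<epsilon>..R} (integrand s (bal_order s) y)) \<longlongrightarrow> (1 / norm x) *\<^sub>R bal_limit s x) improper"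
    proof -
      have "((\<lambda>p. (1 / norm x) *\<^sub>R (case p of (\<epsilon>, R) \<Rightarrow> integral {\<epsilon>..R} (integrand s (bal_order s) x))) \<longlongrightarrow> (1 / norm x) *\<^sub>R bal_limit s x) improper"
        using s by (intro tendsto_intros bal_limit) auto
      moreover have "\<forall>\<^sub>F p in improper. (1 / norm x) *\<^sub>R (case p of (\<epsilon>, R) \<Rightarrow> integral {\<epsilon>..R} (integrand s (bal_order s) x)) = (case p of (\<epsilon>, R) \<Rightarrow> integral {\<epsilon>..R} (integrand s (bal_order s) y))"
      proof (rule eventually_mono[OF eventually_improper[of 1 1]])
        fix p :: "real \<times> real" assume p: "(0 < fst p \<and> fst p \<le> 1) \<and> 1 \<le> snd p"
        have pw: "(resolv l ^^ n) (c *\<^sub>R z) = c *\<^sub>R (resolv l ^^ n) z" if "l > 0" for l n c z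
          by (induction n) (simp_all add: resolv_ops that)
        have "integral {fst p..snd p} (integrand s (bal_order s) y) = integral {fst p..snd p} (\<lambda>l. (1 / norm x) *\<^sub>R integrand s (bal_order s) x l)"
          by (rule integral_cong) (use p in \<open>auto simp: integrand_def y_def pw\<close>)
        then show "(1 / norm x) *\<^sub>R (case p of (\<epsilon>, R) \<Rightarrow> integral {\<epsilon>..R} (integrand s (bal_order s) x)) = (case p of (\<epsilon>, R) \<Rightarrow> integral {\<epsilon>..R} (integrand s (bal_order s) y))"
          by (simp add: case_prod_unfold)
      qed simp
      ultimately show ?thesis using tendsto_cong by fastforce
    qed
    then have "bal_limit s y = (1 / norm x) *\<^sub>R bal_limit s x" using tendsto_unique[OF improper_nontrivial bal_limit] s by simp
    then show ?thesis by (simp add: neg_pow_def)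
  qed
  have "gen (S t (neg_pow s y)) = (1 / norm x) *\<^sub>R gen (S t (neg_pow s x))"
  proof (rule block_ext)
    fix \<mu>
    have SD: "S t (neg_pow s x) \<in> gen_dom" "S t (neg_pow s y) \<in> gen_dom" using S_gen_dom(1)[OF neg_pow_gen_dom[OF s] t] by auto
    have "S t (neg_pow s y) = (1 / norm x) *\<^sub>R S t (neg_pow s x)" unfolding Yl by (rule linear_scale[OF S_linear[OF t]])
    then show "block \<mu> (gen (S t (neg_pow s y))) = block \<mu> ((1 / norm x) *\<^sub>R gen (S t (neg_pow s x)))"
      unfolding block_gen[OF SD(2)] block_ops block_gen[OF SD(1)] by (simp add: block_ops chain_at_ops)
  qed
  then have eq: "norm (gen (S t (neg_pow s x))) / norm x = NN (T t (opfun AA (neg_power XX NN (I_minus AA) s (to_state y))))"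
    using decay_value[OF s t, of y] by simp
  have "to_state y \<in> {U \<in> XX. NN U \<le> 1}" using x to_state_in by (simp add: to_state_norm y_def)
  then show ?thesis unfolding eq op_norm_def by (rule SUP_upper)
qed

section \<open>Slowly decaying solutions\<close>

text \<open>
  The test vector is chosen such that \<open>(I - \<A>)^(-2)\<close> maps it to a unit vector with only a \<open>p\<close> component in one
  block. Applying the generator of the block to that vector gives a quadruple with entries in \<open>w\<close> and \<open>\<theta>\<close>
  only, whose two slow coordinates vanish.
\<close>

lemma slow_decay_witness:
  "\<exists>c>0. \<exists>c0>0. \<forall>\<mu>. E \<mu> \<noteq> {0} \<longrightarrow> (\<exists>t\<ge>c * \<mu> powr (2 * \<alpha> - \<beta> - \<gamma>). ereal (c0 * \<mu> powr (- (\<alpha> - \<gamma> / 2))) \<le> decay 2 t)"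
proof -
  obtain C where C: "C \<ge> 1" "\<And>\<mu> y. mu_min \<le> \<mu> \<Longrightarrow> norm (chain_at \<mu> y) \<le> C * ka \<mu> * norm y" using chain_at_norm by blast
  obtain R where R: "R > 0" "\<And>\<mu>. mu_min \<le> \<mu> \<Longrightarrow> (nu \<mu> / ka \<mu>)\<^sup>2 \<le> R * \<mu> powr (- (2 * \<alpha> - \<beta> - \<gamma>))" using rate_upper by blast
  interpret B: damped_chain "om mu_min" "ka mu_min" "nu mu_min" de K_unif by (rule blocks) simp
  have K1: "K_unif \<ge> 1" by (rule B.K1)
  define c where "c = 1 / (576 * K_unif^9 * R)"
  define c0 where "c0 = sqrt m / (2 * (K_unif + C)\<^sup>2)"
  have c: "c > 0" "c0 > 0" using K1 R C mst by (auto simp: c_def c0_def)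
  have "\<exists>t\<ge>c * \<mu> powr (2 * \<alpha> - \<beta> - \<gamma>). ereal (c0 * \<mu> powr (- (\<alpha> - \<gamma> / 2))) \<le> decay 2 t" if spec: "E \<mu> \<noteq> {0}" for \<mu>
  proof -
    have mu: "mu_min \<le> \<mu>" by (rule mu_min(2)[OF spec])
    have mu0: "\<mu> > 0" using mu mu_min(1) by simp
    interpret damped_chain "om \<mu>" "ka \<mu>" "nu \<mu>" de K_unif by (rule blocks[OF mu])
    define k where "k = ka \<mu>"
    have k: "k > 0" using pos by (simp add: k_def)
    obtain e0 where e0: "e0 \<in> E \<mu>" "norm e0 = 1" using unit_vector[OF spec] by blast
    define y :: "'h state" where "y = (0, e0, 0, 0)"
    have yE: "y \<in> block_space \<mu>" using e0 by (simp add: y_def block_space_def E_closed_ops)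
    have ny: "norm y = 1" using norm_quad[of 0 e0 0 0] e0 by (simp add: y_def norm_Pair)
    define y1 where "y1 = y - M y"
    define y2 where "y2 = y1 - M y1"
    have E12: "y1 \<in> block_space \<mu>" "y2 \<in> block_space \<mu>" unfolding y1_def y2_def by (intro block_space_ops block_space_chain yE)+
    obtain x where x: "x \<in> gen_dom" "\<And>\<nu>. block \<nu> x = (if \<nu> = \<mu> then y else 0)" using block_vector_ex[OF yE] by blast
    obtain x1 where x1: "\<And>\<nu>. block \<nu> x1 = (if \<nu> = \<mu> then y1 else 0)" using block_vector_ex[OF E12(1)] by blast
    obtain x2 where x2: "\<And>\<nu>. block \<nu> x2 = (if \<nu> = \<mu> then y2 else 0)" using block_vector_ex[OF E12(2)] by blast
    have "resolv 1 x2 = x1" by (rule resolv_unique) (auto simp: x1 x2 y2_def linear_0[OF linear_chain])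
    moreover have "resolv 1 x1 = x" by (rule resolv_unique) (auto simp: x1 x y1_def linear_0[OF linear_chain])
    ultimately have Y2: "neg_pow 2 x2 = x" using neg_pow_integer[of 2 x2] by (simp add: numeral_2_eq_2)
    have step: "norm (z - M z) \<le> (K_unif + C) * k * norm z" for z :: "'h state"
    proof -
      have "norm (z - M z) \<le> norm z + norm (M z)" by (rule norm_triangle_ineq4)
      also have "\<dots> \<le> (K_unif * k) * norm z + C * k * norm z"
        using C(2)[OF mu, of z] ka_ge mult_right_mono[of 1 "K_unif * k" "norm z"] by (intro add_mono) (auto simp: k_def)
      finally show ?thesis by (simp add: algebra_simps)
    qed
    have nx2: "norm x2 \<le> ((K_unif + C) * k)\<^sup>2"
    proof -
      have "norm x2 \<le> norm y2 * norm x"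
      proof (rule block_norm_le_blockwise)
        show "norm (block \<nu> x2) \<le> norm y2 * norm (block \<nu> x)" for \<nu> by (simp add: x2 x ny)
      qed simp
      moreover have "norm x \<le> 1 * norm x" by simp
      moreover have "(norm x)\<^sup>2 = 1"
      proof -
        have "((\<lambda>\<nu>. (norm (block \<nu> x))\<^sup>2) has_sum (norm y)\<^sup>2) {\<mu>}" by (simp add: x has_sum_finiteI)
        then have "((\<lambda>\<nu>. (norm (block \<nu> x))\<^sup>2) has_sum (norm y)\<^sup>2) UNIV"
          by (rule has_sum_cong_neutral[THEN iffD1, rotated -1]) (auto simp: x)
        then show ?thesis using has_sum_unique[OF block_parseval] ny by fastforce
      qed
      then have "norm x = 1 \<or> norm x = - 1" by (simp only: power2_eq_1_iff)
      then have "norm x = 1" using norm_ge_zero[of x] by linarith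
      ultimately have "norm x2 \<le> norm y2" by simp
      also have "\<dots> \<le> (K_unif + C) * k * norm y1" unfolding y2_def by (rule step)
      also have "\<dots> \<le> (K_unif + C) * k * ((K_unif + C) * k * norm y)" unfolding y1_def using k K1 C(1) by (intro mult_left_mono step) auto
      finally show ?thesis by (simp add: ny power2_eq_square)
    qed
    \<comment> \<open>The time at which the lower bound for the energy has dropped to one
      half.\<close>
    define t where "t = 1 / (576 * K_unif^9 * s\<^sup>2)"
    have t0: "t > 0" using K1 s_bounds(1) by (simp add: t_def)
    have tl: "c * \<mu> powr (2 * \<alpha> - \<beta> - \<gamma>) \<le> t"
    proof -
      have "s\<^sup>2 \<le> R * \<mu> powr (- (2 * \<alpha> - \<beta> - \<gamma>))" using R(2)[OF mu] by (simp add: s_def)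
      then have "1 / (576 * K_unif^9 * (R * \<mu> powr (- (2 * \<alpha> - \<beta> - \<gamma>)))) \<le> t"
        unfolding t_def using K1 R(1) mu0 s_bounds(1) by (intro divide_left_mono mult_left_mono) auto
      moreover define G where "G = 2 * \<alpha> - \<beta> - \<gamma>"
      moreover have "1 / (576 * K_unif^9 * (R * \<mu> powr (- G))) = c * \<mu> powr G"
        unfolding c_def powr_minus_divide by simp
      ultimately show ?thesis by simp
    qed
    define z where "z = (\<lambda>t. M (block \<mu> (S t x)))"
    have zf: "is_flow M z" unfolding z_def by (rule chain_at_commute_flow[OF S_flow[OF x(1)]])
    have z0: "z 0 = (om \<mu> *\<^sub>R e0, 0, - (ka \<mu> *\<^sub>R e0), 0)" by (simp add: z_def S_0 x y_def chain_def)
    have w0: "slow_w (z 0) = 0" "slow_r (z 0) = 0" using pos by (simp_all add: z0 slow_w_def slow_r_def)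
    have "norm (z 0) \<ge> k"
    proof -
      have "(norm (z 0))\<^sup>2 = (om \<mu>)\<^sup>2 + k\<^sup>2" unfolding z0 norm_quad by (simp add: e0 k_def)
      then have "k\<^sup>2 \<le> (norm (z 0))\<^sup>2" by simp
      then show ?thesis by (rule power2_le_imp_le) simp
    qed
    then have kz: "k\<^sup>2 \<le> (norm (z 0))\<^sup>2" using k by (intro power_mono) auto
    have half: "1 - 288 * K_unif^9 * s\<^sup>2 * t = 1 / 2" using K1 s_bounds(1) by (simp add: t_def)
    have "1 / 2 * (norm (z 0))\<^sup>2 \<le> (norm (z t))\<^sup>2"
      unfolding half[symmetric] by (rule flow_lower_bound[OF zf _ w0]) (use t0 in simp)
    moreover have "(k / 2)\<^sup>2 = k\<^sup>2 / 4" by (simp add: power_divide)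
    ultimately have "(k / 2)\<^sup>2 \<le> (norm (z t))\<^sup>2" using kz zero_le_power2[of k] by linarith
    then have zt: "k / 2 \<le> norm (z t)" by (rule power2_le_imp_le) simp
    have SD: "S t x \<in> gen_dom" using S_gen_dom(1)[OF x(1)] t0 by simp
    have "k / 2 \<le> norm (block \<mu> (gen (S t (neg_pow 2 x2))))" unfolding Y2 block_gen[OF SD] using zt by (simp add: z_def)
    also have "\<dots> \<le> norm (gen (S t (neg_pow 2 x2)))" by (rule block_norm)
    finally have g: "k / 2 \<le> norm (gen (S t (neg_pow 2 x2)))" .
    have x2p: "norm x2 > 0"
    proof (rule ccontr)
      assume "\<not> norm x2 > 0"
      then have "resolv 1 (resolv 1 x2) = 0" using linear_0[OF bounded_linear.linear[OF resolv_linear[of 1]]] by simp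
      then have "x = 0" using Y2 neg_pow_integer[of 2 x2] by (simp add: numeral_2_eq_2)
      then have "y = 0" using x(2)[of \<mu>] linear_0[OF bounded_linear.linear[OF block_linear]] by simp
      then show False using ny by simp
    qed
    have "c0 * \<mu> powr (- (\<alpha> - \<gamma> / 2)) \<le> (k / 2) / ((K_unif + C) * k)\<^sup>2"
    proof -
      have "k \<le> 1 / sqrt m * \<mu> powr (\<alpha> - \<gamma> / 2)" using coeff_bounds(1)[OF mu] by (simp add: k_def)
      then have "k * (sqrt m * \<mu> powr (- (\<alpha> - \<gamma> / 2))) \<le> 1 / sqrt m * \<mu> powr (\<alpha> - \<gamma> / 2) * (sqrt m * \<mu> powr (- (\<alpha> - \<gamma> / 2)))"
        using mst by (intro mult_right_mono) auto
      also have "\<dots> = 1" using mst mu0 by (simp add: powr_add[symmetric])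
      finally have "sqrt m * \<mu> powr (- (\<alpha> - \<gamma> / 2)) \<le> 1 / k" using k by (simp add: field_simps)
      then have "sqrt m * \<mu> powr (- (\<alpha> - \<gamma> / 2)) / (2 * (K_unif + C)\<^sup>2) \<le> 1 / k / (2 * (K_unif + C)\<^sup>2)" by (intro divide_right_mono) auto
      then show ?thesis using k by (simp add: c0_def power2_eq_square mult_ac)
    qed
    also have "\<dots> \<le> (k / 2) / norm x2" using nx2 x2p k K1 C(1) by (intro divide_left_mono) auto
    also have "\<dots> \<le> norm (gen (S t (neg_pow 2 x2))) / norm x2" using g by (intro divide_right_mono) auto
    finally have "ereal (c0 * \<mu> powr (- (\<alpha> - \<gamma> / 2))) \<le> ereal (norm (gen (S t (neg_pow 2 x2))) / norm x2)" by simp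
    also have "\<dots> \<le> decay 2 t" by (rule decay_ge) (use t0 x2p in auto)
    finally show ?thesis using tl by blast
  qed
  then show ?thesis using c by blast
qed

text \<open>
  A faster rate contradicts the witnesses along the unbounded sequence of eigenvalues: at some time
  \<open>t \<ge> c \<mu>^r\<close> with \<open>r = 2\<alpha> - \<beta> - \<gamma>\<close> the norm is at least \<open>c0 \<mu>^(-r/b)\<close>.
\<close>

lemma decay_not_faster:
  assumes inf: "\<not> (\<exists>B::'h set. finite B \<and> complex_vector.span B = UNIV)" and d: "\<delta> > 0"
  shows "\<not> (\<forall>\<^sub>F t in at_top. decay 2 t \<le> ereal (C * t powr (- 1 / rate_exp - \<delta>)))"
proof
  assume "\<forall>\<^sub>F t in at_top. decay 2 t \<le> ereal (C * t powr (- 1 / rate_exp - \<delta>))"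
  then obtain t0 where t0: "\<And>t. t \<ge> t0 \<Longrightarrow> decay 2 t \<le> ereal (C * t powr (- 1 / rate_exp - \<delta>))" by (auto simp: eventually_at_top_linorder)
  from slow_decay_witness obtain c c0 where c: "c > 0" "c0 > 0" and w: "\<forall>\<mu>. E \<mu> \<noteq> {0} \<longrightarrow> (\<exists>t\<ge>c * \<mu> powr (2 * \<alpha> - \<beta> - \<gamma>). ereal (c0 * \<mu> powr (- (\<alpha> - \<gamma> / 2))) \<le> decay 2 t)"
    by (elim exE conjE)
  define r where "r = 2 * \<alpha> - \<beta> - \<gamma>"
  have r: "r > 0" "r / rate_exp = \<alpha> - \<gamma> / 2" using rate_exp by (auto simp: r_def field_simps)
  define q where "q = - 1 / rate_exp - \<delta>"
  have "1 / rate_exp > 0" using rate_exp(1) by simp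
  then have q: "q < 0" using d unfolding q_def by linarith
  define D where "D = (\<bar>C\<bar> + 1) * c powr q"
  have D: "D > 0" using c by (simp add: D_def)
  obtain \<mu>0 where mu0: "\<mu>0 > 0" "c * \<mu>0 powr r \<ge> t0" "c0 * \<mu>0 powr (r * \<delta>) > D"
  proof -
    define z1 z2 where "z1 = \<bar>t0\<bar> / c + 1" "z2 = D / c0 + 1"
    have z: "z1 > 0" "z2 > 0" "c * z1 \<ge> t0" "c0 * z2 > D"
      using c D by (auto simp: z1_z2_def distrib_left intro: add_nonneg_pos)
    define \<mu>0 where "\<mu>0 = max (z1 powr (1 / r)) (z2 powr (1 / (r * \<delta>)))"
    have "(z1 powr (1 / r)) powr r \<le> \<mu>0 powr r" using r z by (intro powr_mono2) (auto simp: \<mu>0_def)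
    then have "z1 \<le> \<mu>0 powr r" using r z by (simp add: powr_powr)
    then have "c * z1 \<le> c * \<mu>0 powr r" using c by (intro mult_left_mono) auto
    moreover have "(z2 powr (1 / (r * \<delta>))) powr (r * \<delta>) \<le> \<mu>0 powr (r * \<delta>)" using r d z by (intro powr_mono2) (auto simp: \<mu>0_def)
    then have "z2 \<le> \<mu>0 powr (r * \<delta>)" using r d z by (simp add: powr_powr)
    then have "c0 * z2 \<le> c0 * \<mu>0 powr (r * \<delta>)" using c by (intro mult_left_mono) auto
    moreover have "\<mu>0 > 0" using z by (simp add: \<mu>0_def less_max_iff_disj)
    ultimately show ?thesis using that[of \<mu>0] z(3,4) by linarith
  qed
  from spectrum_unbounded[OF inf, of \<mu>0] obtain \<mu> where mu: "\<mu> > \<mu>0" "E \<mu> \<noteq> {0}" by (elim exE conjE)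
  have m0: "\<mu> > 0" using mu mu0 by simp
  obtain t where t: "t \<ge> c * \<mu> powr r" "ereal (c0 * \<mu> powr (- (\<alpha> - \<gamma> / 2))) \<le> decay 2 t"
    using w[rule_format, OF mu(2)] unfolding r_def by (elim exE conjE)
  have "\<mu>0 powr r \<le> \<mu> powr r" using mu mu0 r by (intro powr_mono2) auto
  then have "c * \<mu>0 powr r \<le> c * \<mu> powr r" using c(1) by (intro mult_left_mono) auto
  then have "t0 \<le> t" using mu0(2) t(1) by linarith
  from order.trans[OF t(2) t0[OF this]] have "ereal (c0 * \<mu> powr (- (\<alpha> - \<gamma> / 2))) \<le> ereal (C * t powr q)" unfolding q_def .
  then have "c0 * \<mu> powr (- (\<alpha> - \<gamma> / 2)) \<le> C * t powr q" by simp
  also have "\<dots> \<le> (\<bar>C\<bar> + 1) * t powr q" by (intro mult_right_mono) auto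
  also have "\<dots> \<le> (\<bar>C\<bar> + 1) * (c * \<mu> powr r) powr q" using t(1) c m0 q by (intro mult_left_mono powr_mono2') auto
  also have "\<dots> = D * \<mu> powr (r * q)" using c by (simp add: D_def powr_mult powr_powr)
  also have "r * q = - (\<alpha> - \<gamma> / 2) + - (r * \<delta>)" unfolding r(2)[symmetric] by (simp add: q_def algebra_simps)
  also have "\<mu> powr (- (\<alpha> - \<gamma> / 2) + - (r * \<delta>)) = \<mu> powr (- (\<alpha> - \<gamma> / 2)) * \<mu> powr (- (r * \<delta>))" by (rule powr_add)
  finally have "\<mu> powr (- (\<alpha> - \<gamma> / 2)) * c0 \<le> \<mu> powr (- (\<alpha> - \<gamma> / 2)) * (D * \<mu> powr (- (r * \<delta>)))" by (simp add: mult_ac)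
  then have "c0 \<le> D * \<mu> powr (- (r * \<delta>))" using m0 by simp
  then have "c0 * \<mu> powr (r * \<delta>) \<le> D" using m0 by (simp add: powr_minus field_simps)
  moreover have "c0 * \<mu>0 powr (r * \<delta>) \<le> c0 * \<mu> powr (r * \<delta>)" using mu mu0 r d c by (intro mult_left_mono powr_mono2) auto
  ultimately show False using mu0(3) by simp
qed

end

section \<open>The decay rates\<close>

theorem theorem2p5:
  fixes A :: "'h::chilbert_space operator"
    and m \<sigma> \<tau> \<alpha> \<beta> \<gamma> :: real
    and T :: "real \<Rightarrow> 'h state \<Rightarrow> 'h state"
  assumes infinite_dimensional: "\<not> (\<exists>B::'h set. finite B \<and> complex_vector.span B = UNIV)"
    and "selfadjoint A" and "positive_definite A" and "compact_resolvent A"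
    and "m > 0" and "\<sigma> > 0" and "\<tau> > 0"
    and "(\<alpha>, \<beta>, \<gamma>) \<in> param_region"
    and "contraction_semigroup (energy_space A \<gamma>) (energy_norm A \<sigma> m \<tau> \<gamma>) T"
    and "is_generator (energy_space A \<gamma>) (energy_norm A \<sigma> m \<tau> \<gamma>) T (system_op A \<sigma> m \<tau> \<alpha> \<beta> \<gamma>)"
  shows
    "let X = energy_space A \<gamma>;
         N = energy_norm A \<sigma> m \<tau> \<gamma>;
         \<A> = system_op A \<sigma> m \<tau> \<alpha> \<beta> \<gamma>;
         b = 2 * (2 * \<alpha> - \<beta> - \<gamma>) / (2 * \<alpha> - \<gamma>);
         a = max 1 b;
         decay = (\<lambda>s t. op_norm X N (\<lambda>U. T t (opfun \<A> (neg_power X N (I_minus \<A>) s U))))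
     in (\<exists>C. \<forall>t\<ge>1. decay (1 + b) t \<le> ereal (C * t powr (-1))) \<and>
        (\<exists>C. \<forall>t\<ge>1. decay 2 t \<le> ereal (C * t powr (-1 / a))) \<and>
        (\<alpha> \<ge> \<beta> + \<gamma> / 2 \<longrightarrow>
           \<not> (\<exists>\<delta>>0. \<exists>C. \<forall>\<^sub>F t in at_top. decay 2 t \<le> ereal (C * t powr (-1 / a - \<delta>))))"
proof -
  interpret thermo_semigroup A m \<sigma> \<tau> \<alpha> \<beta> \<gamma> T
    by unfold_locales (use assms in auto)
  have 1: "\<exists>C. \<forall>t\<ge>1. decay (1 + rate_exp) t \<le> ereal (C * t powr (-1))"
  proof -
    obtain C where C: "C \<ge> 0" "\<And>t. t > 0 \<Longrightarrow> decay (1 + rate_exp) t \<le> ereal (C * (1 / t + t powr (- ((1 + rate_exp - 1) / rate_exp))))"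
      using decay_le[of "1 + rate_exp"] rate_exp(1,2) by auto
    have "decay (1 + rate_exp) t \<le> ereal (2 * C * t powr (-1))" if "t \<ge> 1" for t
      using C(2)[of t] that rate_exp(1) by (simp add: powr_minus divide_inverse mult_ac)
    then show ?thesis by blast
  qed
  have 2: "\<exists>C. \<forall>t\<ge>1. decay 2 t \<le> ereal (C * t powr (-1 / max 1 rate_exp))"
  proof -
    obtain C where C: "C \<ge> 0" "\<And>t. t > 0 \<Longrightarrow> decay 2 t \<le> ereal (C * (1 / t + t powr (- ((2 - 1) / rate_exp))))"
      using decay_le[of 2] by auto
    have "decay 2 t \<le> ereal (2 * C * t powr (-1 / max 1 rate_exp))" if t: "t \<ge> 1" for t
    proof -
      have "t powr (-1) \<le> t powr (-1 / max 1 rate_exp)" "t powr (- ((2 - 1) / rate_exp)) \<le> t powr (-1 / max 1 rate_exp)"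
        using t rate_exp(1) by (intro powr_mono; auto simp: field_simps max_def)+
      moreover have "t powr (-1) = 1 / t" using t by (simp add: powr_minus divide_inverse)
      ultimately have "C * (1 / t + t powr (- ((2 - 1) / rate_exp))) \<le> C * (t powr (-1 / max 1 rate_exp) + t powr (-1 / max 1 rate_exp))"
        using C(1) by (intro mult_left_mono add_mono) auto
      then have "ereal (C * (1 / t + t powr (- ((2 - 1) / rate_exp)))) \<le> ereal (2 * C * t powr (-1 / max 1 rate_exp))" by simp
      then show ?thesis using C(2)[of t] t order_trans by (meson less_le_trans zero_less_one)
    qed
    then show ?thesis by blast
  qed
  have 3: "\<not> (\<exists>\<delta>>0. \<exists>C. \<forall>\<^sub>F t in at_top. decay 2 t \<le> ereal (C * t powr (-1 / max 1 rate_exp - \<delta>)))" if "\<alpha> \<ge> \<beta> + \<gamma> / 2"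
  proof -
    have "rate_exp \<ge> 1" using that rate_exp(4) by (simp add: rate_exp_def le_divide_eq)
    then have "max 1 rate_exp = rate_exp" by simp
    then show ?thesis using decay_not_faster[OF infinite_dimensional] by simp
  qed
  show ?thesis unfolding Let_def rate_exp_def[symmetric] using 1 2 3 by blast
qed

end
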